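(* Let $G = SU(2)\times SU(2) = S^3\times S^3$, and let $g$ be a left-invariant Einstein metric on $G$ that is invariant under a non-trivial finite subgroup $\Gamma\subset \mathrm{Ad}(G)$ such that $\Gamma\not\cong\mathbb{Z}_2$. Then $(G,g)$ is homothetic to $(G,g_{can})$ or to $(G,g_{NK})$.
   Context: All metrics are Riemannian. $S^3\cong SU(2)$ is the group of unit quaternions. A metric $g$ is Einstein if $Ric_g=\lambda g$ for some constant $\lambda\in\mathbb{R}$. Left-invariant metrics on $G$ are identified with scalar products on the Lie algebra $\mathfrak{g}=\mathfrak{su}(2)\oplus\mathfrak{su}(2)$, and $\mathrm{Ad}(G)\cong SO(3)\times SO(3)$ is the image of the adjoint representation of $G$ on $\mathfrak{g}$. A left-invariant metric is invariant under $\Gamma\subset\mathrm{Ad}(G)$ if the corresponding scalar product on $\mathfrak{g}$ is $\Gamma$-invariant. Two Riemannian manifolds are homothetic if they are isometric after multiplying one of the metrics by a positive constant. The standard metric $g_{can}$ is the product of the two canonical (unit round) metrics on the $S^3$-factors. The nearly Kähler metric $g_{NK}$ (considered up to scale) is described as follows. Let $Q=-\tfrac12 B$, where $B(X,Y)=\mathrm{tr}(\mathrm{ad}(X)\mathrm{ad}(Y))$ is the Killing form of $\mathfrak{g}$, and let $(E_1,E_2,E_3)$, $(F_1,F_2,F_3)$ be oriented $Q$-orthonormal bases of the two $\mathfrak{su}(2)$-factors (so $[E_1,E_2]=E_3$, $[F_1,F_2]=F_3$ and cyclic). Then $g_{NK}$ is the left-invariant metric for which the vectors $X_i=\frac{\sqrt[4]{3}}{\sqrt2}E_i$,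 $Y_i=\frac{1}{\sqrt2\sqrt[4]{3}}E_i+\frac{\sqrt2}{\sqrt[4]{3}}F_i$ ($i=1,2,3$) form an orthonormal basis of $\mathfrak{g}$. *)

theory Defs
  imports "HOL-Analysis.Analysis" "HOL-Algebra.Bij" "HOL-Algebra.Elementary_Groups"
begin

section \<open>Smooth submanifolds of a Euclidean space\<close>

text \<open>
  Throughout, \<open>M\<close> is (the point set of) an embedded submanifold of a Euclidean space.
  Functions, vector fields and metrics on \<open>M\<close> are represented by total functions on
  the ambient space; only their values at points of \<open>M\<close> and on tangent vectors matter.
\<close>

primrec Ck_on :: "nat \<Rightarrow> 'a::euclidean_space set \<Rightarrow> ('a \<Rightarrow> 'b::euclidean_space) \<Rightarrow> bool" where
  "Ck_on 0 = (\<lambda>U f. continuous_on U f)"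
| "Ck_on (Suc k) = (\<lambda>U f. (\<forall>x\<in>U. f differentiable (at x)) \<and>
      (\<forall>v. Ck_on k U (\<lambda>x. frechet_derivative f (at x) v)))"

definition smooth :: "'a::euclidean_space set \<Rightarrow> ('a \<Rightarrow> 'b::euclidean_space) \<Rightarrow> bool" where
  "smooth M f \<longleftrightarrow> (\<exists>U F. open U \<and> M \<subseteq> U \<and> (\<forall>k. Ck_on k U F) \<and> (\<forall>x\<in>M. F x = f x))"

definition tangent_space :: "'a::euclidean_space set \<Rightarrow> 'a \<Rightarrow> 'a set" where
  "tangent_space M p =
     {v. \<exists>\<gamma> :: real \<Rightarrow> 'a. (\<forall>t. \<gamma> t \<in> M) \<and> \<gamma> 0 = p \<and> (\<gamma> has_vector_derivative v) (at 0)}"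

text \<open>
  A derivative within \<open>M\<close> is not unique as a linear map on the ambient space, but its
  restriction to \<open>tangent_space M p\<close> is, and \<open>differential\<close> is only ever applied
  to tangent vectors.
\<close>

definition differential ::
  "'a::euclidean_space set \<Rightarrow> ('a \<Rightarrow> 'b::euclidean_space) \<Rightarrow> 'a \<Rightarrow> 'a \<Rightarrow> 'b" where
  "differential M f p v = frechet_derivative f (at p within M) v"

definition vector_fields :: "'a::euclidean_space set \<Rightarrow> ('a \<Rightarrow> 'a) set" where
  "vector_fields M = {X. smooth M X \<and> (\<forall>p\<in>M. X p \<in> tangent_space M p)}"

text \<open>
  The bracket with \<open>[X, Y] f = X (Y f) - Y (X f)\<close>, evaluated on the ambient coordinate
  functions.
\<close>

definition vf_bracket ::
  "'a::euclidean_space set \<Rightarrow> ('a \<Rightarrow> 'a) \<Rightarrow> ('a \<Rightarrow> 'a) \<Rightarrow> 'a \<Rightarrow> 'a" where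
  "vf_bracket M X Y p = differential M Y p (X p) - differential M X p (Y p)"

definition diffeomorphism ::
  "'a::euclidean_space set \<Rightarrow> 'b::euclidean_space set \<Rightarrow> ('a \<Rightarrow> 'b) \<Rightarrow> bool" where
  "diffeomorphism M N \<phi> \<longleftrightarrow> bij_betw \<phi> M N \<and> smooth M \<phi> \<and> smooth N (inv_into M \<phi>)"


section \<open>Riemannian metrics\<close>

type_synonym 'a metric_tensor = "'a \<Rightarrow> 'a \<Rightarrow> 'a \<Rightarrow> real"

definition scalar_product_on :: "'a::real_vector set \<Rightarrow> ('a \<Rightarrow> 'a \<Rightarrow> real) \<Rightarrow> bool" where
  "scalar_product_on V b \<longleftrightarrow>
     (\<forall>u\<in>V. \<forall>v\<in>V. \<forall>w\<in>V. b (u + v) w = b u w + b v w) \<and>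
     (\<forall>c. \<forall>u\<in>V. \<forall>v\<in>V. b (c *\<^sub>R u) v = c * b u v) \<and>
     (\<forall>u\<in>V. \<forall>v\<in>V. b u v = b v u) \<and>
     (\<forall>u\<in>V. u \<noteq> 0 \<longrightarrow> b u u > 0)"

definition riemannian_metric ::
  "'a::euclidean_space set \<Rightarrow> 'a metric_tensor \<Rightarrow> bool" where
  "riemannian_metric M g \<longleftrightarrow>
     (\<forall>p\<in>M. scalar_product_on (tangent_space M p) (g p)) \<and>
     (\<forall>X\<in>vector_fields M. \<forall>Y\<in>vector_fields M. smooth M (\<lambda>p. g p (X p) (Y p)))"

definition isometry ::
  "'a::euclidean_space set \<Rightarrow> 'a metric_tensor \<Rightarrow>
   'b::euclidean_space set \<Rightarrow> 'b metric_tensor \<Rightarrow> ('a \<Rightarrow> 'b) \<Rightarrow> bool" where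
  "isometry M g N h \<phi> \<longleftrightarrow> diffeomorphism M N \<phi> \<and>
     (\<forall>p\<in>M. \<forall>u\<in>tangent_space M p. \<forall>v\<in>tangent_space M p.
        h (\<phi> p) (differential M \<phi> p u) (differential M \<phi> p v) = g p u v)"

definition homothetic ::
  "'a::euclidean_space set \<Rightarrow> 'a metric_tensor \<Rightarrow>
   'b::euclidean_space set \<Rightarrow> 'b metric_tensor \<Rightarrow> bool" where
  "homothetic M g N h \<longleftrightarrow> (\<exists>c>0. \<exists>\<phi>. isometry M (\<lambda>p u v. c * g p u v) N h \<phi>)"


section \<open>Levi-Civita connection and Ricci tensor\<close>

definition affine_connection ::
  "'a::euclidean_space set \<Rightarrow> (('a \<Rightarrow> 'a) \<Rightarrow> ('a \<Rightarrow> 'a) \<Rightarrow> ('a \<Rightarrow> 'a)) \<Rightarrow> bool" where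
  "affine_connection M D \<longleftrightarrow>
     (\<forall>X\<in>vector_fields M. \<forall>Y\<in>vector_fields M. D X Y \<in> vector_fields M) \<and>
     (\<forall>X\<in>vector_fields M. \<forall>Y\<in>vector_fields M. \<forall>Z\<in>vector_fields M. \<forall>p\<in>M.
        D (\<lambda>q. X q + Y q) Z p = D X Z p + D Y Z p \<and>
        D X (\<lambda>q. Y q + Z q) p = D X Y p + D X Z p) \<and>
     (\<forall>f :: 'a \<Rightarrow> real. smooth M f \<longrightarrow>
        (\<forall>X\<in>vector_fields M. \<forall>Y\<in>vector_fields M. \<forall>p\<in>M.
           D (\<lambda>q. f q *\<^sub>R X q) Y p = f p *\<^sub>R D X Y p \<and>
           D X (\<lambda>q. f q *\<^sub>R Y q) p = differential M f p (X p) *\<^sub>R Y p + f p *\<^sub>R D X Y p))"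

definition levi_civita_connection ::
  "'a::euclidean_space set \<Rightarrow> 'a metric_tensor \<Rightarrow>
   (('a \<Rightarrow> 'a) \<Rightarrow> ('a \<Rightarrow> 'a) \<Rightarrow> ('a \<Rightarrow> 'a)) \<Rightarrow> bool" where
  "levi_civita_connection M g D \<longleftrightarrow> affine_connection M D \<and>
     (\<forall>X\<in>vector_fields M. \<forall>Y\<in>vector_fields M. \<forall>p\<in>M.
        D X Y p - D Y X p = vf_bracket M X Y p) \<and>
     (\<forall>X\<in>vector_fields M. \<forall>Y\<in>vector_fields M. \<forall>Z\<in>vector_fields M. \<forall>p\<in>M.
        differential M (\<lambda>q. g q (Y q) (Z q)) p (X p) = g p (D X Y p) (Z p) + g p (Y p) (D X Z p))"

definition curvature ::
  "'a::euclidean_space set \<Rightarrow> (('a \<Rightarrow> 'a) \<Rightarrow> ('a \<Rightarrow> 'a) \<Rightarrow> ('a \<Rightarrow> 'a)) \<Rightarrow>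
   ('a \<Rightarrow> 'a) \<Rightarrow> ('a \<Rightarrow> 'a) \<Rightarrow> ('a \<Rightarrow> 'a) \<Rightarrow> 'a \<Rightarrow> 'a" where
  "curvature M D X Y Z p = D X (D Y Z) p - D Y (D X Z) p - D (vf_bracket M X Y) Z p"

text \<open>
  \<open>r\<close> is the Ricci tensor: \<open>r p (Y p) (Z p)\<close> is the trace of the endomorphism
  \<open>X \<mapsto> R(X, Y) Z\<close> of the tangent space at \<open>p\<close>, computed in a
  \<open>g p\<close>-orthonormal basis \<open>E 0 p, \<dots>, E (n - 1) p\<close>.  The right-hand side is
  tensorial, so it depends neither on the basis nor on the extension of tangent vectors
  to vector fields.
\<close>

definition has_ricci_tensor ::
  "'a::euclidean_space set \<Rightarrow> 'a metric_tensor \<Rightarrow> 'a metric_tensor \<Rightarrow> bool" where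
  "has_ricci_tensor M g r \<longleftrightarrow> (\<exists>D. levi_civita_connection M g D \<and>
     (\<forall>p\<in>M. \<forall>Y\<in>vector_fields M. \<forall>Z\<in>vector_fields M. \<forall>n. \<forall>E :: nat \<Rightarrow> 'a \<Rightarrow> 'a.
        (\<forall>i<n. E i \<in> vector_fields M) \<longrightarrow>
        (\<forall>i<n. \<forall>j<n. g p (E i p) (E j p) = (if i = j then 1 else 0)) \<longrightarrow>
        span ((\<lambda>i. E i p) ` {..<n}) = tangent_space M p \<longrightarrow>
        r p (Y p) (Z p) = (\<Sum>i<n. g p (curvature M D (E i) Y Z p) (E i p))))"

definition einstein_metric ::
  "'a::euclidean_space set \<Rightarrow> 'a metric_tensor \<Rightarrow> bool" where
  "einstein_metric M g \<longleftrightarrow> riemannian_metric M g \<and>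
     (\<exists>lam::real. has_ricci_tensor M g (\<lambda>p u v. lam * g p u v))"


section \<open>The Lie group of pairs of unit quaternions\<close>

text \<open>A quaternion is a pair of its real part and its imaginary part.\<close>

type_synonym quat = "real \<times> (real^3)"

definition qmult :: "quat \<Rightarrow> quat \<Rightarrow> quat" where
  "qmult p q = (fst p * fst q - snd p \<bullet> snd q,
                fst p *\<^sub>R snd q + fst q *\<^sub>R snd p + cross3 (snd p) (snd q))"

definition qcnj :: "quat \<Rightarrow> quat" where
  "qcnj p = (fst p, - snd p)"

definition S3xS3 :: "(quat \<times> quat) set" where
  "S3xS3 = sphere 0 1 \<times> sphere 0 1"

definition gmult :: "quat \<times> quat \<Rightarrow> quat \<times> quat \<Rightarrow> quat \<times> quat" where
  "gmult a b = (qmult (fst a) (fst b), qmult (snd a) (snd b))"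

definition gone :: "quat \<times> quat" where
  "gone = ((1, 0), (1, 0))"

definition ginv :: "quat \<times> quat \<Rightarrow> quat \<times> quat" where
  "ginv a = (qcnj (fst a), qcnj (snd a))"

definition lie_alg :: "(quat \<times> quat) set" where
  "lie_alg = tangent_space S3xS3 gone"

definition left_invariant :: "(quat \<times> quat) metric_tensor \<Rightarrow> bool" where
  "left_invariant g \<longleftrightarrow>
     (\<forall>a\<in>S3xS3. \<forall>p\<in>S3xS3. \<forall>u\<in>tangent_space S3xS3 p. \<forall>v\<in>tangent_space S3xS3 p.
        g (gmult a p) (differential S3xS3 (gmult a) p u) (differential S3xS3 (gmult a) p v) = g p u v)"

definition left_extension ::
  "(quat \<times> quat \<Rightarrow> quat \<times> quat \<Rightarrow> real) \<Rightarrow> (quat \<times> quat) metric_tensor" where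
  "left_extension b p u v =
     b (differential S3xS3 (gmult (ginv p)) p u) (differential S3xS3 (gmult (ginv p)) p v)"

definition Ad :: "quat \<times> quat \<Rightarrow> quat \<times> quat \<Rightarrow> quat \<times> quat" where
  "Ad a = (\<lambda>x\<in>lie_alg. differential S3xS3 (\<lambda>y. gmult (gmult a y) (ginv a)) gone x)"

text \<open>The image of the adjoint representation, as a group of bijections of the Lie algebra.\<close>

definition Ad_group :: "(quat \<times> quat \<Rightarrow> quat \<times> quat) monoid" where
  "Ad_group = (BijGroup lie_alg)\<lparr>carrier := Ad ` S3xS3\<rparr>"

definition invariant_under ::
  "(quat \<times> quat \<Rightarrow> quat \<times> quat) set \<Rightarrow> (quat \<times> quat) metric_tensor \<Rightarrow> bool" where
  "invariant_under \<Gamma> g \<longleftrightarrow>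
     (\<forall>\<phi>\<in>\<Gamma>. \<forall>u\<in>lie_alg. \<forall>v\<in>lie_alg. g gone (\<phi> u) (\<phi> v) = g gone u v)"


section \<open>The standard metric and the nearly Kaehler metric\<close>

definition g_can :: "(quat \<times> quat) metric_tensor" where
  "g_can p u v = u \<bullet> v"

text \<open>
  The halves of the imaginary units: the factor \<open>1/2\<close> makes the bases orthonormal for
  minus one half of the Killing form, see the lemmas below.
\<close>

definition lie_E :: "3 \<Rightarrow> quat \<times> quat" where
  "lie_E i = ((0, axis i (1/2)), 0)"

definition lie_F :: "3 \<Rightarrow> quat \<times> quat" where
  "lie_F i = (0, (0, axis i (1/2)))"

definition lie_bracket :: "quat \<times> quat \<Rightarrow> quat \<times> quat \<Rightarrow> quat \<times> quat" where
  "lie_bracket x y = gmult x y - gmult y x"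

text \<open>
  The trace is taken over the whole ambient algebra, which adds nothing to the trace over
  the Lie algebra because the remaining basis vectors are central.
\<close>

definition killing_form :: "quat \<times> quat \<Rightarrow> quat \<times> quat \<Rightarrow> real" where
  "killing_form x y = (\<Sum>b\<in>Basis. lie_bracket x (lie_bracket y b) \<bullet> b)"

definition nk_X :: "3 \<Rightarrow> quat \<times> quat" where
  "nk_X i = (root 4 3 / sqrt 2) *\<^sub>R lie_E i"

definition nk_Y :: "3 \<Rightarrow> quat \<times> quat" where
  "nk_Y i = (1 / (sqrt 2 * root 4 3)) *\<^sub>R lie_E i + (sqrt 2 / root 4 3) *\<^sub>R lie_F i"

definition nk_basis :: "(quat \<times> quat) set" where
  "nk_basis = range nk_X \<union> range nk_Y"

text \<open>The scalar product on the span of \<open>B\<close> for which the basis \<open>B\<close> is orthonormal.\<close>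

definition scalar_product_of_basis :: "'a::real_vector set \<Rightarrow> 'a \<Rightarrow> 'a \<Rightarrow> real" where
  "scalar_product_of_basis B u v = (\<Sum>b\<in>B. representation B u b * representation B v b)"

definition g_NK :: "(quat \<times> quat) metric_tensor" where
  "g_NK = left_extension (scalar_product_of_basis nk_basis)"

lemma lie_bracket_E:
  "lie_bracket (lie_E 1) (lie_E 2) = lie_E 3"
  "lie_bracket (lie_E 2) (lie_E 3) = lie_E 1"
  "lie_bracket (lie_E 3) (lie_E 1) = lie_E 2"
  by (simp_all add: lie_bracket_def lie_E_def gmult_def qmult_def cross3_def zero_prod_def
      vec_eq_iff forall_3 axis_def inner_vec_def sum_3)

lemma lie_bracket_F:
  "lie_bracket (lie_F 1) (lie_F 2) = lie_F 3"
  "lie_bracket (lie_F 2) (lie_F 3) = lie_F 1"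
  "lie_bracket (lie_F 3) (lie_F 1) = lie_F 2"
  by (simp_all add: lie_bracket_def lie_F_def gmult_def qmult_def cross3_def zero_prod_def
      vec_eq_iff forall_3 axis_def inner_vec_def sum_3)

lemma sum_Basis_prod:
  fixes f :: "'a::euclidean_space \<times> 'b::euclidean_space \<Rightarrow> real"
  shows "(\<Sum>b\<in>Basis. f b) = (\<Sum>b\<in>Basis. f (b, 0)) + (\<Sum>b\<in>Basis. f (0, b))"
proof -
  have "inj_on (\<lambda>u::'a. (u, 0::'b)) Basis" "inj_on (\<lambda>u::'b. (0::'a, u)) Basis"
    by (auto intro!: inj_onI)
  then show ?thesis
    unfolding Basis_prod_def
    by (subst sum.union_disjoint) (auto simp: sum.reindex)
qed

lemma killing_form_basis:
  "- killing_form (lie_E i) (lie_E j) / 2 = (if i = j then 1 else 0)"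
  "- killing_form (lie_F i) (lie_F j) / 2 = (if i = j then 1 else 0)"
  "killing_form (lie_E i) (lie_F j) = 0"
proof -
  have split: "(\<Sum>b\<in>Basis. f b) = f ((1, 0), 0) + (\<Sum>k\<in>UNIV. f ((0, axis k 1), 0))
      + f (0, (1, 0)) + (\<Sum>k\<in>UNIV. f (0, (0, axis k 1)))" for f :: "quat \<times> quat \<Rightarrow> real"
  proof -
    have v: "(\<Sum>b\<in>Basis. h b) = (\<Sum>k\<in>UNIV. h (axis k 1))" for h :: "real^3 \<Rightarrow> real"
    proof -
      have "inj (\<lambda>k::3. axis k (1::real))"
        by (simp add: inj_on_def axis_eq_axis)
      then show ?thesis
        by (simp add: Basis_vec_def sum.reindex UNION_singleton_eq_range)
    qed
    have q: "(\<Sum>b\<in>Basis. h b) = h (1, 0) + (\<Sum>k\<in>UNIV. h (0, axis k 1))"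
      for h :: "quat \<Rightarrow> real"
      by (subst sum_Basis_prod) (simp add: v)
    show ?thesis
      by (subst sum_Basis_prod) (simp add: q add.assoc)
  qed
  note defs = killing_form_def split lie_bracket_def lie_E_def lie_F_def gmult_def qmult_def
    cross3_def zero_prod_def axis_def inner_vec_def sum_3 vec_eq_iff forall_3
  show "- killing_form (lie_E i) (lie_E j) / 2 = (if i = j then 1 else 0)"
    using exhaust_3[of i] exhaust_3[of j] by (auto simp: defs)
  show "- killing_form (lie_F i) (lie_F j) / 2 = (if i = j then 1 else 0)"
    using exhaust_3[of i] exhaust_3[of j] by (auto simp: defs)
  show "killing_form (lie_E i) (lie_F j) = 0"
    using exhaust_3[of i] exhaust_3[of j] by (auto simp: defs)
qed

lemma finite_nk_basis: "finite nk_basis"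
  by (simp add: nk_basis_def)

lemma independent_nk_basis: "independent nk_basis"
proof -
  define A where "A = range lie_E \<union> range lie_F"
  have inj: "inj lie_E" "inj lie_F"
    by (auto simp: inj_on_def lie_E_def lie_F_def axis_eq_axis)
  have ne: "lie_E i \<noteq> lie_F j" for i j
    by (simp add: lie_E_def lie_F_def zero_prod_def axis_eq_0_iff)
  have "card A = 6"
  proof -
    have "range lie_E \<inter> range lie_F = {}"
      using ne by blast
    then show ?thesis
      using inj by (simp add: A_def card_Un_disjoint card_image)
  qed
  have "pairwise orthogonal A"
    by (auto simp: pairwise_def A_def orthogonal_def lie_E_def lie_F_def zero_prod_def
        inner_axis_axis split: if_splits)
  moreover have "0 \<notin> A"
    by (auto simp: A_def lie_E_def lie_F_def zero_prod_def axis_eq_0_iff)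
  ultimately have indep: "independent A"
    using pairwise_orthogonal_independent by blast
  have E: "lie_E i \<in> span nk_basis" for i
  proof -
    have "lie_E i = (sqrt 2 / root 4 3) *\<^sub>R nk_X i"
      by (simp add: nk_X_def)
    moreover have "nk_X i \<in> span nk_basis"
      by (simp add: nk_basis_def span_base)
    ultimately show ?thesis
      by (metis span_scale)
  qed
  have F: "lie_F i \<in> span nk_basis" for i
  proof -
    have "lie_F i = (root 4 3 / sqrt 2) *\<^sub>R (nk_Y i - (1 / (sqrt 2 * root 4 3)) *\<^sub>R lie_E i)"
      by (simp add: nk_Y_def)
    moreover have "nk_Y i \<in> span nk_basis"
      by (simp add: nk_basis_def span_base)
    ultimately show ?thesis
      using E by (metis span_scale span_diff)
  qed
  have sub: "A \<subseteq> span nk_basis"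
    using E F by (auto simp: A_def)
  have "card nk_basis \<le> card (range nk_X) + card (range nk_Y)"
    unfolding nk_basis_def by (rule card_Un_le)
  also have "\<dots> \<le> 3 + 3"
    using card_image_le[of UNIV nk_X] card_image_le[of UNIV nk_Y] by simp
  finally have "card nk_basis \<le> card A"
    using \<open>card A = 6\<close> by simp
  also have "\<dots> = dim A"
    using indep by (simp add: dim_eq_card_independent)
  also have "\<dots> \<le> dim (span nk_basis)"
    using sub by (rule dim_subset)
  finally show ?thesis
    by (intro card_le_dim_spanning[of nk_basis "span nk_basis"])
      (auto simp: span_superset finite_nk_basis)
qed

lemma scalar_product_nk_basis:
  assumes "b \<in> nk_basis" and "c \<in> nk_basis"
  shows "scalar_product_of_basis nk_basis b c = (if b = c then 1 else 0)"
proof -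
  have "scalar_product_of_basis nk_basis b c
      = (\<Sum>d\<in>nk_basis. if d = b then (if b = c then 1 else 0) else 0)"
    unfolding scalar_product_of_basis_def
    by (rule sum.cong)
      (auto simp: real_vector.representation_basis[OF independent_nk_basis] assms)
  then show ?thesis
    using assms finite_nk_basis by simp
qed

end

theory Submission
  imports Defs
begin

text \<open>
  A rotation of one factor, or of both with angles other than \<open>\<pi>\<close>, or two commuting involutions
  put an invariant scalar product on the Lie algebra into one of two shapes. If the factors are coupled along one
  axis only, then the mixed Ricci components are positive multiples of the coupling, which must
  vanish. Otherwise there are oriented orthonormal bases \<open>E\<^sub>i\<close>, \<open>F\<^sub>i\<close> in which only \<open>E\<^sub>i\<close> and \<open>F\<^sub>i\<close>
  with the same index are coupled. A finite group larger than \<open>\<int>\<^sub>2\<close> always contains such symmetries.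

  In the block form let \<open>1/s\<^sub>i\<close> and \<open>1/y\<^sub>i\<close> be the squared lengths of \<open>E\<^sub>i\<close> and of \<open>F\<^sub>i + w\<^sub>i E\<^sub>i\<close>, the
  latter orthogonal to \<open>E\<^sub>i\<close>. The mixed equation multiplied by \<open>w\<^sub>i\<close> shows that all \<open>w\<^sub>i\<close> vanish unless
  \<open>w\<^sub>1 w\<^sub>2 w\<^sub>3 > 0\<close>. In the latter case the equations, written in \<open>t\<^sub>i = w\<^sub>j w\<^sub>k / w\<^sub>i\<close>, contradict
  an ordering of the \<open>s\<^sub>i\<close> with \<open>s\<^sub>3 < s\<^sub>1\<close>; so all \<open>s\<^sub>i\<close> agree, and what remains is
  \<open>t\<^sub>i = 1\<close> (isometric to \<open>g_can\<close>, possibly by an isometry that is not a homomorphism) or \<open>t\<^sub>i = 1/2\<close> (\<open>g_can\<close> or \<open>g_NK\<close>).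
\<close>

section \<open>Polynomial inequalities\<close>

text \<open>One half-turn in both factors still leaves \<open>E\<^sub>2\<close>,
  \<open>E\<^sub>3\<close>, \<open>F\<^sub>2\<close>, \<open>F\<^sub>3\<close> freely coupled, which
  is why \<open>\<int>\<^sub>2\<close> is excluded. For larger groups the obstacle is to show that a
  coupled block metric has equal \<open>s\<^sub>i\<close>. With the quantities \<open>c1\<close>,
  \<open>c2\<close>, \<open>c3\<close> of \<open>tsys\<close> the mixed equations become
  \<open>c1 + A1 = t2*c2 + t3*c3\<close> and its permutations, where \<open>A1\<close>,
  \<open>A2\<close>, \<open>A3\<close> are nonnegative and measure the differences of the
  \<open>s\<^sub>i\<close>. If \<open>s1\<close> is the largest and \<open>s3\<close> the smallest,
  these and the diagonal equations force all \<open>c\<^sub>i > 0\<close>, all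
  \<open>t\<^sub>i < 1\<close> and \<open>t1 < 1/2\<close>. What is missing is then an estimate free
  of the \<open>s\<^sub>i\<close>: \<open>c1*(t2*y3 + t3*y2) \<le> y2*y3/y1 * (c2*t2^2/(1-t2) +
  c3*t3^2/(1-t3))\<close>. By the definition of the \<open>c\<^sub>i\<close>,
  \<open>(1-t1)/t1\<close> times the right side is \<open>c1\<close> times the same sum with its
  terms multiplied by \<open>s1/s2\<close> and \<open>s1/s3\<close>, and this clashes with the
  diagonal equations. The inequalities for weights \<open>a\<close>, \<open>b\<close> (standing for
  \<open>t2\<close>, \<open>t3\<close>) and masses \<open>c\<close>, \<open>d\<close> (standing for
  \<open>c2\<close>, \<open>c3\<close>) serve this estimate.\<close>

lemma weight_poly_nonneg:
  fixes z g :: real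
  assumes z: "0 \<le> z" and g: "0 \<le> g" and zg: "z + g \<le> 1"
  shows "0 \<le> 16*g^2 - 12*g*z + 6*z + 8*z^2 + 28*g^2*z + 16*g^3 + 8*g*z^2 - 12*g*z^3
    + 8*g^2*z^2 + 4*g^2*z^3 + 12*g^3*z - 2*g^4*z - 4*z^3 - 8*z^4 - 2*z^5" (is "0 \<le> ?T")
proof -
  have g1: "g \<le> 1" "z \<le> 1" using assms by auto
  have "g^4*z \<le> g^3*z"
    using mult_right_mono[OF power_decreasing[of 3 4 g] z] g g1 by simp
  moreover have "0 \<le> g^3*z" "0 \<le> g^2*z" "0 \<le> g^3" "0 \<le> g^2*z^2" "0 \<le> g^2*z^3" using z g by simp_all
  ultimately have rest: "0 \<le> 28*g^2*z + 16*g^3 + 8*g^2*z^2 + 4*g^2*z^3 + 12*g^3*z - 2*g^4*z"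
    by linarith
  show ?thesis
  \<comment> \<open>The polynomial vanishes at \<open>(z, g) = (0, 0)\<close> and at
    \<open>(1, 0)\<close>, so one certificate cannot be generous everywhere. Near the first point a
    square absorbs \<open>-12*g*z\<close>; near the second the factor \<open>1 - z - g\<close> is
    split off.\<close>
  proof (cases "z \<le> 2/3")
    case True
    have sq: "0 \<le> (4*g - 3/2*z)^2" by simp
    have p2: "z^2 \<le> (2/3)^2" and p3: "z^3 \<le> (2/3)^3" and p4: "z^4 \<le> (2/3)^4"
      using True z by (intro power_mono; simp)+
    then have "4*z^2 + 8*z^3 + 2*z^4 \<le> 6" by (simp add: power_numeral_reduce)
    then have "0 \<le> z * (6 - (4*z^2 + 8*z^3 + 2*z^4))" using z by simp
    moreover have "0 \<le> g*z^2*(8 - 12*z)" using z g True by simp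
    moreover have "?T = (4*g - 3/2*z)^2 + z * (6 - (4*z^2 + 8*z^3 + 2*z^4)) + 23/4*z^2
        + g*z^2*(8 - 12*z) + (28*g^2*z + 16*g^3 + 8*g^2*z^2 + 4*g^2*z^3 + 12*g^3*z - 2*g^4*z)"
      by (simp add: field_simps power2_eq_square power_numeral_reduce)
    moreover have "0 \<le> 23/4*z^2" by simp
    ultimately show ?thesis using rest sq by linarith
  next
    case False
    have "0 \<le> (1 - z - g) * (2*z*(3 + 3*z + z^2 + z^3) + 8*z^2*(1+z))"
      using assms by simp
    moreover have "0 \<le> g*z*(22*z - 6 - 2*z^2 + 2*z^3)"
    proof -
      have "z^2 \<le> 1" using z g1 by (simp add: power_le_one)
      then have "0 \<le> 22*z - 6 - 2*z^2 + 2*z^3" using False zero_le_power[OF z, of 3] by linarith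
      then show ?thesis using z g by simp
    qed
    moreover have "?T = (1 - z - g) * (2*z*(3 + 3*z + z^2 + z^3) + 8*z^2*(1+z))
        + g*z*(22*z - 6 - 2*z^2 + 2*z^3) + 16*g^2
        + (28*g^2*z + 16*g^3 + 8*g^2*z^2 + 4*g^2*z^3 + 12*g^3*z - 2*g^4*z)"
      by (simp add: field_simps power2_eq_square power_numeral_reduce)
    moreover have "0 \<le> 16*g^2" by simp
    ultimately show ?thesis using rest by linarith
  qed
qed

text \<open>Multiplying the two mass conditions eliminates \<open>c\<close> and \<open>d\<close>.
  The second bound follows from the first by \<open>4*a*b \<le> (a+b)^2\<close>.\<close>

lemma weights_bounds:
  fixes a b c d :: real
  assumes ab: "0 < a" "a < 1" "0 < b" "b < 1" and cd: "0 < c" "0 < d"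
    and h1: "(2 - a)*c \<le> 3*b*d" and h2: "(2 - b)*d \<le> 3*a*c"
  shows "2 \<le> 4*a*b + a + b" and "1 \<le> a + b"
proof -
  have "((2 - a)*c)*((2 - b)*d) \<le> (3*b*d)*(3*a*c)"
    by (rule mult_mono[OF h1 h2]) (use ab cd in auto)
  then have "((2-a)*(2-b))*(c*d) \<le> (9*a*b)*(c*d)" by (simp add: algebra_simps)
  then have "(2-a)*(2-b) \<le> 9*a*b" using mult_right_le_imp_le[OF _ mult_pos_pos[OF cd]] by blast
  then show 1: "2 \<le> 4*a*b + a + b" by (simp add: algebra_simps)
  show "1 \<le> a + b"
  proof (rule ccontr)
    assume n: "\<not> ?thesis"
    have "0 \<le> (a-b)^2" by simp
    then have "4*a*b \<le> (a+b)*(a+b)" by (simp add: algebra_simps power2_eq_square)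
    also have "\<dots> \<le> 1*(a+b)" using n ab by (intro mult_right_mono) auto
    finally show False using 1 n by simp
  qed
qed

text \<open>The case \<open>c = d\<close> of \<open>moment_lower_bound\<close>. Four times the
  numerator is a multiple of \<open>(a-b)^2\<close> plus a multiple of
  \<open>(a+b)-1\<close>.\<close>

lemma weight_sum_nonneg:
  fixes a b :: real
  assumes ab: "0 < a" "a < 1" "0 < b" "b < 1" "1 \<le> a + b"
  shows "0 \<le> (a^2/(1-a) - (a+b)*a) + (b^2/(1-b) - (a+b)*b)"
proof -
  have "(a^2/(1-a) - (a+b)*a) + (b^2/(1-b) - (a+b)*b)
    = (a^2*(1-b) + b^2*(1-a) - (a+b)^2*((1-a)*(1-b)))/((1-a)*(1-b))"
    using ab by (simp add: field_simps power2_eq_square)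
  moreover have "0 \<le> a^2*(1-b) + b^2*(1-a) - (a+b)^2*((1-a)*(1-b))"
  proof -
    have r: "0 \<le> (a+b)^2*(2-(a+b))*((a+b)-1)" using ab by simp
    have "4*(a^2*(1-b) + b^2*(1-a) - (a+b)^2*((1-a)*(1-b)))
      = (a-b)^2*(2 + (a+b) + (a+b)^2) + (a+b)^2*(2-(a+b))*((a+b)-1)"
      by (simp add: algebra_simps power2_eq_square)
    moreover have "0 \<le> (a-b)^2*(2 + (a+b) + (a+b)^2)" using ab by simp
    ultimately have "0 \<le> 4*(a^2*(1-b) + b^2*(1-a) - (a+b)^2*((1-a)*(1-b)))" using r by simp
    then show ?thesis by simp
  qed
  ultimately show ?thesis using ab by simp
qed

text \<open>The case \<open>c = 3*b\<close>, \<open>d = 2-a\<close> of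
  \<open>moment_lower_bound\<close>, where the ratio \<open>c/d\<close> is the largest that
  \<open>h1\<close> permits. The coordinates \<open>z\<close> and \<open>g\<close> are centred at
  \<open>a = b = 1/2\<close>, where equality holds.\<close>

lemma weight_combination_bound:
  fixes a b :: real
  assumes ab: "0 < a" "a < 1" "0 < b" "b < 1" "1 \<le> a + b" and le: "a \<le> b"
  shows "(3*b + a - 2)*(b - a) \<le> 3*b*(a^2/(1-a) - (a+b)*a) + (2-a)*(b^2/(1-b) - (a+b)*b)"
proof -
  define z g where "z = a + b - 1" and "g = b - a"
  have a: "a = (1 + z - g)/2" and b: "b = (1+z+g)/2" by (simp_all add: z_def g_def)
  have T: "0 \<le> 16*g^2 - 12*g*z + 6*z + 8*z^2 + 28*g^2*z + 16*g^3 + 8*g*z^2 - 12*g*z^3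
    + 8*g^2*z^2 + 4*g^2*z^3 + 12*g^3*z - 2*g^4*z - 4*z^3 - 8*z^4 - 2*z^5"
    by (rule weight_poly_nonneg) (use assms in \<open>auto simp: z_def g_def\<close>)
  define N where "N = b*(3*a^2*(1-b) + (2-a)*b*(1-a) - (a+b)*(2+2*a)*((1-a)*(1-b))) - (3*b+a-2)*(b-a)*((1-a)*(1-b))"
  have "16 * N = 16*g^2 - 12*g*z + 6*z + 8*z^2 + 28*g^2*z + 16*g^3 + 8*g*z^2 - 12*g*z^3
    + 8*g^2*z^2 + 4*g^2*z^3 + 12*g^3*z - 2*g^4*z - 4*z^3 - 8*z^4 - 2*z^5"
    unfolding N_def a b by (simp add: field_simps power2_eq_square power_numeral_reduce)
  then have "0 \<le> N" using T by linarith
  have "3*b*(a^2/(1-a) - (a+b)*a) + (2-a)*(b^2/(1-b) - (a+b)*b) - (3*b + a - 2)*(b - a)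
    = N / ((1-a)*(1-b))"
    unfolding N_def using ab by (simp add: divide_simps) (simp add: algebra_simps power2_eq_square)
  moreover have "0 \<le> N / ((1-a)*(1-b))" using \<open>0 \<le> N\<close> ab by simp
  ultimately show ?thesis by linarith
qed

text \<open>For fixed weights the claim is linear in \<open>(c, d)\<close>. If \<open>a < b\<close>,
  it holds on the cone \<open>d \<le> c\<close>, \<open>(2-a)*c \<le> 3*b*d\<close> because it holds
  on the two extreme rays, by \<open>weight_sum_nonneg\<close> and
  \<open>weight_combination_bound\<close>. If \<open>b \<le> a\<close>, then
  \<open>1/2 \<le> a\<close> makes \<open>f\<close> nonnegative. The extra term
  \<open>(c-d)*(b-a)\<close> is a gain needed in \<open>coupling_bound_ordered\<close>.\<close>

lemma moment_lower_bound:
  fixes a b c d :: real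
  assumes ab: "0 < a" "a < 1" "0 < b" "b < 1" and cd: "0 < d" "d \<le> c"
    and h1: "(2 - a)*c \<le> 3*b*d" and s: "1 \<le> a + b"
  shows "(a+b)*(a*c+b*d) + (if a < b then (c - d)*(b - a) else 0) \<le> c*a^2/(1-a) + d*b^2/(1-b)"
proof -
  define f h where "f = a^2/(1-a) - (a+b)*a" and "h = b^2/(1-b) - (a+b)*b"
  have sum: "0 \<le> f + h" unfolding f_def h_def by (rule weight_sum_nonneg) (use assms in auto)
  have G: "c*a^2/(1-a) + d*b^2/(1-b) = (a+b)*(a*c+b*d) + (d*(f+h) + (c-d)*f)"
    unfolding f_def h_def by (simp add: algebra_simps diff_divide_distrib)
  show ?thesis
  proof (cases "a < b")
    case False
    then have a: "1/2 \<le> a" "b \<le> a" using s by auto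
    have "(a+b)*a*(1-a) \<le> (2*a)*a*(1/2)" using a ab by (intro mult_mono) auto
    then have "(a+b)*a*(1-a) \<le> a^2" by (simp add: power2_eq_square)
    then have "0 \<le> f" using ab by (simp add: f_def field_simps)
    then show ?thesis using False sum cd by (simp add: G)
  next
    case True
    have w: "(3*b + a - 2)*(b - a) \<le> 3*b*f + (2-a)*h"
      unfolding f_def h_def by (rule weight_combination_bound) (use assms True in auto)
    have "(c-d)*((b-a) - f) \<le> d*(f+h)"
    proof (cases "(b-a) - f \<le> 0")
      case True
      then have "(c-d)*((b-a)-f) \<le> 0" using cd by (simp add: mult_nonneg_nonpos)
      also have "0 \<le> d*(f+h)" using cd sum by simp
      finally show ?thesis .
    next
      case False
      have "(2-a)*(c-d) \<le> d*(3*b+a-2)" using h1 by (simp add: algebra_simps)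
      then have "(2-a)*(c-d)*((b-a)-f) \<le> d*(3*b+a-2)*((b-a)-f)"
        using False by (intro mult_right_mono) auto
      also have "\<dots> = d*((3*b+a-2)*(b-a) - (3*b+a-2)*f)" by (simp add: algebra_simps)
      also have "\<dots> \<le> d*((3*b*f + (2-a)*h) - (3*b+a-2)*f)"
        using cd w by (intro mult_left_mono) auto
      also have "\<dots> = (2-a)*(d*(f+h))" by (simp add: algebra_simps)
      finally have "(2-a)*((c-d)*((b-a)-f)) \<le> (2-a)*(d*(f+h))" by (simp add: mult.assoc)
      then show ?thesis using ab by simp
    qed
    then show ?thesis using True by (simp add: G algebra_simps)
  qed
qed

text \<open>These bounds supply the hypothesis of \<open>amgm_weighted\<close> in
  \<open>coupling_bound_ordered\<close>: the first controls the part cubic in \<open>Z\<close>, the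
  second the part proportional to \<open>l\<close>.\<close>

lemma moment_products:
  fixes a b c d :: real
  assumes ab: "0 < a" "a < b" "b < 1" and cd: "0 < d" "d \<le> c"
    and h1: "(2 - a)*c \<le> 3*b*d" and h: "2 \<le> 4*a*b + a + b" and s: "1 \<le> a + b"
  shows "(a*c+b*d)^2 \<le> 16*a*c*d" and "3*((1-a)*(1-b))*(a*c+b*d)^2 \<le> 4*a*c*d"
proof -
  have c: "0 < c" using cd by simp
  have a5: "1/5 \<le> a"
  proof -
    have "4*a*b \<le> 4*a*1" using ab by (intro mult_left_mono) auto
    then show ?thesis using h ab by linarith
  qed
  have d3: "(2 - a)*c \<le> 3*d"
  proof -
    have "3*b*d \<le> 3*1*d" using ab cd by (intro mult_right_mono) auto
    then show ?thesis using h1 by simp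
  qed
  have "a*c+b*d \<le> (1+a)*c"
  proof -
    have "b*d \<le> 1*c" using ab cd by (intro mult_mono) auto
    then show ?thesis by (simp add: algebra_simps)
  qed
  then have "(a*c+b*d)^2 \<le> ((1+a)*c)^2" using ab cd c by (intro power_mono) auto
  then have "3*(a*c+b*d)^2 \<le> 3*(1+a)^2*c^2" by (simp add: power_mult_distrib)
  also have "\<dots> \<le> (16*a*(2-a))*c^2"
  proof (rule mult_right_mono)
    \<comment> \<open>The difference \<open>16*a*(2-a) - 3*(1+a)^2 = 26*a - 3 - 19*a^2\<close>
      equals \<open>36/25\<close> at \<open>a = 1/5\<close>, and this product is its increment from
      there.\<close>
    have "0 \<le> (a - 1/5)*(130/5 - 1/5*19 - 19*a)" using a5 ab by simp
    then show "3*(1+a)^2 \<le> 16*a*(2-a)" using a5 by (simp add: field_simps power2_eq_square)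
  qed simp
  also have "\<dots> = 16*a*c*((2-a)*c)" by (simp add: power2_eq_square)
  also have "\<dots> \<le> 16*a*c*(3*d)" using d3 ab c by (intro mult_left_mono) auto
  finally show "(a*c+b*d)^2 \<le> 16*a*c*d" by simp
  have "(1-a)*(1-b) \<le> (1-a)*a" using s ab by (intro mult_left_mono) auto
  then have k: "3*((1-a)*(1-b))*(a*c+b*d)^2 \<le> 3*((1-a)*a)*(a*c+b*d)^2"
    by (intro mult_right_mono) auto
  have main: "3*(1-a)*(a*c+b*d)^2 \<le> 4*c*d"
  proof -
    \<comment> \<open>Both factors are constraints on the masses. Their product bounds
      \<open>3*b*d^2\<close> by terms divisible by \<open>c\<close>, so that only the linear form
      \<open>F\<close> remains to be estimated.\<close>
    have p: "0 \<le> (c - d)*(3*b*d - (2-a)*c)" using cd h1 by simp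
    have "b*(3*b*d^2) \<le> b*(3*b*c*d - (2-a)*c^2 + (2-a)*c*d)"
      using p ab by (intro mult_left_mono) (simp_all add: algebra_simps power2_eq_square)
    then have d2: "3*(a*c+b*d)^2 \<le> 3*a^2*c^2 + 6*a*b*c*d + 3*b^2*c*d - b*(2-a)*c^2 + b*(2-a)*c*d"
      by (simp add: algebra_simps power2_eq_square)
    define F where "F = 4*d - (1-a)*((3*a^2 - b*(2-a))*c + (5*a*b+3*b^2+2*b)*d)"
    have r: "0 < 3*b+a-2" using s ab by linarith
    have "0 \<le> 4 - 3*(1-a)*(a+b)^2"
    proof -
      have "(a+b)^2 \<le> (1+a)^2" using ab by (intro power_mono) auto
      then have "3*(1-a)*(a+b)^2 \<le> 3*(1-a)*(1+a)^2" using ab by (intro mult_left_mono) auto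
      also have "\<dots> = 4 - ((1-a)^3 + 4*a^3)" by (simp add: algebra_simps power2_eq_square power3_eq_cube)
      also have "\<dots> \<le> 4"
      proof -
        have "0 \<le> (1-a)^3" "0 \<le> a^3" using ab by simp_all
        then show ?thesis by linarith
      qed
      finally show ?thesis by simp
    qed
    moreover have "0 \<le> 4*(2-a) - 4*((1-a)*b*(1+a)^2)"
    proof -
      have "(1-a)*b*(1+a)^2 \<le> (1-a)*1*(1+a)^2" using ab by (intro mult_right_mono mult_left_mono) auto
      also have "\<dots> = (2-a) - ((1-a)^2 + a^3)" by (simp add: algebra_simps power2_eq_square power3_eq_cube)
      also have "\<dots> \<le> 2-a"
      proof -
        have "0 \<le> (1-a)^2" "0 \<le> a^3" using ab by simp_all
        then show ?thesis by linarith
      qed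
      finally show ?thesis by simp
    qed
    \<comment> \<open>The two coefficients are the values of \<open>F\<close> on the extreme rays of
      the cone, at \<open>c = d = 1\<close> and at \<open>c = 3*b\<close>,
      \<open>d = 2-a\<close>.\<close>
    ultimately have "0 \<le> (4 - 3*(1-a)*(a+b)^2)*(3*b*d - (2-a)*c) + (4*(2-a) - 4*((1-a)*b*(1+a)^2))*(c-d)"
      using h1 cd by simp
    also have "\<dots> = F*(3*b+a-2)" unfolding F_def by (simp add: algebra_simps power2_eq_square)
    finally have "0 \<le> F" using r by (simp add: zero_le_mult_iff)
    then have "0 \<le> F*c" using c by simp
    moreover have "(1-a)*(3*(a*c+b*d)^2) \<le> (1-a)*(3*a^2*c^2 + 6*a*b*c*d + 3*b^2*c*d - b*(2-a)*c^2 + b*(2-a)*c*d)"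
      using d2 ab by (intro mult_left_mono) auto
    moreover have "F*c = 4*c*d - (1-a)*(3*a^2*c^2 + 6*a*b*c*d + 3*b^2*c*d - b*(2-a)*c^2 + b*(2-a)*c*d)"
      unfolding F_def by (simp add: algebra_simps power2_eq_square)
    moreover have "3*(1-a)*(a*c+b*d)^2 = (1-a)*(3*(a*c+b*d)^2)" by simp
    ultimately show ?thesis by linarith
  qed
  have "3*((1-a)*a)*(a*c+b*d)^2 \<le> 4*a*c*d" using mult_left_mono[OF main, of a] ab by (simp add: algebra_simps)
  with k show "3*((1-a)*(1-b))*(a*c+b*d)^2 \<le> 4*a*c*d" by linarith
qed

text \<open>The hypothesis \<open>le\<close> bounds \<open>(Z*g*D)^2\<close> by four times the
  product of the two summands, so this is the arithmetic-geometric mean inequality.\<close>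

lemma amgm_weighted:
  fixes a b c d Z l Q g D m k :: real
  assumes k: "0 < k" and m: "0 < m" and Z: "0 < Z" and cd: "0 < c" "0 < d" and a: "0 < a" and Q: "0 < Q"
    and gD: "0 \<le> g" "0 \<le> D"
    and le: "k*Z*m^2 \<le> 4*c*d*a*Q"
  shows "Z*g*D \<le> c*d*g^2/k + (D/m)^2*Q*(a*Z)"
proof -
  define U V where "U = c*d*g^2/k" and "V = (D/m)^2*Q*(a*Z)"
  have UV: "0 \<le> U" "0 \<le> V" using assms by (simp_all add: U_def V_def)
  have "(Z*g*D)^2 = (k*Z*m^2)*(g^2*D^2*Z/(k*m^2))"
    using k m by (simp add: field_simps power2_eq_square)
  also have "\<dots> \<le> (4*c*d*a*Q)*(g^2*D^2*Z/(k*m^2))"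
    using le k m Z by (intro mult_right_mono) auto
  also have "\<dots> = 4*U*V" unfolding U_def V_def by (simp add: power_divide power2_eq_square algebra_simps)
  also have "\<dots> \<le> (U+V)^2"
  proof -
    have "0 \<le> (U-V)^2" by simp
    then show ?thesis by (simp add: algebra_simps power2_eq_square)
  qed
  finally have "Z*g*D \<le> U + V" by (rule power2_le_imp_le) (use UV in simp)
  then show ?thesis by (simp add: U_def V_def)
qed

text \<open>Subtracting \<open>Yc\<close> and \<open>Yd\<close> gives \<open>c - d = eta*m\<close>:
  the masses differ in proportion to \<open>y2 - y3\<close>. Once both sides are expressed through
  \<open>eta\<close>, the terms without \<open>eta\<close> are a Cauchy-Schwarz estimate, and only a
  term with the factor \<open>(b-a)*y3\<close> can cause trouble.\<close>

lemma coupling_bound_ordered: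
  fixes a b c d Z l y1 y2 y3 :: real
  assumes ab: "0 < a" "a < 1" "0 < b" "b < 1" and c: "0 < c" and d: "0 < d" and Z: "0 < Z" and l: "0 < l"
    and y: "0 < y1" "0 < y2" "0 < y3"
    and Yc: "c + l = y1 + y3 - y1*y3/y2" and Yd: "d + l = y1 + y2 - y1*y2/y3"
    and YZ: "Z + l = y2 + y3 - y2*y3/y1"
    and Z1: "Z \<le> a*c + b*d" and Z2: "2*c \<le> Z + 2*b*d" and Z3: "2*d \<le> Z + 2*a*c"
    and min: "c \<le> Z \<or> d \<le> Z" and le: "y3 \<le> y2"
  shows "Z*(a*y3 + b*y2) \<le> y2*y3/y1 * (c*a^2/(1-a) + d*b^2/(1-b))"
proof -
  define Q where "Q = y2*y3/y1"
  define eta where "eta = (y2-y3)/Q"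
  define m where "m = Z + l"
  define Zp where "Zp = a*c + b*d"
  define G where "G = c*a^2/(1-a) + d*b^2/(1-b)"
  define D where "D = c - d"
  define k where "k = (1-a)*(1-b)"
  have pos: "0 < Q" "0 < m" "0 < k" using y Z l ab by (simp_all add: Q_def m_def k_def)
  have y1: "y1 = y2*y3/Q" using y by (simp add: Q_def)
  have m: "m = y2 + y3 - Q" using YZ by (simp add: m_def Q_def)
  have cl: "c + l = y3*(1+eta)"
  proof -
    have "y1 - y1*y3/y2 = y3*eta" using y pos unfolding y1 eta_def by (simp add: field_simps)
    then show ?thesis using Yc by (simp add: algebra_simps)
  qed
  have dl: "d + l = y2*(1-eta)"
  proof -
    have "y1 - y1*y2/y3 = - (y2*eta)" using y pos unfolding y1 eta_def by (simp add: field_simps)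
    then show ?thesis using Yd by (simp add: algebra_simps)
  qed
  have eta0: "0 \<le> eta" using le pos by (simp add: eta_def)
  have etaQ: "eta*Q = y2 - y3" using pos by (simp add: eta_def)
  have D: "D = eta*m"
  proof -
    have "D = eta*(y2+y3) - eta*Q" using cl dl etaQ by (simp add: D_def algebra_simps)
    then show ?thesis by (simp add: m algebra_simps)
  qed
  have D0: "0 \<le> D" using D eta0 pos by simp
  have dc: "d \<le> c" using D0 by (simp add: D_def)
  have dZ: "d \<le> Z" using min dc by auto
  have QQ: "Q*(1-eta^2) = c + d + l - Z"
  proof -
    have "Q*(1-eta^2) = Q - eta*(eta*Q)" by (simp add: algebra_simps power2_eq_square)
    also have "\<dots> = Q - eta*(y2-y3)" by (simp add: etaQ)
    also have "\<dots> = (c + l) + (d + l) - m" by (simp add: cl dl m algebra_simps)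
    finally show ?thesis by (simp add: m_def)
  qed
  have h1: "(2-a)*c \<le> 3*b*d" and h2: "(2-b)*d \<le> 3*a*c"
    using Z1 Z2 Z3 by (simp_all add: algebra_simps)
  have w: "2 \<le> 4*a*b + a + b" "1 \<le> a + b" using weights_bounds[OF ab c d h1 h2] by auto
  have Zp: "Z \<le> Zp" "0 < Zp" using Z1 Z by (simp_all add: Zp_def)
  have GG: "(a+b)*Zp + (if a < b then D*(b-a) else 0) \<le> G"
    unfolding Zp_def G_def D_def by (rule moment_lower_bound) (use ab d dc h1 w in auto)
  have G0: "(a+b)*Zp \<le> G"
  proof -
    have "0 \<le> (if a < b then D*(b-a) else 0)" using D0 by simp
    then show ?thesis using GG by linarith
  qed
  have tZ: "(a+b)*Z \<le> (a+b)*Zp" using Zp ab by (intro mult_left_mono) auto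
  have GbZ: "a*Z \<le> G - b*Z" using G0 tZ by (simp add: algebra_simps)
  have aZ0: "0 \<le> a*Z" using ab Z by simp
  define U where "U = c*d*(b-a)^2/k"
  have U0: "0 \<le> U" using c d pos by (simp add: U_def)
  \<comment> \<open>Lagrange's identity: the Cauchy-Schwarz inequality with its exact defect
    \<open>U\<close>, which is spent later.\<close>
  have CS: "((1-a)*c+(1-b)*d)*G = Zp^2 + U"
    unfolding G_def Zp_def U_def k_def using ab by (simp add: divide_simps) (simp add: algebra_simps power2_eq_square)
  have base: "Z*(Zp + l*(a+b)) + U + l*(G - (a+b)*Z) \<le> (c+d+l-Z)*G"
  proof -
    have G_pos: "0 \<le> G" using G0 Zp ab by (smt (verit) mult_nonneg_nonneg)
    have "(c+d+l-Zp)*G \<le> (c+d+l-Z)*G" using G_pos Zp by (intro mult_right_mono) auto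
    moreover have "(c+d+l-Zp)*G = Zp^2 + U + l*G"
      using CS by (simp add: Zp_def algebra_simps)
    moreover have "Z*Zp \<le> Zp^2" using Zp by (simp add: power2_eq_square)
    ultimately show ?thesis by (simp add: algebra_simps)
  qed
  have split: "(c+d+l-Z)*G + eta*(y2-y3)*G = Q*G"
  proof -
    have "eta*(y2-y3) = eta^2*Q" by (simp add: etaQ[symmetric] power2_eq_square)
    then have "(c+d+l-Z) + eta*(y2-y3) = Q" using QQ by (simp add: algebra_simps)
    then show ?thesis by (metis distrib_right)
  qed
  have pq: "a*y3 + b*y2 = Zp + l*(a+b) + eta*(b*(y2-y3) + (b-a)*y3)"
  proof -
    have "c = y3*(1+eta) - l" "d = y2*(1-eta) - l" using cl dl by simp_all
    then show ?thesis by (simp only: Zp_def) (simp add: algebra_simps)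
  qed
  \<comment> \<open>This is what the claim still requires after \<open>pq\<close> is inserted on the
    left and \<open>base\<close> and \<open>split\<close> on the right. The right side consists of
    three nonnegative slacks; the left side is positive only if \<open>a < b\<close>.\<close>
  have main: "Z*(eta*((b-a)*y3)) \<le> U + l*(G-(a+b)*Z) + eta*(y2-y3)*(G - b*Z)"
  proof (cases "a < b")
    case False
    have "Z*(eta*((b-a)*y3)) \<le> 0" using False Z eta0 y by (intro mult_nonneg_nonpos mult_nonpos_nonneg) auto
    moreover have "0 \<le> l*(G-(a+b)*Z)" using l G0 tZ by simp
    moreover have "0 \<le> eta*(y2-y3)*(G - b*Z)" using eta0 le GbZ aZ0 by simp
    ultimately show ?thesis using U0 by linarith
  next
    case True
    \<comment> \<open>From \<open>d \<le> Z\<close> follows \<open>y3 \<le> m\<close>;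
      multiplication by \<open>eta\<close> turns this into the bound.\<close>
    have ey: "eta*y3 \<le> D"
    proof -
      have "c + l \<le> (1+eta)*m"
      proof -
        have "c + l = d + l + D" by (simp add: D_def)
        also have "\<dots> \<le> m + D" using dZ by (simp add: m_def)
        finally show ?thesis by (simp add: D algebra_simps)
      qed
      then have "y3*(1+eta) \<le> m*(1+eta)" by (simp add: cl mult.commute)
      then have "y3 \<le> m" using eta0 by (simp add: mult_le_cancel_right)
      then show ?thesis using eta0 by (simp add: D mult_left_mono)
    qed
    have "Z*(eta*((b-a)*y3)) = Z*(b-a)*(eta*y3)" by simp
    also have "\<dots> \<le> Z*(b-a)*D" using ey Z True by (intro mult_left_mono) auto
    finally have t: "Z*(eta*((b-a)*y3)) \<le> Z*(b-a)*D" .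
    show ?thesis
    \<comment> \<open>If \<open>Z \<le> l\<close>, the gain in \<open>moment_lower_bound\<close>
      multiplied by \<open>l\<close> is enough. Otherwise \<open>m^2 \<le> Z^2 + 3*Z*l\<close>, and
      the defect \<open>U\<close> together with the slack in \<open>eta\<close> pays by the
      arithmetic-geometric mean.\<close>
    proof (cases "Z \<le> l")
      case True': True
      have gD: "D*(b-a) \<le> G - (a+b)*Z" using GG True tZ by simp
      have "Z*(b-a)*D \<le> l*(D*(b-a))"
      proof -
        have "0 \<le> D*(b-a)" using D0 True by simp
        from mult_right_mono[OF True' this] show ?thesis by (simp only: mult_ac)
      qed
      also have "\<dots> \<le> l*(G-(a+b)*Z)" using gD l by (intro mult_left_mono) auto
      finally have "Z*(b-a)*D \<le> l*(G-(a+b)*Z)" .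
      moreover have "0 \<le> eta*(y2-y3)*(G - b*Z)" using eta0 le GbZ aZ0 by simp
      ultimately show ?thesis using U0 t by linarith
    next
      case lZ: False
      have mp: "(a*c+b*d)^2 \<le> 16*a*c*d" "3*((1-a)*(1-b))*(a*c+b*d)^2 \<le> 4*a*c*d"
        using moment_products[OF ab(1) True ab(4) d dc h1 w] by auto
      have Zp2: "Z^2 \<le> Zp^2" using Zp Z by (intro power_mono) auto
      have i2: "3*k*Z^2 \<le> 4*a*c*d"
        using mult_left_mono[OF Zp2, of "3*k"] mp(2) pos by (simp add: Zp_def k_def)
      have i1: "k*Z^3 \<le> 4*a*c*d*((1-a)*c+(1-b)*d)"
      proof -
        have q: "4*x*(1-x) \<le> 1" for x :: real
          using zero_le_power2[of "2*x-1"] by (simp add: algebra_simps power2_eq_square)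
        have "k*(4*b*c) \<le> (1-a)*c"
          using mult_left_mono[OF q[of b], of "(1-a)*c"] ab c by (simp add: k_def algebra_simps)
        moreover have "k*(4*a*d) \<le> (1-b)*d"
          using mult_left_mono[OF q[of a], of "(1-b)*d"] ab d by (simp add: k_def algebra_simps)
        \<comment> \<open>Since \<open>a < b\<close> and \<open>d \<le> c\<close>, exchanging the
          weights increases the moment: \<open>a*c + b*d \<le> b*c + a*d\<close>.\<close>
        moreover have "0 \<le> k*((b-a)*(c-d))" using pos True dc by simp
        ultimately have s: "k*(4*Zp) \<le> (1-a)*c+(1-b)*d"
          by (simp add: Zp_def algebra_simps)
        have "Z^3 \<le> Zp^3" using Zp Z by (intro power_mono) auto
        then have "k*Z^3 \<le> k*Zp^3" using pos by simp
        also have "\<dots> = k*Zp*Zp^2" by (simp add: power2_eq_square power3_eq_cube)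
        also have "\<dots> \<le> k*Zp*(16*a*c*d)" using mp(1) pos Zp by (intro mult_left_mono) (auto simp: Zp_def)
        also have "\<dots> = 4*a*c*d*(k*(4*Zp))" by simp
        also have "\<dots> \<le> 4*a*c*d*((1-a)*c+(1-b)*d)" using s ab c d by (intro mult_left_mono) auto
        finally show ?thesis .
      qed
      have Qge: "(1-a)*c+(1-b)*d + l \<le> Q"
      proof -
        have "(1-a)*c+(1-b)*d + l \<le> c + d + l - Z" using Z1 by (simp add: algebra_simps)
        also have "\<dots> \<le> Q" using QQ pos by (simp add: algebra_simps)
        finally show ?thesis .
      qed
      have "k*Z*m^2 \<le> k*Z*(Z^2 + 3*Z*l)"
      proof -
        have "l*l \<le> Z*l" using lZ l by simp
        then have "m^2 \<le> Z^2+3*Z*l" by (simp add: m_def algebra_simps power2_eq_square)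
        then show ?thesis using pos Z by (intro mult_left_mono) auto
      qed
      also have "\<dots> = k*Z^3 + (3*k*Z^2)*l" by (simp add: algebra_simps power2_eq_square power3_eq_cube)
      also have "\<dots> \<le> 4*a*c*d*((1-a)*c+(1-b)*d) + (4*a*c*d)*l"
        using i1 i2 l by (intro add_mono mult_right_mono) auto
      also have "\<dots> = 4*a*c*d*((1-a)*c+(1-b)*d + l)" by (simp add: algebra_simps)
      also have "\<dots> \<le> 4*a*c*d*Q" using Qge ab c d by (intro mult_left_mono) auto
      finally have "k*Z*m^2 \<le> 4*c*d*a*Q" by (simp add: mult_ac)
      then have am: "Z*(b-a)*D \<le> c*d*(b-a)^2/k + (D/m)^2*Q*(a*Z)"
        by (intro amgm_weighted) (use pos Z c d ab D0 True in auto)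
      have "(D/m)^2*Q*(a*Z) = eta*(y2-y3)*(a*Z)"
        using pos by (simp add: D etaQ[symmetric] power2_eq_square)
      also have "\<dots> \<le> eta*(y2-y3)*(G-b*Z)" using GbZ eta0 le by (intro mult_left_mono) auto
      finally have "Z*(b-a)*D \<le> U + eta*(y2-y3)*(G-b*Z)" using am by (simp add: U_def)
      moreover have "0 \<le> l*(G-(a+b)*Z)" using l G0 tZ by simp
      ultimately show ?thesis using t by linarith
    qed
  qed
  have "Z*(a*y3+b*y2) = Z*(Zp + l*(a+b)) + eta*(y2-y3)*(b*Z) + Z*(eta*((b-a)*y3))"
    unfolding pq by (simp add: algebra_simps)
  also have "\<dots> \<le> Z*(Zp + l*(a+b)) + eta*(y2-y3)*(b*Z) + (U + l*(G-(a+b)*Z) + eta*(y2-y3)*(G - b*Z))"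
    using main by simp
  also have "\<dots> = (Z*(Zp + l*(a+b)) + U + l*(G-(a+b)*Z)) + eta*(y2-y3)*G"
  proof -
    have "eta*(y2-y3)*(b*Z) + eta*(y2-y3)*(G - b*Z) = eta*(y2-y3)*G" by (simp flip: distrib_left)
    then show ?thesis by linarith
  qed
  also have "\<dots> \<le> Q*G" using base split by linarith
  finally show ?thesis by (simp add: Q_def G_def)
qed

text \<open>The first bound is symmetric under exchanging \<open>(a, c, y3)\<close> with
  \<open>(b, d, y2)\<close>, so \<open>y3 \<le> y2\<close> may be assumed. The second is
  Cauchy-Schwarz together with \<open>(1-a)*c + (1-b)*d \<le> y2*y3/y1\<close>.\<close>

lemma coupling_bounds:
  fixes a b c d Z l y1 y2 y3 :: real
  assumes ab: "0 < a" "a < 1" "0 < b" "b < 1" and c: "0 < c" and d: "0 < d" and Z: "0 < Z" and l: "0 < l"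
    and y: "0 < y1" "0 < y2" "0 < y3"
    and Yc: "c + l = y1 + y3 - y1*y3/y2" and Yd: "d + l = y1 + y2 - y1*y2/y3"
    and YZ: "Z + l = y2 + y3 - y2*y3/y1"
    and Z1: "Z \<le> a*c + b*d" and Z2: "2*c \<le> Z + 2*b*d" and Z3: "2*d \<le> Z + 2*a*c"
    and min: "c \<le> Z \<or> d \<le> Z"
  shows "Z*(a*y3 + b*y2) \<le> y2*y3/y1 * (c*a^2/(1-a) + d*b^2/(1-b))"
    and "Z^2 \<le> y2*y3/y1 * (c*a^2/(1-a) + d*b^2/(1-b))"
proof -
  show "Z*(a*y3 + b*y2) \<le> y2*y3/y1 * (c*a^2/(1-a) + d*b^2/(1-b))"
  proof (cases "y3 \<le> y2")
    case True
    then show ?thesis using assms by (intro coupling_bound_ordered)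
  next
    case False
    have "Z*(b*y2 + a*y3) \<le> y3*y2/y1 * (d*b^2/(1-b) + c*a^2/(1-a))"
      by (rule coupling_bound_ordered[where l=l]) (use assms False in \<open>auto simp: mult_ac add_ac\<close>)
    then show ?thesis by (simp add: mult_ac add_ac)
  qed
  define G where "G = c*a^2/(1-a) + d*b^2/(1-b)"
  have G0: "0 \<le> G" using ab c d by (simp add: G_def)
  have CS: "((1-a)*c+(1-b)*d)*G = (a*c+b*d)^2 + c*d*(b-a)^2/((1-a)*(1-b))"
    unfolding G_def using ab by (simp add: divide_simps) (simp add: algebra_simps power2_eq_square)
  have "c + d + 2*l \<le> y2 + y3"
  proof -
    have "0 \<le> y1*(y2-y3)^2/(y2*y3)" using y by simp
    moreover have "y1*(y2-y3)^2/(y2*y3) = y1*y2/y3 + y1*y3/y2 - 2*y1"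
      using y by (simp add: field_simps power2_eq_square)
    ultimately show ?thesis using Yc Yd by linarith
  qed
  then have "(1-a)*c+(1-b)*d \<le> y2*y3/y1" using YZ Z1 l by (simp add: algebra_simps)
  then have "((1-a)*c+(1-b)*d)*G \<le> y2*y3/y1*G" using G0 by (rule mult_right_mono)
  moreover have "Z^2 \<le> (a*c+b*d)^2" using Z Z1 by (intro power_mono) auto
  moreover have "0 \<le> c*d*(b-a)^2/((1-a)*(1-b))" using ab c d by simp
  ultimately show "Z^2 \<le> y2*y3/y1 * (c*a^2/(1-a) + d*b^2/(1-b))" using CS by (simp add: G_def)
qed

text \<open>The Einstein equations of a metric in block form (see \<open>blk\<close> below) with Einstein constant
  \<open>l/2\<close> and all \<open>w\<^sub>i \<noteq> 0\<close>, in the variables \<open>t\<^sub>i = w\<^sub>j w\<^sub>k / w\<^sub>i\<close>.\<close>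

definition tsys :: "real \<Rightarrow> real \<Rightarrow> real \<Rightarrow> real \<Rightarrow> real \<Rightarrow> real \<Rightarrow> real \<Rightarrow> real \<Rightarrow> real
    \<Rightarrow> real \<Rightarrow> real \<Rightarrow> real \<Rightarrow> real \<Rightarrow> bool" where
  "tsys l s1 s2 s3 y1 y2 y3 t1 t2 t3 c1 c2 c3 \<longleftrightarrow>
    0 < s1 \<and> 0 < s2 \<and> 0 < s3 \<and> 0 < y1 \<and> 0 < y2 \<and> 0 < y3 \<and> 0 < t1 \<and> 0 < t2 \<and> 0 < t3 \<and>
    c1 = t2*t3*y2*y3*(1-t1)/s1 \<and> c2 = t1*t3*y1*y3*(1-t2)/s2 \<and> c3 = t1*t2*y1*y2*(1-t3)/s3 \<and>
    c1 + l = y2 + y3 - y2*y3/y1 \<and> c2 + l = y1 + y3 - y1*y3/y2 \<and> c3 + l = y1 + y2 - y1*y2/y3 \<and>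
    l - t1*c1 = s2 + s3 - s2 * s3/s1 + (1-s2/s1)*(y3*t1*t2) + (1-s3/s1)*(y2*t1*t3) \<and>
    l - t2*c2 = s1 + s3 - s1 * s3/s2 + (1-s1/s2)*(y3*t1*t2) + (1-s3/s2)*(y1*t2*t3) \<and>
    l - t3*c3 = s1 + s2 - s1 * s2/s3 + (1-s1/s3)*(y2*t1*t3) + (1-s2/s3)*(y1*t2*t3) \<and>
    c1 + y1*t2*t3*(s2-s3)^2/(s2 * s3) = t2*c2 + t3*c3 \<and>
    c2 + y2*t1*t3*(s1-s3)^2/(s1 * s3) = t1*c1 + t3*c3 \<and>
    c3 + y3*t1*t2*(s1-s2)^2/(s1 * s2) = t1*c1 + t2*c2"

section \<open>Excluding unequal \<open>s\<^sub>i\<close>\<close>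

lemma tsys_swap:
  "tsys l s1 s2 s3 y1 y2 y3 t1 t2 t3 c1 c2 c3 = tsys l s2 s1 s3 y2 y1 y3 t2 t1 t3 c2 c1 c3"
  "tsys l s1 s2 s3 y1 y2 y3 t1 t2 t3 c1 c2 c3 = tsys l s1 s3 s2 y1 y3 y2 t1 t3 t2 c1 c3 c2"
  unfolding tsys_def by (simp_all only: mult_ac add_ac conj_ac power2_commute)

lemma tsys_not_ordered:
  assumes sys: "tsys l s1 s2 s3 y1 y2 y3 t1 t2 t3 c1 c2 c3"
    and ord: "s2 \<le> s1" "s3 \<le> s2" "s3 < s1"
  shows False
proof -
  have s: "0 < s1" "0 < s2" "0 < s3" and y: "0 < y1" "0 < y2" "0 < y3" and t: "0 < t1" "0 < t2" "0 < t3"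
    and c1: "c1 = t2*t3*y2*y3*(1-t1)/s1" and c2: "c2 = t1*t3*y1*y3*(1-t2)/s2" and c3: "c3 = t1*t2*y1*y2*(1-t3)/s3"
    and Y: "c1 + l = y2 + y3 - y2*y3/y1" "c2 + l = y1 + y3 - y1*y3/y2" "c3 + l = y1 + y2 - y1*y2/y3"
    using sys by (auto simp: tsys_def)
  define a1 a2 a3 where "a1 = y1*t2*t3" and "a2 = y2*t1*t3" and "a3 = y3*t1*t2"
  define A1 A2 A3 where "A1 = a1*(s2-s3)^2/(s2 * s3)" and "A2 = a2*(s1-s3)^2/(s1 * s3)" and "A3 = a3*(s1-s2)^2/(s1 * s2)"
  have S: "l - t1*c1 = s2 + s3 - s2 * s3/s1 + (1-s2/s1)*a3 + (1-s3/s1)*a2"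
     "l - t2*c2 = s1 + s3 - s1 * s3/s2 + (1-s1/s2)*a3 + (1-s3/s2)*a1"
     "l - t3*c3 = s1 + s2 - s1 * s2/s3 + (1-s1/s3)*a2 + (1-s2/s3)*a1"
    and W: "c1 + A1 = t2*c2 + t3*c3" "c2 + A2 = t1*c1 + t3*c3" "c3 + A3 = t1*c1 + t2*c2"
    using sys by (auto simp: tsys_def a1_def a2_def a3_def A1_def A2_def A3_def)
  have a: "0 < a1" "0 < a2" "0 < a3" using y t by (simp_all add: a1_def a2_def a3_def)
  have A: "0 \<le> A1" "0 < A2" "0 \<le> A3" using a s ord by (simp_all add: A1_def A2_def A3_def)
  have sgn1: "0 < c1 \<longleftrightarrow> t1 < 1" and sgn2: "0 < c2 \<longleftrightarrow> t2 < 1" and sgn3: "0 < c3 \<longleftrightarrow> t3 < 1"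
  proof -
    have "0 < p*(1-r)/q \<longleftrightarrow> r < 1" if "0 < p" "0 < q" for p q r :: real
      using that by (simp add: zero_less_divide_iff zero_less_mult_iff)
    then show "0 < c1 \<longleftrightarrow> t1 < 1" "0 < c2 \<longleftrightarrow> t2 < 1" "0 < c3 \<longleftrightarrow> t3 < 1"
      unfolding c1 c2 c3 using s y t by simp_all
  qed
  \<comment> \<open>With \<open>K\<close> the mixed equations read \<open>(1+t1)*c1 = K - A1\<close>
    and so on. If \<open>K \<le> 0\<close>, all \<open>c\<^sub>i\<close> would be nonpositive and
    all \<open>t\<^sub>i\<close> at least 1, and the sum of the mixed equations would contradict
    \<open>0 < A2\<close>.\<close>
  define K where "K = t1*c1 + t2*c2 + t3*c3"
  have K: "(1+t1)*c1 = K - A1" "(1+t2)*c2 = K - A2" "(1+t3)*c3 = K - A3"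
    using W by (simp_all add: K_def algebra_simps)
  have K0: "0 < K"
  proof (rule ccontr)
    assume "\<not> 0 < K"
    then have "(1+t1)*c1 \<le> 0" "(1+t2)*c2 \<le> 0" "(1+t3)*c3 \<le> 0" using K A by auto
    then have n: "c1 \<le> 0" "c2 \<le> 0" "c3 \<le> 0" using t by (simp_all add: mult_le_0_iff)
    then have "1 \<le> t1" "1 \<le> t2" "1 \<le> t3" using sgn1 sgn2 sgn3 by auto
    then have m: "t1*c1 \<le> c1" "t2*c2 \<le> c2" "t3*c3 \<le> c3"
      using n mult_right_mono_neg[of 1 t1 c1] mult_right_mono_neg[of 1 t2 c2] mult_right_mono_neg[of 1 t3 c3] by auto
    then show False using W A n by linarith
  qed
  \<comment> \<open>The difference of the diagonal equations for the largest and the smallest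
    \<open>s\<^sub>i\<close>. Its \<open>a1\<close> term alone dominates \<open>A1\<close>, and its
    first term is positive; hence \<open>A1 < J\<close>, from which all the signs follow.\<close>
  define J where "J = t3*c3 - t1*c1"
  have J: "J = (s1-s3)*(s2/s3+s2/s1-1) + a2*(s1/s3-s3/s1) + a3*(1-s2/s1) + a1*(s2/s3-1)"
  proof -
    have "(s1-s3)*(s2/s3+s2/s1-1) = s1 * s2/s3 - s1 - s2 * s3/s1 + s3"
      using s by (simp add: field_simps power2_eq_square)
    then show ?thesis using S(1,3) unfolding J_def by (simp add: algebra_simps)
  qed
  have r: "1 \<le> s2/s3" "s2/s1 \<le> 1" "1 < s1/s3" "s3/s1 < 1" "0 < s2/s1" using s ord by simp_all
  have A1: "A1 \<le> a1*(s2/s3-1)"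
  proof -
    have "(s2-s3)^2/(s2 * s3) = (s2/s3-1)*(1-s3/s2)" using s by (simp add: field_simps power2_eq_square)
    also have "\<dots> \<le> (s2/s3-1)*1" using r s by (intro mult_left_mono) auto
    finally show ?thesis using a by (simp add: A1_def mult_left_mono flip: times_divide_eq_right)
  qed
  have JA: "A1 < J"
  proof -
    have "0 < (s1-s3)*(s2/s3+s2/s1-1)" using r ord by (intro mult_pos_pos) auto
    moreover have "0 \<le> a2*(s1/s3-s3/s1)" "0 \<le> a3*(1-s2/s1)" using r a by simp_all
    ultimately show ?thesis using J A1 by linarith
  qed
  have t13: "t1 < t3"
  proof (rule ccontr)
    assume n: "\<not> ?thesis"
    have "(1+t1)*(1+t3)*J = t3*(1+t1)*((1+t3)*c3) - t1*(1+t3)*((1+t1)*c1)"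
      by (simp add: J_def algebra_simps)
    also have "\<dots> = K*(t3-t1) - t3*(1+t1)*A3 + t1*(1+t3)*A1"
      unfolding K by (simp add: algebra_simps)
    also have "\<dots> \<le> 0 - 0 + (1+t1)*(1+t3)*A1"
      using n K0 A t by (intro add_mono diff_mono mult_right_mono) (auto simp: mult_nonneg_nonpos)
    finally have "J \<le> A1" using t by simp
    then show False using JA by simp
  qed
  have c13: "c3 < c1" using W JA A by (simp add: J_def)
  have J0: "t1*c1 < t3*c3" using JA A by (simp add: J_def)
  have c3p: "0 < c3"
  proof (rule ccontr)
    assume n: "\<not> ?thesis"
    then have "t3*c3 \<le> 0" using t by (simp add: mult_nonneg_nonpos)
    then have "t1*c1 < 0" using J0 by linarith
    then have "c1 < 0" using t by (simp add: mult_less_0_iff)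
    have "t3*c3 \<le> t3*c1" using c13 t by simp
    also have "\<dots> \<le> t1*c1" using t13 \<open>c1 < 0\<close> by (simp add: mult_right_mono_neg)
    finally show False using J0 by simp
  qed
  then have c1p: "0 < c1" using c13 by simp
  have t3: "t3 < 1" and t1: "t1 < 1" using sgn1 sgn3 c1p c3p by auto
  have c2p: "0 < c2"
  proof (rule ccontr)
    assume "\<not> ?thesis"
    then have "t2*c2 \<le> 0" using t by (simp add: mult_nonneg_nonpos)
    then have "c3 < t3*c3" using W(3) A J0 by linarith
    then show False using c3p t3 by (simp add: mult_less_cancel_right1)
  qed
  then have t2: "t2 < 1" using sgn2 by auto
  have l: "0 < l"
  proof -
    have "s2 * s3/s1 \<le> s3" using s ord by (simp add: divide_simps mult_right_mono mult.commute)
    moreover have "0 \<le> (1-s2/s1)*a3" "0 \<le> (1-s3/s1)*a2" "0 < t1*c1" using r a t c1p by simp_all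
    ultimately show ?thesis using S(1) s by linarith
  qed
  define al be where "al = s1/s2" and "be = s1/s3"
  have albe: "1 \<le> al" "1 < be" using s ord by (simp_all add: al_def be_def)
  \<comment> \<open>The first diagonal equation is compared with each of the other two and the
    results are added; \<open>W(1)\<close> replaces \<open>t2*c2 + t3*c3\<close>.\<close>
  have I1: "a2*(be - 1 + 2*(1-1/be)) + a3*(al - 1 + 2*(1-1/al)) \<le> c1*(1-2*t1)"
  proof -
    have "c1*(1-2*t1) = (l - t1*c1 - (l - t2*c2)) + (l - t1*c1 - (l - t3*c3)) - A1"
      using W(1) by (simp add: algebra_simps)
    also have "\<dots> = (s1*(s2-s3)^2/(s2 * s3) + s2*(1-s3/s1) + s3*(1-s2/s1))
        + a2*(be - 1 + 2*(1-1/be)) + a3*(al - 1 + 2*(1-1/al))"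
      unfolding S A1_def al_def be_def using s
      by (simp add: divide_simps) (simp add: algebra_simps power2_eq_square)
    finally have "c1*(1-2*t1) = (s1*(s2-s3)^2/(s2 * s3) + s2*(1-s3/s1) + s3*(1-s2/s1))
        + a2*(be - 1 + 2*(1-1/be)) + a3*(al - 1 + 2*(1-1/al))" .
    moreover have "0 \<le> s1*(s2-s3)^2/(s2 * s3)" "0 \<le> s2*(1-s3/s1)" "0 \<le> s3*(1-s2/s1)"
      using s r by simp_all
    ultimately show ?thesis by linarith
  qed
  have phi: "0 \<le> al - 1 + 2*(1-1/al)" "0 < be - 1 + 2*(1-1/be)"
  proof -
    have "1/al \<le> 1" "1/be < 1" using albe by simp_all
    then show "0 \<le> al - 1 + 2*(1-1/al)" and "0 < be - 1 + 2*(1-1/be)" using albe by (simp_all only: diff_ge_0_iff_ge add_nonneg_nonneg diff_gt_0_iff_gt add_pos_pos mult_nonneg_nonneg zero_le_numeral mult_pos_pos zero_less_numeral)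
  qed
  have "0 < c1*(1-2*t1)"
  proof -
    have "0 < a2*(be - 1 + 2*(1-1/be))" "0 \<le> a3*(al - 1 + 2*(1-1/al))" using a phi by simp_all
    then show ?thesis using I1 by linarith
  qed
  then have th: "2*t1 < 1" using c1p by (simp add: zero_less_mult_iff)
  have tc: "2*(t1*c1) \<le> c1" using th c1p by simp
  define Q G where "Q = y2*y3/y1" and "G = c2*t2^2/(1-t2) + c3*t3^2/(1-t3)"
  \<comment> \<open>Here \<open>Z = c1\<close>. The condition \<open>2*c2 \<le> c1 + 2*t3*c3\<close>
    is \<open>W(2)\<close> combined with \<open>2*t1 < 1\<close>, likewise with \<open>c2\<close>,
    \<open>t2\<close> and \<open>c3\<close>, \<open>t3\<close> exchanged, and \<open>c3 < c1\<close>
    supplies \<open>min\<close>.\<close>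
  have cr: "c1*(t2*y3 + t3*y2) \<le> Q*G" "c1^2 \<le> Q*G"
    unfolding Q_def G_def
    by (rule coupling_bounds[where l=l]; (use t t1 t2 t3 c1p c2p c3p l y Y W A tc c13 in linarith)?)+
  define u where "u = (1-t1)/t1"
  have u: "1 < u" using th t by (simp add: u_def)
  define p q where "p = t2*y3" and "q = t3*y2"
  \<comment> \<open>In \<open>G\<close> the denominators \<open>1-t2\<close> and \<open>1-t3\<close>
    cancel against \<open>c2\<close> and \<open>c3\<close>, and the factor \<open>1-t1\<close> in
    \<open>u\<close> restores \<open>c1\<close>. The ratios of the \<open>s\<^sub>i\<close> are all
    that is left over.\<close>
  have X: "u*(Q*G) = c1*(p*al + q*be)"
  proof -
    have "u*(Q*(c2*t2^2/(1-t2))) = c1*(p*al)"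
      unfolding u_def Q_def c1 c2 p_def al_def using s y t t2
      by (simp add: divide_simps) (simp add: power2_eq_square)
    moreover have "u*(Q*(c3*t3^2/(1-t3))) = c1*(q*be)"
      unfolding u_def Q_def c1 c3 q_def be_def using s y t t3
      by (simp add: divide_simps) (simp add: power2_eq_square)
    ultimately show ?thesis unfolding G_def by (simp add: algebra_simps)
  qed
  have "t1*(q*(be - 1 + 2*(1-1/be)) + p*(al - 1 + 2*(1-1/al))) \<le> t1*(c1*(u-1))"
    using I1 t by (simp add: a2_def a3_def p_def q_def u_def algebra_simps diff_divide_distrib)
  then have "q*(be - 1 + 2*(1-1/be)) + p*(al - 1 + 2*(1-1/al)) \<le> c1*(u-1)" using t by simp
  moreover have "q*(be-1) < q*(be - 1 + 2*(1-1/be))"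
  proof (rule mult_strict_left_mono)
    have "1/be < 1" using albe by simp
    then show "be-1 < be - 1 + 2*(1-1/be)"
      by (simp only: less_add_same_cancel1 diff_gt_0_iff_gt mult_pos_pos zero_less_numeral)
  qed (use t y in \<open>simp add: q_def\<close>)
  moreover have "p*(al-1) \<le> p*(al - 1 + 2*(1-1/al))"
  proof (rule mult_left_mono)
    have "1/al \<le> 1" using albe by simp
    then show "al-1 \<le> al - 1 + 2*(1-1/al)"
      by (simp only: le_add_same_cancel1 diff_ge_0_iff_ge mult_nonneg_nonneg zero_le_numeral)
  qed (use t y in \<open>simp add: p_def\<close>)
  \<comment> \<open>The positive terms \<open>2*(1-1/be)\<close> and \<open>2*(1-1/al)\<close> are
    dropped. Multiplied by \<open>c1\<close> and combined with \<open>X\<close> and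
    \<open>c1^2 \<le> Q*G\<close>, this yields \<open>Q*G < c1*(p+q)\<close>, against the first
    bound in \<open>cr\<close>.\<close>
  ultimately have "(p*al + q*be) - (p+q) < c1*(u-1)" by (simp add: algebra_simps)
  then have "c1*((p*al + q*be) - (p+q)) < c1*(c1*(u-1))" using c1p by simp
  moreover have "c1*((p*al + q*be) - (p+q)) = u*(Q*G) - c1*(p+q)"
    unfolding X by (simp add: algebra_simps)
  moreover have "(u-1)*c1^2 \<le> (u-1)*(Q*G)" using cr u by (intro mult_left_mono) auto
  ultimately show False using cr(1) by (simp add: p_def q_def algebra_simps power2_eq_square)
qed

text \<open>The two transpositions generate all permutations of the indices, so one of the six
  instances has its \<open>s\<^sub>i\<close> in the order excluded above unless they agree.\<close>

lemma tsys_s_equal: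
  assumes sys: "tsys l s1 s2 s3 y1 y2 y3 t1 t2 t3 c1 c2 c3"
  shows "s1 = s2 \<and> s2 = s3"
proof -
  note sw = tsys_swap
  have o: "s1 = s3" if "tsys l s1 s2 s3 y1 y2 y3 t1 t2 t3 c1 c2 c3" "s2 \<le> s1" "s3 \<le> s2"
    for l s1 s2 s3 y1 y2 y3 t1 t2 t3 c1 c2 c3
    using tsys_not_ordered[OF that] that by fastforce
  have s1: "tsys l s2 s1 s3 y2 y1 y3 t2 t1 t3 c2 c1 c3" using sys sw(1) by blast
  have s2: "tsys l s1 s3 s2 y1 y3 y2 t1 t3 t2 c1 c3 c2" using sys sw(2) by blast
  have s3: "tsys l s2 s3 s1 y2 y3 y1 t2 t3 t1 c2 c3 c1" using s1 sw(2) by blast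
  have s4: "tsys l s3 s1 s2 y3 y1 y2 t3 t1 t2 c3 c1 c2" using s2 sw(1) by blast
  have s5: "tsys l s3 s2 s1 y3 y2 y1 t3 t2 t1 c3 c2 c1" using s3 sw(1) by blast
  show ?thesis
    using o[OF sys] o[OF s1] o[OF s2] o[OF s3] o[OF s4] o[OF s5] by linarith
qed

text \<open>These are the Einstein equations of a diagonal left-invariant metric on
  \<open>SU(2)\<close>, added in pairs. Their differences factor as
  \<open>(L - 2*y3)*(y1 - y2) = 0\<close>, and the branches with unequal \<open>y\<^sub>i\<close>
  would make one of them vanish.\<close>

lemma su2_einstein:
  fixes y1 y2 y3 L :: real
  assumes y: "0 < y1" "0 < y2" "0 < y3"
    and Y: "L = y2 + y3 - y2*y3/y1" "L = y1 + y3 - y1*y3/y2" "L = y1 + y2 - y1*y2/y3"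
  shows "y1 = L" "y2 = L" "y3 = L"
proof -
  have L: "L*y1 = y1*y2+y1*y3-y2*y3" "L*y2 = y1*y2+y2*y3-y1*y3" "L*y3 = y1*y3+y2*y3-y1*y2"
    using y by (subst Y; simp add: field_simps)+
  have "(L - 2*y3)*(y1-y2) = 0" "(L-2*y2)*(y1-y3) = 0" "(L-2*y1)*(y2-y3) = 0"
    using L by (simp_all add: algebra_simps)
  then have d: "L = 2*y3 \<or> y1 = y2" "L = 2*y2 \<or> y1 = y3" "L = 2*y1 \<or> y2 = y3" by auto
  have "y1 = y2 \<and> y2 = y3"
  proof (rule ccontr)
    assume "\<not> ?thesis"
    then consider "y1 = y2" "y1 \<noteq> y3" "L = 2*y2" | "y1 = y3" "y1 \<noteq> y2" "L = 2*y3" | "y2 = y3" "y1 \<noteq> y2" "L = 2*y3"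
      using d by fastforce
    then show False using L y by cases auto
  qed
  then show "y1 = L" "y2 = L" "y3 = L" using L y by auto
qed

section \<open>Solving the block equations\<close>

lemma tsys_solutions:
  assumes sys: "tsys l s1 s2 s3 y1 y2 y3 t1 t2 t3 c1 c2 c3"
  shows "s1 = s2 \<and> s2 = s3 \<and> y1 = y2 \<and> y2 = y3 \<and>
    (t1 = 1 \<and> t2 = 1 \<and> t3 = 1 \<and> y1 = s1 \<or> t1 = 1/2 \<and> t2 = 1/2 \<and> t3 = 1/2 \<and> (3*y1 = 4 * s1 \<or> y1 = 4 * s1))"
proof -
  have se: "s2 = s1" "s3 = s1" using tsys_s_equal[OF sys] by auto
  have p: "0 < s1" "0 < y1" "0 < y2" "0 < y3" "0 < t1" "0 < t2" "0 < t3"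
    and c1: "c1 = t2*t3*y2*y3*(1-t1)/s1" and c2: "c2 = t1*t3*y1*y3*(1-t2)/s1" and c3: "c3 = t1*t2*y1*y2*(1-t3)/s1"
    and Y: "c1 + l = y2 + y3 - y2*y3/y1" "c2 + l = y1 + y3 - y1*y3/y2" "c3 + l = y1 + y2 - y1*y2/y3"
    and S: "l - t1*c1 = s1 + s1 - s1 * s1/s1 + (1-s1/s1)*(y3*t1*t2) + (1-s1/s1)*(y2*t1*t3)"
     "l - t2*c2 = s1 + s1 - s1 * s1/s1 + (1-s1/s1)*(y3*t1*t2) + (1-s1/s1)*(y1*t2*t3)"
     "l - t3*c3 = s1 + s1 - s1 * s1/s1 + (1-s1/s1)*(y2*t1*t3) + (1-s1/s1)*(y1*t2*t3)"
    and W: "c1 + y1*t2*t3*(s1-s1)^2/(s1 * s1) = t2*c2+t3*c3"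
     "c2 + y2*t1*t3*(s1-s1)^2/(s1 * s1) = t1*c1+t3*c3" "c3 + y3*t1*t2*(s1-s1)^2/(s1 * s1) = t1*c1+t2*c2"
    using sys unfolding tsys_def se by blast+
  have S: "t1*c1 = l - s1" "t2*c2 = l - s1" "t3*c3 = l - s1" using S p(1) by auto
  have ce: "c1 = 2*(l-s1)" "c2 = 2*(l-s1)" "c3 = 2*(l-s1)" using W unfolding S by auto
  define L where "L = 2*(l-s1) + l"
  have y: "y1 = L" "y2 = L" "y3 = L"
  proof -
    have "L = y2 + y3 - y2*y3/y1" "L = y1 + y3 - y1*y3/y2" "L = y1 + y2 - y1*y2/y3"
      using Y unfolding ce L_def by linarith+
    from su2_einstein[OF p(2-4) this] show "y1 = L" "y2 = L" "y3 = L" .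
  qed
  show ?thesis
  proof (cases "l = s1")
    case True
    then have "t1 = 1" "t2 = 1" "t3 = 1" using c1 c2 c3 ce p by auto
    then show ?thesis using y se True by (simp add: L_def)
  next
    case False
    have "(2*t1-1)*(l-s1) = 0" "(2*t2-1)*(l-s1) = 0" "(2*t3-1)*(l-s1) = 0"
      using S unfolding ce by (simp_all add: algebra_simps)
    then have t: "t1 = 1/2" "t2 = 1/2" "t3 = 1/2" using False by auto
    \<comment> \<open>For \<open>t\<^sub>i = 1/2\<close> the definition of \<open>c1\<close> becomes
      a quadratic equation for \<open>L\<close>. The root \<open>4/3 * s1\<close> leads to
      \<open>g_NK\<close>, the root \<open>4 * s1\<close> to a disguised form of
      \<open>g_can\<close>.\<close>
    have "2*(l-s1) = L*L/(8 * s1)" using c1 ce t y by simp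
    moreover have "l = (L+2 * s1)/3" by (simp add: L_def)
    ultimately have "3*L*L = 16 * s1*L - 16 * s1 * s1" using p by (simp add: field_simps)
    then have "(3*L-4 * s1)*(L-4 * s1) = 0" by (simp add: algebra_simps)
    then show ?thesis using y se t by auto
  qed
qed

text \<open>The Einstein equations carrying index 1: the direction \<open>E\<^sub>1\<close>, the
  direction \<open>F\<^sub>1 + w\<^sub>1 E\<^sub>1\<close>, and the mixed component scaled by
  \<open>-2*y1\<close>. Cyclic shifts of the arguments give the other six equations in use.\<close>

definition blk_eqs :: "real \<Rightarrow> real \<Rightarrow> real \<Rightarrow> real \<Rightarrow> real \<Rightarrow> real \<Rightarrow> real \<Rightarrow> real \<Rightarrow> real \<Rightarrow> real \<Rightarrow> bool" where
  "blk_eqs lam s1 s2 s3 w1 w2 w3 y1 y2 y3 \<longleftrightarrow>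
    s1 - (s1 * s3/s2 + s1 * s2/s3 - s2 * s3/s1)/2 - y3*w3^2*(s1/s2-s2/s1)/2 - y2*w2^2*(s1/s3-s3/s1)/2
      + y2*y3/s1*(w2*w3-w1)^2/2 = lam \<and>
    y1 - (y1*y3/y2 + y1*y2/y3 - y2*y3/y1)/2 - (y1*(s2-s3)^2/(s2 * s3)*w1^2 + y1*y3/s2*(w1*w3-w2)^2
      + y1*y2/s3*(w1*w2-w3)^2)/2 = lam \<and>
    y1*(s2-s3)^2/(s2 * s3)*w1 + y2*y3/s1*(w1-w2*w3) + y1*y3/s2*w3*(w3*w1-w2) + y1*y2/s3*w2*(w1*w2-w3) = 0"

lemma blk_eqs_zero:
  assumes pos: "0 < s1" "0 < s2" "0 < s3" "0 < y1" "0 < y2" "0 < y3"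
    and e: "blk_eqs lam s1 s2 s3 w1 w2 w3 y1 y2 y3" and w: "w1*w2*w3 \<le> 0"
  shows "w1 = 0"
proof -
  define A B C D where "A = y1*(s2-s3)^2/(s2 * s3)" and "B = y2*y3/s1" and "C = y1*y3/s2" and "D = y1*y2/s3"
  have p: "0 \<le> A" "0 < B" "0 \<le> C" "0 \<le> D" using pos by (simp_all add: A_def B_def C_def D_def)
  have "w1*(A*w1 + B*(w1-w2*w3) + C*w3*(w3*w1-w2) + D*w2*(w1*w2-w3)) = 0"
    using e by (simp add: blk_eqs_def A_def B_def C_def D_def)
  then have "A*w1^2 + B*w1^2 + C*(w3*w1)^2 + D*(w1*w2)^2 + (B+C+D)*(-(w1*w2*w3)) = 0"
    by (simp add: algebra_simps power2_eq_square)
  moreover have "0 \<le> A*w1^2" "0 \<le> B*w1^2" "0 \<le> C*(w3*w1)^2" "0 \<le> D*(w1*w2)^2" using p by simp_all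
  moreover have "0 \<le> (B+C+D)*(-(w1*w2*w3))" using p w by (intro mult_nonneg_nonneg) auto
  ultimately have "B*w1^2 = 0" by linarith
  then show ?thesis using p by simp
qed

lemma blk_eqs_tsys:
  fixes s1 s2 s3 w1 w2 w3 y1 y2 y3 lam :: real
  assumes pos: "0 < s1" "0 < s2" "0 < s3" "0 < y1" "0 < y2" "0 < y3"
    and e1: "blk_eqs lam s1 s2 s3 w1 w2 w3 y1 y2 y3"
    and e2: "blk_eqs lam s2 s3 s1 w2 w3 w1 y2 y3 y1"
    and e3: "blk_eqs lam s3 s1 s2 w3 w1 w2 y3 y1 y2"
    and w: "0 < w1*w2*w3"
  defines "t1 \<equiv> w2*w3/w1" and "t2 \<equiv> w1*w3/w2" and "t3 \<equiv> w1*w2/w3"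
  shows "tsys (2*lam) s1 s2 s3 y1 y2 y3 t1 t2 t3 (t2*t3*y2*y3*(1-t1)/s1) (t1*t3*y1*y3*(1-t2)/s2) (t1*t2*y1*y2*(1-t3)/s3)"
proof -
  have w0: "w1 \<noteq> 0" "w2 \<noteq> 0" "w3 \<noteq> 0" using w by auto
  have t: "0 < t1" "0 < t2" "0 < t3"
    using w w0 unfolding t1_def t2_def t3_def
    by (auto simp: zero_less_divide_iff zero_less_mult_iff mult_less_0_iff)
  have tt: "t2*t3 = w1^2" "t1*t3 = w2^2" "t1*t2 = w3^2"
    using w0 by (simp_all add: t1_def t2_def t3_def power2_eq_square)
  define B1 B2 B3 where "B1 = y2*y3/s1" and "B2 = y1*y3/s2" and "B3 = y1*y2/s3"
  define r1 r2 r3 where "r1 = w1 - w2*w3" and "r2 = w2 - w1*w3" and "r3 = w3 - w1*w2"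
  define c1 c2 c3 where "c1 = B1*w1*r1" and "c2 = B2*w2*r2" and "c3 = B3*w3*r3"
  define d1 d2 d3 where "d1 = B1*(w2*w3)*r1" and "d2 = B2*(w1*w3)*r2" and "d3 = B3*(w1*w2)*r3"
  define a1 a2 a3 where "a1 = y1*w1^2" and "a2 = y2*w2^2" and "a3 = y3*w3^2"
  define A1 A2 A3 where "A1 = y1*(s2-s3)^2/(s2 * s3)*w1^2" and "A2 = y2*(s1-s3)^2/(s1 * s3)*w2^2" and "A3 = y3*(s1-s2)^2/(s1 * s2)*w3^2"
  have c: "t2*t3*y2*y3*(1-t1)/s1 = c1" "t1*t3*y1*y3*(1-t2)/s2 = c2" "t1*t2*y1*y2*(1-t3)/s3 = c3"
  proof -
    have r: "w1^2*(1-t1) = w1*r1" "w2^2*(1-t2) = w2*r2" "w3^2*(1-t3) = w3*r3"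
      using w0 by (simp_all add: r1_def r2_def r3_def t1_def t2_def t3_def field_simps power2_eq_square)
    have "t2*t3*y2*y3*(1-t1)/s1 = B1*(t2*t3*(1-t1))" "t1*t3*y1*y3*(1-t2)/s2 = B2*(t1*t3*(1-t2))"
      "t1*t2*y1*y2*(1-t3)/s3 = B3*(t1*t2*(1-t3))"
      by (simp_all add: B1_def B2_def B3_def)
    then show "t2*t3*y2*y3*(1-t1)/s1 = c1" "t1*t3*y1*y3*(1-t2)/s2 = c2" "t1*t2*y1*y2*(1-t3)/s3 = c3"
      unfolding tt r c1_def c2_def c3_def by (simp_all only: mult.assoc)
  qed
  have d: "t1*c1 = d1" "t2*c2 = d2" "t3*c3 = d3"
    using w0 by (simp_all add: c1_def c2_def c3_def d1_def d2_def d3_def t1_def t2_def t3_def)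
  \<comment> \<open>Since \<open>r1^2 = w1*r1 - w2*w3*r1\<close>, the quadratic terms of the
    diagonal equations become linear in \<open>c\<^sub>i\<close> and \<open>d\<^sub>i\<close>;
    \<open>W\<close> can then eliminate the \<open>A\<^sub>i\<close>.\<close>
  have br: "B1*r1^2 = c1 - d1" "B2*r2^2 = c2-d2" "B3*r3^2 = c3-d3"
    by (simp_all add: c1_def c2_def c3_def d1_def d2_def d3_def r1_def r2_def r3_def algebra_simps power2_eq_square)
  have W: "c1 + A1 = d2 + d3" "c2 + A2 = d1 + d3" "c3 + A3 = d1 + d2"
  proof -
    have z: "w1*(y1*(s2-s3)^2/(s2 * s3)*w1 + y2*y3/s1*(w1-w2*w3) + y1*y3/s2*w3*(w3*w1-w2) + y1*y2/s3*w2*(w1*w2-w3)) = 0"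
      "w2*(y2*(s3-s1)^2/(s3 * s1)*w2 + y3*y1/s2*(w2-w3*w1) + y2*y1/s3*w1*(w1*w2-w3) + y2*y3/s1*w3*(w2*w3-w1)) = 0"
      "w3*(y3*(s1-s2)^2/(s1 * s2)*w3 + y1*y2/s3*(w3-w1*w2) + y3*y2/s1*w2*(w2*w3-w1) + y3*y1/s2*w1*(w3*w1-w2)) = 0"
      using e1 e2 e3 by (simp_all add: blk_eqs_def)
    have "w1*(y1*(s2-s3)^2/(s2 * s3)*w1 + y2*y3/s1*(w1-w2*w3) + y1*y3/s2*w3*(w3*w1-w2) + y1*y2/s3*w2*(w1*w2-w3))
      = A1 + c1 - d2 - d3"
      unfolding A1_def c1_def d2_def d3_def B1_def B2_def B3_def r1_def r2_def r3_def
      by (simp add: algebra_simps power2_eq_square diff_divide_distrib)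
    with z(1) show "c1 + A1 = d2 + d3" by linarith
    have "w2*(y2*(s3-s1)^2/(s3 * s1)*w2 + y3*y1/s2*(w2-w3*w1) + y2*y1/s3*w1*(w1*w2-w3) + y2*y3/s1*w3*(w2*w3-w1))
      = A2 + c2 - d1 - d3"
      unfolding A2_def c2_def d1_def d3_def B1_def B2_def B3_def r1_def r2_def r3_def
      by (simp add: algebra_simps power2_eq_square diff_divide_distrib)
    with z(2) show "c2 + A2 = d1 + d3" by linarith
    have "w3*(y3*(s1-s2)^2/(s1 * s2)*w3 + y1*y2/s3*(w3-w1*w2) + y3*y2/s1*w2*(w2*w3-w1) + y3*y1/s2*w1*(w3*w1-w2))
      = A3 + c3 - d1 - d2"
      unfolding A3_def c3_def d1_def d2_def B1_def B2_def B3_def r1_def r2_def r3_def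
      by (simp add: algebra_simps power2_eq_square diff_divide_distrib)
    with z(3) show "c3 + A3 = d1 + d2" by linarith
  qed
  have Y: "y1 - (y1*y3/y2 + y1*y2/y3 - y2*y3/y1)/2 - (A1 + (c2-d2) + (c3-d3))/2 = lam"
    "y2 - (y1*y2/y3 + y2*y3/y1 - y1*y3/y2)/2 - (A2 + (c3-d3) + (c1-d1))/2 = lam"
    "y3 - (y2*y3/y1 + y1*y3/y2 - y1*y2/y3)/2 - (A3 + (c1-d1) + (c2-d2))/2 = lam"
    unfolding br[symmetric]
    using e1 e2 e3 by (simp_all add: blk_eqs_def A1_def A2_def A3_def B1_def B2_def B3_def r1_def r2_def r3_def mult_ac power2_commute)
  have S: "s1 - (s1 * s3/s2 + s1 * s2/s3 - s2 * s3/s1)/2 - a3*(s1/s2-s2/s1)/2 - a2*(s1/s3-s3/s1)/2 + (c1-d1)/2 = lam"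
   "s2 - (s1 * s2/s3 + s2 * s3/s1 - s1 * s3/s2)/2 - a1*(s2/s3-s3/s2)/2 - a3*(s2/s1-s1/s2)/2 + (c2-d2)/2 = lam"
   "s3 - (s2 * s3/s1 + s1 * s3/s2 - s1 * s2/s3)/2 - a2*(s3/s1-s1/s3)/2 - a1*(s3/s2-s2/s3)/2 + (c3-d3)/2 = lam"
    unfolding br[symmetric]
    using e1 e2 e3 by (simp_all add: blk_eqs_def a1_def a2_def a3_def B1_def B2_def B3_def r1_def r2_def r3_def mult_ac power2_commute)
  have AA: "A1 = a1*(s2/s3) + a1*(s3/s2) - 2*a1" "A2 = a2*(s1/s3) + a2*(s3/s1) - 2*a2" "A3 = a3*(s1/s2) + a3*(s2/s1) - 2*a3"
    unfolding A1_def A2_def A3_def a1_def a2_def a3_def using pos by (simp_all add: field_simps power2_eq_square)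
  have Y': "c1 + 2*lam = y2 + y3 - y2*y3/y1" "c2 + 2*lam = y1 + y3 - y1*y3/y2" "c3 + 2*lam = y1 + y2 - y1*y2/y3"
  proof -
    define g1 g2 g3 where "g1 = y2*y3/y1" and "g2 = y1*y3/y2" and "g3 = y1*y2/y3"
    note Y' = Y[folded g1_def g2_def g3_def]
    have "c1 + 2*lam = y2 + y3 - g1" "c2 + 2*lam = y1 + y3 - g2" "c3 + 2*lam = y1 + y2 - g3"
      using Y' W by - argo+
    then show "c1 + 2*lam = y2 + y3 - y2*y3/y1" "c2 + 2*lam = y1 + y3 - y1*y3/y2" "c3 + 2*lam = y1 + y2 - y1*y2/y3"
      by (simp_all add: g1_def g2_def g3_def)
  qed
  have S': "2*lam - d1 = s2 + s3 - s2 * s3/s1 + (1-s2/s1)*a3 + (1-s3/s1)*a2"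
     "2*lam - d2 = s1 + s3 - s1 * s3/s2 + (1-s1/s2)*a3 + (1-s3/s2)*a1"
     "2*lam - d3 = s1 + s2 - s1 * s2/s3 + (1-s1/s3)*a2 + (1-s2/s3)*a1"
  proof -
    define k1 k2 k3 where "k1 = s2 * s3/s1" and "k2 = s1 * s3/s2" and "k3 = s1 * s2/s3"
    define m12 m13 m21 m23 m31 m32 where "m12 = a3*(s1/s2)" and "m13 = a2*(s1/s3)" and "m21 = a3*(s2/s1)"
      and "m23 = a1*(s2/s3)" and "m31 = a2*(s3/s1)" and "m32 = a1*(s3/s2)"
    note defs = k1_def k2_def k3_def m12_def m13_def m21_def m23_def m31_def m32_def
    have "s1 - (k2 + k3 - k1)/2 - (m12-m21)/2 - (m13-m31)/2 + (c1-d1)/2 = lam"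
      "s2 - (k3 + k1 - k2)/2 - (m23-m32)/2 - (m21-m12)/2 + (c2-d2)/2 = lam"
      "s3 - (k1 + k2 - k3)/2 - (m31-m13)/2 - (m32-m23)/2 + (c3-d3)/2 = lam"
      using S unfolding defs by (simp_all only: right_diff_distrib)
    then have "2*lam - d1 = s2 + s3 - k1 + (a3 - m21) + (a2 - m31)"
      "2*lam - d2 = s1 + s3 - k2 + (a3 - m12) + (a1 - m32)"
      "2*lam - d3 = s1 + s2 - k3 + (a2 - m13) + (a1 - m23)"
      using W unfolding AA[folded m12_def m13_def m21_def m23_def m31_def m32_def] by - argo+
    then show "2*lam - d1 = s2 + s3 - s2 * s3/s1 + (1-s2/s1)*a3 + (1-s3/s1)*a2"
     "2*lam - d2 = s1 + s3 - s1 * s3/s2 + (1-s1/s2)*a3 + (1-s3/s2)*a1"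
     "2*lam - d3 = s1 + s2 - s1 * s2/s3 + (1-s1/s3)*a2 + (1-s2/s3)*a1"
      unfolding defs by (simp_all add: algebra_simps)
  qed
  have aa: "y3*t1*t2 = a3" "y2*t1*t3 = a2" "y1*t2*t3 = a1"
    by (simp_all add: mult.assoc tt a1_def a2_def a3_def)
  have AAA: "a1*(s2-s3)^2/(s2 * s3) = A1" "a2*(s1-s3)^2/(s1 * s3) = A2" "a3*(s1-s2)^2/(s1 * s2) = A3"
    by (simp_all add: A1_def A2_def A3_def a1_def a2_def a3_def)
  show ?thesis
    unfolding c unfolding tsys_def c d aa AAA
    using pos t Y' S' W c by blast
qed

lemma blk_eqs_solutions:
  fixes s1 s2 s3 w1 w2 w3 y1 y2 y3 lam :: real
  assumes pos: "0 < s1" "0 < s2" "0 < s3" "0 < y1" "0 < y2" "0 < y3"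
    and e1: "blk_eqs lam s1 s2 s3 w1 w2 w3 y1 y2 y3"
    and e2: "blk_eqs lam s2 s3 s1 w2 w3 w1 y2 y3 y1"
    and e3: "blk_eqs lam s3 s1 s2 w3 w1 w2 y3 y1 y2"
  shows "s1 = s2 \<and> s2 = s3 \<and> y1 = y2 \<and> y2 = y3 \<and>
    (w1 = 0 \<and> w2 = 0 \<and> w3 = 0 \<and> y1 = s1 \<or>
     0 < w1*w2*w3 \<and> w1^2 = 1 \<and> w2^2 = 1 \<and> w3^2 = 1 \<and> y1 = s1 \<or>
     0 < w1*w2*w3 \<and> w1^2 = 1/4 \<and> w2^2 = 1/4 \<and> w3^2 = 1/4 \<and> (3*y1 = 4 * s1 \<or> y1 = 4 * s1))"
proof (cases "w1*w2*w3 \<le> 0")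
  case True
  have w: "w1 = 0" "w2 = 0" "w3 = 0"
    using blk_eqs_zero[OF pos e1] blk_eqs_zero[OF _ _ _ _ _ _ e2] blk_eqs_zero[OF _ _ _ _ _ _ e3] pos True
    by (simp_all add: mult_ac)
  have "2*lam = y2 + y3 - y2*y3/y1" "2*lam = y1 + y3 - y1*y3/y2" "2*lam = y1 + y2 - y1*y2/y3"
  proof -
    have "y1 - (y1*y3/y2 + y1*y2/y3 - y2*y3/y1)/2 = lam" "y2 - (y1*y2/y3 + y2*y3/y1 - y1*y3/y2)/2 = lam"
      "y3 - (y2*y3/y1 + y1*y3/y2 - y1*y2/y3)/2 = lam"
      using e1 e2 e3 by (simp_all add: blk_eqs_def w mult.commute)
    note u = this
    define g1 g2 g3 where "g1 = y2*y3/y1" and "g2 = y1*y3/y2" and "g3 = y1*y2/y3"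
    have "2*lam = y2 + y3 - g1" "2*lam = y1 + y3 - g2" "2*lam = y1 + y2 - g3"
      using u[folded g1_def g2_def g3_def] by - argo+
    then show "2*lam = y2 + y3 - y2*y3/y1" "2*lam = y1 + y3 - y1*y3/y2" "2*lam = y1 + y2 - y1*y2/y3"
      by (simp_all add: g1_def g2_def g3_def)
  qed
  moreover have "2*lam = s2 + s3 - s2 * s3/s1" "2*lam = s1 + s3 - s1 * s3/s2" "2*lam = s1 + s2 - s1 * s2/s3"
  proof -
    have "s1 - (s1 * s3/s2 + s1 * s2/s3 - s2 * s3/s1)/2 = lam" "s2 - (s1 * s2/s3 + s2 * s3/s1 - s1 * s3/s2)/2 = lam"
      "s3 - (s2 * s3/s1 + s1 * s3/s2 - s1 * s2/s3)/2 = lam"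
      using e1 e2 e3 by (simp_all add: blk_eqs_def w mult.commute)
    note u = this
    define g1 g2 g3 where "g1 = s2 * s3/s1" and "g2 = s1 * s3/s2" and "g3 = s1 * s2/s3"
    have "2*lam = s2 + s3 - g1" "2*lam = s1 + s3 - g2" "2*lam = s1 + s2 - g3"
      using u[folded g1_def g2_def g3_def] by - argo+
    then show "2*lam = s2 + s3 - s2 * s3/s1" "2*lam = s1 + s3 - s1 * s3/s2" "2*lam = s1 + s2 - s1 * s2/s3"
      by (simp_all add: g1_def g2_def g3_def)
  qed
  ultimately show ?thesis
    using su2_einstein[of y1 y2 y3 "2*lam"] su2_einstein[of s1 s2 s3 "2*lam"] pos w by simp
next
  case False
  then have w: "0 < w1*w2*w3" by simp
  then have w0: "w1 \<noteq> 0" "w2 \<noteq> 0" "w3 \<noteq> 0" by auto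
  have tt: "(w1*w3/w2)*(w1*w2/w3) = w1^2" "(w2*w3/w1)*(w1*w2/w3) = w2^2" "(w2*w3/w1)*(w1*w3/w2) = w3^2"
    using w0 by (simp_all add: power2_eq_square)
  define t1 t2 t3 where "t1 = w2*w3/w1" and "t2 = w1*w3/w2" and "t3 = w1*w2/w3"
  have "s1 = s2 \<and> s2 = s3 \<and> y1 = y2 \<and> y2 = y3 \<and>
    (t1 = 1 \<and> t2 = 1 \<and> t3 = 1 \<and> y1 = s1 \<or> t1 = 1/2 \<and> t2 = 1/2 \<and> t3 = 1/2 \<and> (3*y1 = 4 * s1 \<or> y1 = 4 * s1))"
    unfolding t1_def t2_def t3_def by (rule tsys_solutions[OF blk_eqs_tsys[OF assms w]])
  moreover have q: "w1^2 = t2*t3" "w2^2 = t1*t3" "w3^2 = t1*t2"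
    using tt by (simp_all only: t1_def t2_def t3_def)
  have "w1^2 = 1 \<and> w2^2 = 1 \<and> w3^2 = 1" if "t1 = 1" "t2 = 1" "t3 = 1" unfolding q that by simp
  moreover have "w1^2 = 1/4 \<and> w2^2 = 1/4 \<and> w3^2 = 1/4" if "t1 = 1/2" "t2 = 1/2" "t3 = 1/2" unfolding q that by simp
  ultimately show ?thesis using w by blast
qed

section \<open>Ricci curvature of scalar products on the Lie algebra\<close>

type_synonym vv = "(real^3) \<times> (real^3)"

definition lbr :: "vv \<Rightarrow> vv \<Rightarrow> vv" where
  "lbr x y = (cross3 (fst x) (fst y), cross3 (snd x) (snd y))"

text \<open>The Ricci tensor of the left-invariant metric \<open>B\<close>, for which the vectors \<open>sqrt (m i) *\<^sub>R v i\<close>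
  are orthonormal: the weights keep square roots out of the computations. There is no mean curvature
  term because the algebra is unimodular, and the Killing form is traced in the same basis.\<close>

definition ric :: "(vv \<Rightarrow> vv \<Rightarrow> real) \<Rightarrow> (nat \<Rightarrow> real) \<Rightarrow> (nat \<Rightarrow> vv) \<Rightarrow> vv \<Rightarrow> vv \<Rightarrow> real" where
  "ric B m v x y = (\<Sum>i<6. \<Sum>j<6. m i * m j * B (lbr (v i) (v j)) x * B (lbr (v i) (v j)) y) / 4
     - (\<Sum>i<6. m i * (B (lbr x (v i)) (lbr y (v i)) + B (lbr x (lbr y (v i))) (v i))) / 2"

text \<open>Orthogonal with squared lengths \<open>1/s\<^sub>i\<close> and \<open>1/y\<^sub>i\<close> is the basis \<open>blkv\<close> below, which consists of
  \<open>E\<^sub>i\<close> and \<open>F\<^sub>i + w\<^sub>i E\<^sub>i\<close>.\<close>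

definition blk :: "real \<Rightarrow> real \<Rightarrow> real \<Rightarrow> real \<Rightarrow> real \<Rightarrow> real \<Rightarrow> real \<Rightarrow> real \<Rightarrow> real \<Rightarrow> vv \<Rightarrow> vv \<Rightarrow> real" where
  "blk s1 s2 s3 w1 w2 w3 y1 y2 y3 x z =
    (fst x$1 - w1 * snd x$1)*(fst z$1 - w1 * snd z$1)/s1 + snd x$1 * snd z$1/y1
  + (fst x$2 - w2 * snd x$2)*(fst z$2 - w2 * snd z$2)/s2 + snd x$2 * snd z$2/y2
  + (fst x$3 - w3 * snd x$3)*(fst z$3 - w3 * snd z$3)/s3 + snd x$3 * snd z$3/y3"

definition blkv :: "real \<Rightarrow> real \<Rightarrow> real \<Rightarrow> nat \<Rightarrow> vv" where
  "blkv w1 w2 w3 i = [(vector [1,0,0], 0), (vector [0,1,0], 0), (vector [0,0,1], 0),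
    (vector [w1,0,0], vector [1,0,0]), (vector [0,w2,0], vector [0,1,0]), (vector [0,0,w3], vector [0,0,1])] ! i"

lemma less6: "{..<6::nat} = {0,1,2,3,4,5}" by auto

lemma blkv_simps:
  "blkv w1 w2 w3 0 = (vector [1,0,0], 0)" "blkv w1 w2 w3 1 = (vector [0,1,0], 0)" "blkv w1 w2 w3 2 = (vector [0,0,1], 0)"
  "blkv w1 w2 w3 3 = (vector [w1,0,0], vector [1,0,0])" "blkv w1 w2 w3 4 = (vector [0,w2,0], vector [0,1,0])"
  "blkv w1 w2 w3 5 = (vector [0,0,w3], vector [0,0,1])"
  "blkv w1 w2 w3 (Suc 0) = (vector [0,1,0], 0)"
  by (simp_all add: blkv_def)

lemma cross3_vector: "cross3 (vector [a,b,c]) (vector [d,e,f]) = vector [b*f-c*e, c*d-a*f, a*e-b*d]"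
  by (simp add: cross3_def)

definition blkm :: "real \<Rightarrow> real \<Rightarrow> real \<Rightarrow> real \<Rightarrow> real \<Rightarrow> real \<Rightarrow> nat \<Rightarrow> real" where
  "blkm s1 s2 s3 y1 y2 y3 i = [s1,s2,s3,y1,y2,y3] ! i"

lemma blkm_simps: "blkm s1 s2 s3 y1 y2 y3 0 = s1" "blkm s1 s2 s3 y1 y2 y3 1 = s2" "blkm s1 s2 s3 y1 y2 y3 2 = s3"
 "blkm s1 s2 s3 y1 y2 y3 3 = y1" "blkm s1 s2 s3 y1 y2 y3 4 = y2" "blkm s1 s2 s3 y1 y2 y3 5 = y3"
  "blkm s1 s2 s3 y1 y2 y3 (Suc 0) = s2"
  by (simp_all add: blkm_def)

lemma ric_blk:
  fixes s1 s2 s3 w1 w2 w3 y1 y2 y3 :: real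
  assumes pos: "0 < s1" "0 < s2" "0 < s3" "0 < y1" "0 < y2" "0 < y3"
  defines "v \<equiv> blkv w1 w2 w3"
  defines "R \<equiv> ric (blk s1 s2 s3 w1 w2 w3 y1 y2 y3) (blkm s1 s2 s3 y1 y2 y3) v"
  shows "s1 * R (v 0) (v 0)
   = s1 - (s1 * s3/s2+s1 * s2/s3 - s2 * s3/s1)/2 - y3*w3^2*(s1/s2-s2/s1)/2 - y2*w2^2*(s1/s3-s3/s1)/2 + y2*y3/s1*(w2*w3-w1)^2/2"
  "s2 * R (v 1) (v 1)
   = s2 - (s2 * s1/s3+s2 * s3/s1 - s3 * s1/s2)/2 - y1*w1^2*(s2/s3-s3/s2)/2 - y3*w3^2*(s2/s1-s1/s2)/2 + y3*y1/s2*(w3*w1-w2)^2/2"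
  "s3 * R (v 2) (v 2)
   = s3 - (s3 * s2/s1+s3 * s1/s2 - s1 * s2/s3)/2 - y2*w2^2*(s3/s1-s1/s3)/2 - y1*w1^2*(s3/s2-s2/s3)/2 + y1*y2/s3*(w1*w2-w3)^2/2"
  "y1 * R (v 3) (v 3)
   = y1 - (y1*y3/y2+y1*y2/y3 - y2*y3/y1)/2 - (y1*(s2-s3)^2/(s2 * s3)*w1^2 + y1*y3/s2*(w1*w3-w2)^2 + y1*y2/s3*(w1*w2-w3)^2)/2"
  "y2 * R (v 4) (v 4)
   = y2 - (y2*y1/y3+y2*y3/y1 - y3*y1/y2)/2 - (y2*(s3-s1)^2/(s3 * s1)*w2^2 + y2*y1/s3*(w2*w1-w3)^2 + y2*y3/s1*(w2*w3-w1)^2)/2"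
  "y3 * R (v 5) (v 5)
   = y3 - (y3*y2/y1+y3*y1/y2 - y1*y2/y3)/2 - (y3*(s1-s2)^2/(s1 * s2)*w3^2 + y3*y2/s1*(w3*w2-w1)^2 + y3*y1/s2*(w3*w1-w2)^2)/2"
  "- 2 * y1 * R (v 0) (v 3)
   = y1*(s2-s3)^2/(s2 * s3)*w1 + y2*y3/s1*(w1-w2*w3) + y1*y3/s2*w3*(w3*w1-w2) + y1*y2/s3*w2*(w1*w2-w3)"
  "- 2 * y2 * R (v 1) (v 4)
   = y2*(s3-s1)^2/(s3 * s1)*w2 + y3*y1/s2*(w2-w3*w1) + y2*y1/s3*w1*(w1*w2-w3) + y2*y3/s1*w3*(w2*w3-w1)"
  "- 2 * y3 * R (v 2) (v 5)
   = y3*(s1-s2)^2/(s1 * s2)*w3 + y1*y2/s3*(w3-w1*w2) + y3*y2/s1*w2*(w2*w3-w1) + y3*y1/s2*w1*(w3*w1-w2)"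
  unfolding R_def v_def using pos
  by - (simp add: ric_def less6 blkv_simps blkm_simps lbr_def cross3_vector blk_def,
      simp add: divide_simps, simp add: algebra_simps power2_eq_square)+

text \<open>Here the coupling of the factors has rank one: the basis \<open>rkonev\<close> below consists of \<open>E\<^sub>i\<close> and
  \<open>F\<^sub>i + w\<^sub>i E\<^sub>3\<close>. The mixed Ricci components are positive multiples of the \<open>w\<^sub>i\<close>, so that they
  force an Einstein metric to be a product.\<close>

definition rkone :: "real \<Rightarrow> real \<Rightarrow> real \<Rightarrow> real \<Rightarrow> real \<Rightarrow> real \<Rightarrow> real \<Rightarrow> real \<Rightarrow> real \<Rightarrow> vv \<Rightarrow> vv \<Rightarrow> real" where
  "rkone s1 s2 s3 w1 w2 w3 y1 y2 y3 x z =
    fst x$1 * fst z$1/s1 + fst x$2 * fst z$2/s2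
  + (fst x$3 - (w1 * snd x$1 + w2 * snd x$2 + w3 * snd x$3)) * (fst z$3 - (w1 * snd z$1 + w2 * snd z$2 + w3 * snd z$3))/s3
  + snd x$1 * snd z$1/y1 + snd x$2 * snd z$2/y2 + snd x$3 * snd z$3/y3"

definition rkonev :: "real \<Rightarrow> real \<Rightarrow> real \<Rightarrow> nat \<Rightarrow> vv" where
  "rkonev w1 w2 w3 i = [(vector [1,0,0], 0), (vector [0,1,0], 0), (vector [0,0,1], 0),
    (vector [0,0,w1], vector [1,0,0]), (vector [0,0,w2], vector [0,1,0]), (vector [0,0,w3], vector [0,0,1])] ! i"

lemma rkonev_simps:
  "rkonev w1 w2 w3 0 = (vector [1,0,0], 0)" "rkonev w1 w2 w3 1 = (vector [0,1,0], 0)" "rkonev w1 w2 w3 2 = (vector [0,0,1], 0)"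
  "rkonev w1 w2 w3 3 = (vector [0,0,w1], vector [1,0,0])" "rkonev w1 w2 w3 4 = (vector [0,0,w2], vector [0,1,0])"
  "rkonev w1 w2 w3 5 = (vector [0,0,w3], vector [0,0,1])" "rkonev w1 w2 w3 (Suc 0) = (vector [0,1,0], 0)"
  by (simp_all add: rkonev_def)

lemma ric_rkone:
  fixes s1 s2 s3 w1 w2 w3 y1 y2 y3 :: real
  assumes pos: "0 < s1" "0 < s2" "0 < s3" "0 < y1" "0 < y2" "0 < y3"
  defines "v \<equiv> rkonev w1 w2 w3"
  defines "R \<equiv> ric (rkone s1 s2 s3 w1 w2 w3 y1 y2 y3) (blkm s1 s2 s3 y1 y2 y3) v"
  shows "- 2 * y1 * R (v 2) (v 3) = (y1*(s1-s2)^2/(s1 * s2) + y2*y3/s3)*w1"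
   "- 2 * y2 * R (v 2) (v 4) = (y2*(s1-s2)^2/(s1 * s2) + y1*y3/s3)*w2"
   "- 2 * y3 * R (v 2) (v 5) = (y3*(s1-s2)^2/(s1 * s2) + y1*y2/s3)*w3"
  unfolding R_def v_def using pos
  by - (simp add: ric_def less6 rkonev_simps blkm_simps lbr_def cross3_vector rkone_def,
      simp add: divide_simps, simp add: algebra_simps power2_eq_square)+

definition adapted :: "(vv \<Rightarrow> vv \<Rightarrow> real) \<Rightarrow> (nat \<Rightarrow> real) \<Rightarrow> (nat \<Rightarrow> vv) \<Rightarrow> bool" where
  "adapted B m v \<longleftrightarrow> (\<forall>i<6. 0 < m i) \<and> (\<forall>i<6. \<forall>j<6. B (v i) (v j) = (if i = j then 1 / m i else 0))"

lemma all_less6: "(\<forall>i<6::nat. P i) \<longleftrightarrow> P 0 \<and> P 1 \<and> P 2 \<and> P 3 \<and> P 4 \<and> P 5"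
proof -
  have "(\<forall>i<6::nat. P i) \<longleftrightarrow> (\<forall>i\<in>{..<6}. P i)" by auto
  then show ?thesis unfolding less6 by simp
qed

lemma adapted_blk:
  assumes "0 < s1" "0 < s2" "0 < s3" "0 < y1" "0 < y2" "0 < y3"
  shows "adapted (blk s1 s2 s3 w1 w2 w3 y1 y2 y3) (blkm s1 s2 s3 y1 y2 y3) (blkv w1 w2 w3)"
  using assms unfolding adapted_def all_less6
  by (simp add: blkv_simps blkm_simps blk_def)

lemma adapted_rkone:
  assumes "0 < s1" "0 < s2" "0 < s3" "0 < y1" "0 < y2" "0 < y3"
  shows "adapted (rkone s1 s2 s3 w1 w2 w3 y1 y2 y3) (blkm s1 s2 s3 y1 y2 y3) (rkonev w1 w2 w3)"
  using assms unfolding adapted_def all_less6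
  by (simp add: rkonev_simps blkm_simps rkone_def)

definition sprod :: "(vv \<Rightarrow> vv \<Rightarrow> real) \<Rightarrow> bool" where
  "sprod B \<longleftrightarrow> bilinear B \<and> (\<forall>x y. B x y = B y x) \<and> (\<forall>x. x \<noteq> 0 \<longrightarrow> 0 < B x x)"

text \<open>Quantifying over all adapted bases makes \<open>einst_aut\<close> immediate, without a
  proof that \<open>ric\<close> is independent of the basis.\<close>

definition einst :: "(vv \<Rightarrow> vv \<Rightarrow> real) \<Rightarrow> bool" where
  "einst B \<longleftrightarrow> sprod B \<and> (\<exists>lam. \<forall>m v x y. adapted B m v \<longrightarrow> ric B m v x y = lam * B x y)"

lemma einst_blk:
  assumes pos: "0 < s1" "0 < s2" "0 < s3" "0 < y1" "0 < y2" "0 < y3"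
    and e: "einst (blk s1 s2 s3 w1 w2 w3 y1 y2 y3)"
  shows "s1 = s2 \<and> s2 = s3 \<and> y1 = y2 \<and> y2 = y3 \<and>
    (w1 = 0 \<and> w2 = 0 \<and> w3 = 0 \<and> y1 = s1 \<or>
     0 < w1*w2*w3 \<and> w1^2 = 1 \<and> w2^2 = 1 \<and> w3^2 = 1 \<and> y1 = s1 \<or>
     0 < w1*w2*w3 \<and> w1^2 = 1/4 \<and> w2^2 = 1/4 \<and> w3^2 = 1/4 \<and> (3*y1 = 4 * s1 \<or> y1 = 4 * s1))"
proof -
  let ?B = "blk s1 s2 s3 w1 w2 w3 y1 y2 y3" and ?m = "blkm s1 s2 s3 y1 y2 y3" and ?v = "blkv w1 w2 w3"
  obtain lam where lam: "\<And>x y. ric ?B ?m ?v x y = lam * ?B x y"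
    using e adapted_blk[OF pos] unfolding einst_def by blast
  have A: "?B (?v 0) (?v 0) = 1/s1" "?B (?v 1) (?v 1) = 1/s2" "?B (?v 2) (?v 2) = 1/s3"
    "?B (?v 3) (?v 3) = 1/y1" "?B (?v 4) (?v 4) = 1/y2" "?B (?v 5) (?v 5) = 1/y3"
    "?B (?v 0) (?v 3) = 0" "?B (?v 1) (?v 4) = 0" "?B (?v 2) (?v 5) = 0"
    by (simp_all add: blkv_simps blk_def)
  have "blk_eqs lam s1 s2 s3 w1 w2 w3 y1 y2 y3"
    using ric_blk(1,4,7)[OF pos, of w1 w2 w3] pos unfolding lam A blk_eqs_def by simp
  moreover have "blk_eqs lam s2 s3 s1 w2 w3 w1 y2 y3 y1"
    using ric_blk(2,5,8)[OF pos, of w1 w2 w3] pos unfolding lam A blk_eqs_def by simp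
  moreover have "blk_eqs lam s3 s1 s2 w3 w1 w2 y3 y1 y2"
    using ric_blk(3,6,9)[OF pos, of w1 w2 w3] pos unfolding lam A blk_eqs_def by simp
  ultimately show ?thesis by (rule blk_eqs_solutions[OF pos])
qed

lemma einst_rkone:
  assumes pos: "0 < s1" "0 < s2" "0 < s3" "0 < y1" "0 < y2" "0 < y3"
    and e: "einst (rkone s1 s2 s3 w1 w2 w3 y1 y2 y3)"
  shows "w1 = 0" "w2 = 0" "w3 = 0"
proof -
  let ?B = "rkone s1 s2 s3 w1 w2 w3 y1 y2 y3" and ?m = "blkm s1 s2 s3 y1 y2 y3" and ?v = "rkonev w1 w2 w3"
  obtain lam where lam: "\<And>x y. ric ?B ?m ?v x y = lam * ?B x y"
    using e adapted_rkone[OF pos] unfolding einst_def by blast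
  have A: "?B (?v 2) (?v 3) = 0" "?B (?v 2) (?v 4) = 0" "?B (?v 2) (?v 5) = 0"
    by (simp_all add: rkonev_simps rkone_def)
  have "0 < y1*(s1-s2)^2/(s1 * s2) + y2*y3/s3" "0 < y2*(s1-s2)^2/(s1 * s2) + y1*y3/s3" "0 < y3*(s1-s2)^2/(s1 * s2) + y1*y2/s3"
    using pos by (simp_all add: add_nonneg_pos)
  then show "w1 = 0" "w2 = 0" "w3 = 0"
    using ric_rkone[OF pos, of w1 w2 w3] unfolding lam A by auto
qed

lemma einst_rkone_round:
  assumes pos: "0 < s1" "0 < s2" "0 < s3" "0 < y1" "0 < y2" "0 < y3"
    and e: "einst (rkone s1 s2 s3 w1 w2 w3 y1 y2 y3)"
  shows "rkone s1 s2 s3 w1 w2 w3 y1 y2 y3 = blk s1 s1 s1 0 0 0 s1 s1 s1"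
proof -
  have w: "w1 = 0" "w2 = 0" "w3 = 0" using einst_rkone[OF assms] by auto
  have eq: "rkone s1 s2 s3 w1 w2 w3 y1 y2 y3 = blk s1 s2 s3 0 0 0 y1 y2 y3"
    by (simp add: w fun_eq_iff rkone_def blk_def)
  then have "s1 = s2 \<and> s2 = s3 \<and> y1 = y2 \<and> y2 = y3 \<and> y1 = s1"
    using einst_blk[OF pos, of 0 0 0] e by simp
  then have "s2 = s1" "s3 = s1" "y1 = s1" "y2 = s1" "y3 = s1" by auto
  then show ?thesis using eq by simp
qed

section \<open>Automorphisms and coordinate forms of scalar products\<close>

definition lie_aut :: "(vv \<Rightarrow> vv) \<Rightarrow> bool" where
  "lie_aut F \<longleftrightarrow> linear F \<and> inj F \<and> (\<forall>x y. lbr (F x) (F y) = F (lbr x y))"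

lemma bilinear_comp: "bilinear B \<Longrightarrow> linear F \<Longrightarrow> bilinear (\<lambda>x y. B (F x) (F y))"
  unfolding bilinear_def using linear_compose[of F] by (auto simp: o_def)

lemma sprod_aut:
  assumes "sprod B" and F: "linear F" "inj F"
  shows "sprod (\<lambda>x y. B (F x) (F y))"
proof -
  have "F x \<noteq> 0" if "x \<noteq> 0" for x
    using that F linear_injective_0 by blast
  then show ?thesis
    using assms(1) bilinear_comp[of B F] F(1) unfolding sprod_def by blast
qed

lemma einst_aut:
  assumes e: "einst B" and F: "lie_aut F"
  shows "einst (\<lambda>x y. B (F x) (F y))"
proof -
  have lin: "linear F" and br: "\<And>x y. F (lbr x y) = lbr (F x) (F y)" using F by (auto simp: lie_aut_def)
  obtain lam where lam: "\<And>m v x y. adapted B m v \<Longrightarrow> ric B m v x y = lam * B x y"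
    using e unfolding einst_def by blast
  have "ric (\<lambda>x y. B (F x) (F y)) m v x y = lam * B (F x) (F y)" if "adapted (\<lambda>x y. B (F x) (F y)) m v" for m v x y
  proof -
    have "adapted B m (\<lambda>i. F (v i))" using that by (simp add: adapted_def)
    from lam[OF this, of "F x" "F y"] show ?thesis by (simp add: ric_def br)
  qed
  then show ?thesis
    using sprod_aut[of B F] e F unfolding einst_def lie_aut_def by blast
qed

definition rotp :: "real^3^3 \<Rightarrow> real^3^3 \<Rightarrow> vv \<Rightarrow> vv" where
  "rotp A C x = (A *v fst x, C *v snd x)"

definition vswap :: "vv \<Rightarrow> vv" where
  "vswap x = (snd x, fst x)"

lemma rotation_matrix_inj: "rotation_matrix (A::real^3^3) \<Longrightarrow> A *v x = A *v y \<Longrightarrow> x = y"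
  unfolding rotation_matrix_def orthogonal_matrix_def
  by (metis matrix_vector_mul_assoc matrix_vector_mul_lid)

lemma lie_aut_rotp:
  assumes "rotation_matrix A" "rotation_matrix C"
  shows "lie_aut (rotp A C)"
  unfolding lie_aut_def
proof (intro conjI allI)
  show "linear (rotp A C)"
    by (rule linearI) (simp_all add: rotp_def matrix_vector_right_distrib matrix_vector_mult_scaleR)
  show "inj (rotp A C)"
    by (rule injI) (auto simp: rotp_def prod_eq_iff dest: rotation_matrix_inj[OF assms(1)] rotation_matrix_inj[OF assms(2)])
  show "lbr (rotp A C x) (rotp A C y) = rotp A C (lbr x y)" for x y
    using cross_rotation_matrix[OF assms(1)] cross_rotation_matrix[OF assms(2)] by (simp add: lbr_def rotp_def)
qed

lemma lie_aut_vswap: "lie_aut vswap"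
  unfolding lie_aut_def
  by (auto simp: vswap_def lbr_def inj_def prod_eq_iff intro!: linearI)

definition vE :: "3 \<Rightarrow> vv" where "vE i = (axis i 1, 0)"

definition vF :: "3 \<Rightarrow> vv" where "vF i = (0, axis i 1)"

lemma vv_expand: "x = (\<Sum>i\<in>UNIV. fst x$i *\<^sub>R vE i) + (\<Sum>i\<in>UNIV. snd x$i *\<^sub>R vF i)"
proof -
  have "(\<Sum>i\<in>UNIV. (u::real^3)$i *\<^sub>R axis i 1) = u" for u
    using basis_expansion[of u] by (simp add: scalar_mult_eq_scaleR)
  then show ?thesis by (simp add: vE_def vF_def prod_eq_iff fst_sum snd_sum)
qed

lemma bilinear_expand:
  assumes b: "bilinear B"
  shows "B x z = (\<Sum>i\<in>UNIV. \<Sum>j\<in>UNIV. fst x$i * fst z$j * B (vE i) (vE j)) + (\<Sum>i\<in>UNIV. \<Sum>j\<in>UNIV. fst x$i * snd z$j * B (vE i) (vF j))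
    + (\<Sum>i\<in>UNIV. \<Sum>j\<in>UNIV. snd x$i * fst z$j * B (vF i) (vE j)) + (\<Sum>i\<in>UNIV. \<Sum>j\<in>UNIV. snd x$i * snd z$j * (B (vF i) (vF j)::real))"
  by (subst vv_expand[of x], subst vv_expand[of z])
    (simp add: bilinear_ladd[OF b] bilinear_radd[OF b] bilinear_lmul[OF b] bilinear_rmul[OF b] sum.distrib sum_distrib_left
      bilinear_sum[OF b] linear_sum[OF bilinear_def[THEN iffD1, OF b, THEN conjunct1, rule_format]]
      linear_sum[OF bilinear_def[THEN iffD1, OF b, THEN conjunct2, rule_format]] sum_3 algebra_simps)

lemma sprodD:
  assumes "sprod B"
  shows "bilinear B" "B x y = B y x" "x \<noteq> 0 \<Longrightarrow> 0 < B x x"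
  using assms unfolding sprod_def by blast+

lemma sprod_blk:
  assumes B: "sprod B"
    and EE: "\<And>i j. i \<noteq> j \<Longrightarrow> B (vE i) (vE j) = 0" and FF: "\<And>i j. i \<noteq> j \<Longrightarrow> B (vF i) (vF j) = 0"
    and EF: "\<And>i j. i \<noteq> j \<Longrightarrow> B (vE i) (vF j) = 0"
  shows "\<exists>s1 s2 s3 w1 w2 w3 y1 y2 y3. 0 < s1 \<and> 0 < s2 \<and> 0 < s3 \<and> 0 < y1 \<and> 0 < y2 \<and> 0 < y3 \<and> B = blk s1 s2 s3 w1 w2 w3 y1 y2 y3"
proof -
  note b = sprodD(1)[OF B]
  define p c r where "p i = B (vE i) (vE i)" and "c i = B (vE i) (vF i)" and "r i = B (vF i) (vF i)" for i
  have p0: "0 < p i" for i unfolding p_def by (rule sprodD(3)[OF B]) (simp add: vE_def axis_eq_0_iff prod_eq_iff)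
  \<comment> \<open>Gram-Schmidt: \<open>vF i + w i *\<^sub>R vE i\<close> is orthogonal to
    \<open>vE i\<close>, and \<open>q i\<close> is its squared length.\<close>
  define w where "w i = - c i / p i" for i
  define q where "q i = r i - (c i)^2 / p i" for i
  have q0: "0 < q i" for i
  proof -
    have "vF i + w i *\<^sub>R vE i \<noteq> 0" by (simp add: vE_def vF_def axis_eq_0_iff prod_eq_iff)
    then have "0 < B (vF i + w i *\<^sub>R vE i) (vF i + w i *\<^sub>R vE i)" by (rule sprodD(3)[OF B])
    also have "\<dots> = r i + w i * c i + (w i * c i + w i * (w i * p i))"
      using sprodD(2)[OF B, of "vF i" "vE i"]
      by (simp add: bilinear_ladd[OF b] bilinear_radd[OF b] bilinear_lmul[OF b] bilinear_rmul[OF b] p_def c_def r_def algebra_simps)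
    also have "\<dots> = q i" using p0[of i] by (simp add: q_def w_def field_simps power2_eq_square)
    finally show ?thesis .
  qed
  have FE: "B (vF i) (vE j) = B (vE j) (vF i)" for i j by (rule sprodD(2)[OF B])
  have d: "(1::3) \<noteq> 2" "(1::3) \<noteq> 3" "(2::3) \<noteq> 3" "(2::3) \<noteq> 1" "(3::3) \<noteq> 1" "(3::3) \<noteq> 2" by simp_all
  have rq: "r i = q i + c i * c i / p i" for i by (simp add: q_def power2_eq_square)
  have "B x z = blk (1/p 1) (1/p 2) (1/p 3) (w 1) (w 2) (w 3) (1/q 1) (1/q 2) (1/q 3) x z" for x z
  proof -
    have "B x z = (\<Sum>i\<in>UNIV. fst x$i * fst z$i * p i + (fst x$i * snd z$i + snd x$i * fst z$i) * c i + snd x$i * snd z$i * r i)"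
      unfolding bilinear_expand[OF b, of x z] FE
      by (simp add: sum_3 EE[OF d(1)] EE[OF d(2)] EE[OF d(3)] EE[OF d(4)] EE[OF d(5)] EE[OF d(6)]
         FF[OF d(1)] FF[OF d(2)] FF[OF d(3)] FF[OF d(4)] FF[OF d(5)] FF[OF d(6)]
         EF[OF d(1)] EF[OF d(2)] EF[OF d(3)] EF[OF d(4)] EF[OF d(5)] EF[OF d(6)] p_def[symmetric] c_def[symmetric] r_def[symmetric] algebra_simps)
    moreover have "fst x$i * fst z$i * p i + (fst x$i * snd z$i + snd x$i * fst z$i) * c i + snd x$i * snd z$i * r i
       = (fst x$i - w i * snd x$i) * (fst z$i - w i * snd z$i) / (1/p i) + snd x$i * snd z$i / (1/q i)" for i
      unfolding rq w_def using p0[of i] by (simp add: field_simps)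
    ultimately show ?thesis by (simp add: sum_3 blk_def)
  qed
  then have "B = blk (1/p 1) (1/p 2) (1/p 3) (w 1) (w 2) (w 3) (1/q 1) (1/q 2) (1/q 3)" by blast
  moreover have "0 < 1/p i" "0 < 1/q i" for i using p0 q0 by simp_all
  ultimately show ?thesis by blast
qed

text \<open>The hypothesis \<open>FF\<close> says that the vectors \<open>vF i\<close> become
  pairwise orthogonal once their components along \<open>vE 3\<close> are removed, that is, that the
  Schur complement is diagonal.\<close>

lemma sprod_rkone:
  assumes B: "sprod B"
    and EE: "\<And>i j. i \<noteq> j \<Longrightarrow> B (vE i) (vE j) = 0"
    and EF: "\<And>i j. i \<noteq> 3 \<Longrightarrow> B (vE i) (vF j) = 0"
    and FF: "\<And>i j. i \<noteq> j \<Longrightarrow> B (vF i) (vF j) = B (vE 3) (vF i) * B (vE 3) (vF j) / B (vE 3) (vE 3)"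
  shows "\<exists>s1 s2 s3 w1 w2 w3 y1 y2 y3. 0 < s1 \<and> 0 < s2 \<and> 0 < s3 \<and> 0 < y1 \<and> 0 < y2 \<and> 0 < y3 \<and> B = rkone s1 s2 s3 w1 w2 w3 y1 y2 y3"
proof -
  note b = sprodD(1)[OF B]
  define p c r where "p i = B (vE i) (vE i)" and "c i = B (vE 3) (vF i)" and "r i = B (vF i) (vF i)" for i
  have p0: "0 < p i" for i unfolding p_def by (rule sprodD(3)[OF B]) (simp add: vE_def axis_eq_0_iff prod_eq_iff)
  define w where "w i = - c i / p 3" for i
  define q where "q i = r i - (c i)^2 / p 3" for i
  have q0: "0 < q i" for i
  proof -
    have "vF i + w i *\<^sub>R vE 3 \<noteq> 0" by (simp add: vE_def vF_def axis_eq_0_iff prod_eq_iff)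
    then have "0 < B (vF i + w i *\<^sub>R vE 3) (vF i + w i *\<^sub>R vE 3)" by (rule sprodD(3)[OF B])
    also have "\<dots> = r i + w i * c i + (w i * c i + w i * (w i * p 3))"
      using sprodD(2)[OF B, of "vF i" "vE 3"]
      by (simp add: bilinear_ladd[OF b] bilinear_radd[OF b] bilinear_lmul[OF b] bilinear_rmul[OF b] p_def c_def r_def algebra_simps)
    also have "\<dots> = q i" using p0[of 3] by (simp add: q_def w_def field_simps power2_eq_square)
    finally show ?thesis .
  qed
  have FE: "B (vF i) (vE j) = B (vE j) (vF i)" for i j by (rule sprodD(2)[OF B])
  have FF': "B (vF i) (vF j) = (if i = j then q i else 0) + c i * c j / p 3" for i j
    using FF[of i j] by (simp add: q_def r_def c_def p_def power2_eq_square)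
  have EF': "B (vE i) (vF j) = (if i = 3 then c j else 0)" for i j
    using EF[of i j] by (simp add: c_def)
  have EE': "B (vE i) (vE j) = (if i = j then p i else 0)" for i j
    using EE[of i j] by (simp add: p_def)
  have "B x z = rkone (1/p 1) (1/p 2) (1/p 3) (w 1) (w 2) (w 3) (1/q 1) (1/q 2) (1/q 3) x z" for x z
    unfolding bilinear_expand[OF b, of x z] FE FF' EF' EE' rkone_def w_def
    using p0[of 3] by (simp add: sum_3) (simp add: field_simps)
  then have "B = rkone (1/p 1) (1/p 2) (1/p 3) (w 1) (w 2) (w 3) (1/q 1) (1/q 2) (1/q 3)" by blast
  moreover have "0 < 1/p i" "0 < 1/q i" for i using p0 q0 by simp_all
  ultimately show ?thesis by blast
qed

section \<open>Oriented linear algebra in three-space\<close>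

lemma plane_diagonalize:
  fixes N :: "real^3 \<Rightarrow> real^3 \<Rightarrow> real"
  assumes b: "bilinear N" and s: "\<And>x y. N x y = N y x" and pq: "norm p = 1" "norm q = 1" "p \<bullet> q = 0"
  shows "\<exists>c d. c^2 + d^2 = 1 \<and> N (c *\<^sub>R p + d *\<^sub>R q) (c *\<^sub>R q - d *\<^sub>R p) = 0"
proof (cases "N p q = 0")
  case True
  then show ?thesis by (intro exI[of _ 1] exI[of _ 0]) simp
next
  case False
  \<comment> \<open>A Jacobi rotation: the tangent \<open>t\<close> of the rotation angle must
    satisfy \<open>t^2 = 2*t*r + 1\<close>.\<close>
  define r where "r = (N q q - N p p) / (2 * N p q)"
  define t where "t = r + sqrt (r^2 + 1)"
  have t: "t^2 = 2*t*r + 1"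
  proof -
    have "sqrt (r^2+1)^2 = r^2 + 1" by (simp add: add_nonneg_nonneg)
    then show ?thesis by (simp add: t_def power2_eq_square algebra_simps)
  qed
  define c where "c = 1 / sqrt (1 + t^2)"
  have pos: "0 < 1 + t^2" by (simp add: add_pos_nonneg)
  have c2: "c^2 = 1/(1+t^2)" using pos by (simp add: c_def power_divide)
  have "c^2 + (t*c)^2 = c^2*(1+t^2)" by (simp add: algebra_simps power2_eq_square)
  also have "\<dots> = 1" using pos by (simp add: c2)
  finally have 1: "c^2 + (t*c)^2 = 1" .
  have "N (c *\<^sub>R p + (t*c) *\<^sub>R q) (c *\<^sub>R q - (t*c) *\<^sub>R p) = c^2 * (N p q * (1 - t^2) + t * (N q q - N p p))"
    using s[of q p] by (simp add: bilinear_ladd[OF b] bilinear_radd[OF b] bilinear_rsub[OF b] bilinear_lmul[OF b] bilinear_rmul[OF b]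
        algebra_simps power2_eq_square)
  also have "N q q - N p p = 2*r*N p q" using False by (simp add: r_def)
  also have "N p q * (1 - t^2) + t * (2*r*N p q) = N p q * (1 - t^2 + 2*t*r)" by (simp add: algebra_simps)
  also have "\<dots> = 0" by (simp add: t)
  finally show ?thesis using 1 by auto
qed

lemma rotated_pair:
  fixes p q :: "real^3"
  assumes "norm p = 1" "norm q = 1" "p \<bullet> q = 0" "c^2 + d^2 = 1"
  shows "norm (c *\<^sub>R p + d *\<^sub>R q) = 1" "norm (c *\<^sub>R q - d *\<^sub>R p) = 1" "(c *\<^sub>R p + d *\<^sub>R q) \<bullet> (c *\<^sub>R q - d *\<^sub>R p) = 0"
    "cross3 (c *\<^sub>R p + d *\<^sub>R q) (c *\<^sub>R q - d *\<^sub>R p) = cross3 p q"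
proof -
  have i: "p \<bullet> p = 1" "q \<bullet> q = 1" "q \<bullet> p = 0" using assms by (simp_all add: norm_eq_1 inner_commute)
  have 1: "c*c + d*d = 1" using assms by (simp add: power2_eq_square)
  show "norm (c *\<^sub>R p + d *\<^sub>R q) = 1" "norm (c *\<^sub>R q - d *\<^sub>R p) = 1" "(c *\<^sub>R p + d *\<^sub>R q) \<bullet> (c *\<^sub>R q - d *\<^sub>R p) = 0"
    unfolding norm_eq_1 using 1 assms(3) i by (simp_all add: inner_add_left inner_add_right inner_diff_left inner_diff_right)
  have "cross3 (c *\<^sub>R p + d *\<^sub>R q) (c *\<^sub>R q - d *\<^sub>R p) = (c*c + d*d) *\<^sub>R cross3 p q"
    using cross_skew[of q p]
    by (simp add: cross_add_left cross_add_right Cross3.left_diff_distrib Cross3.right_diff_distrib cross_mult_left cross_mult_right scaleR_add_left)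
  then show "cross3 (c *\<^sub>R p + d *\<^sub>R q) (c *\<^sub>R q - d *\<^sub>R p) = cross3 p q" using 1 by simp
qed

lemma exists_extremal_direction:
  fixes N :: "real^3 \<Rightarrow> real^3 \<Rightarrow> real"
  assumes b: "bilinear N" and s: "\<And>x y. N x y = N y x"
  shows "\<exists>x. norm x = 1 \<and> (\<forall>y. x \<bullet> y = 0 \<longrightarrow> N x y = 0)"
proof -
  have "continuous_on (sphere 0 1) (\<lambda>x. N x x)"
    using bilinear_continuous_on_compose[OF continuous_on_id continuous_on_id b] by simp
  moreover have "compact (sphere (0::real^3) 1)" "sphere (0::real^3) 1 \<noteq> {}" by auto
  ultimately obtain x where x: "x \<in> sphere 0 1" and max: "\<And>y. y \<in> sphere 0 1 \<Longrightarrow> N y y \<le> N x x"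
    using continuous_attains_sup[of "sphere (0::real^3) 1" "\<lambda>x. N x x"] by blast
  have xx: "x \<bullet> x = 1" using x by (simp add: norm_eq_1)
  have le: "N v v \<le> N x x * (v \<bullet> v)" for v
  proof (cases "v = 0")
    case True then show ?thesis by (simp add: bilinear_lzero[OF b])
  next
    case False
    have "N ((1/norm v) *\<^sub>R v) ((1/norm v) *\<^sub>R v) \<le> N x x" using False by (intro max) simp
    then have "N v v / (norm v)^2 \<le> N x x"
      by (simp add: bilinear_lmul[OF b] bilinear_rmul[OF b] power2_eq_square)
    then show ?thesis using False by (simp add: field_simps power2_norm_eq_inner)
  qed
  have "N x y = 0" if "x \<bullet> y = 0" for y
  proof -
    \<comment> \<open>A first variation made quantitative: \<open>K\<close> exceeds the second-order
      coefficient, so moving from \<open>x\<close> by \<open>(e/K) *\<^sub>R y\<close> would violate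
      maximality unless \<open>e = 0\<close>.\<close>
    define K where "K = \<bar>N x x * (y \<bullet> y) - N y y\<bar> + 1"
    define e where "e = N x y"
    have K: "0 < K" by (simp add: K_def add_nonneg_pos)
    define t where "t = e/K"
    have "N (x + t *\<^sub>R y) (x + t *\<^sub>R y) \<le> N x x * ((x + t *\<^sub>R y) \<bullet> (x + t *\<^sub>R y))" by (rule le)
    then have "2*t*e \<le> t^2 * (N x x * (y \<bullet> y) - N y y)"
      using s[of y x] that xx by (simp add: e_def bilinear_ladd[OF b] bilinear_radd[OF b] bilinear_lmul[OF b] bilinear_rmul[OF b]
          inner_add_left inner_add_right inner_commute[of y x] algebra_simps power2_eq_square)
    then have "2*(e/K)*e \<le> (e/K)^2 * (N x x * (y \<bullet> y) - N y y)" by (simp only: t_def)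
    also have "\<dots> \<le> (e/K)^2 * K" by (intro mult_left_mono) (auto simp: K_def)
    also have "\<dots> = (e/K)*e" using K by (simp add: power2_eq_square)
    finally have "e*e/K \<le> 0" by simp
    then have "e*e \<le> 0" using K by (simp add: divide_le_0_iff)
    then show ?thesis by (auto simp: e_def mult_le_0_iff)
  qed
  then show ?thesis using xx by (auto simp: norm_eq_1)
qed

definition frame3 :: "real^3 \<Rightarrow> real^3 \<Rightarrow> real^3 \<Rightarrow> real^3^3" where
  "frame3 a b c = transpose (vector [a,b,c])"

lemma frame3_axis: "frame3 a b c *v axis 1 1 = a" "frame3 a b c *v axis 2 1 = b" "frame3 a b c *v axis 3 1 = c"
  by (simp_all add: frame3_def vec_eq_iff matrix_vector_mult_def transpose_def axis_def sum_3 forall_3)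

lemma frame3_rotation:
  assumes "norm a = 1" "norm b = 1" "a \<bullet> b = 0"
  shows "rotation_matrix (frame3 a b (cross3 a b))"
proof -
  have n: "a \<bullet> a = 1" "b \<bullet> b = 1" "b \<bullet> a = 0" using assms by (simp_all add: norm_eq_1 inner_commute)
  have c: "cross3 a b \<bullet> cross3 a b = 1"
    using norm_cross_dot[of a b] assms by (simp add: power2_norm_eq_inner)
  have d: "a \<bullet> cross3 a b = 0" "b \<bullet> cross3 a b = 0" "cross3 a b \<bullet> a = 0" "cross3 a b \<bullet> b = 0"
    by (simp_all add: dot_cross_self inner_commute)
  have o: "orthogonal_matrix (frame3 a b (cross3 a b))"
    unfolding orthogonal_matrix frame3_def transpose_transpose
    using n c d assms(3)
    by (simp add: vec_eq_iff forall_3 matrix_matrix_mult_def transpose_def mat_def inner_vec_def sum_3)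
  have "det (frame3 a b (cross3 a b)) = (cross3 a b) \<bullet> (cross3 a b)"
    unfolding frame3_def det_transpose by (simp add: det_3 cross3_def inner_vec_def sum_3 algebra_simps)
  then show ?thesis using o c by (simp add: rotation_matrix_def)
qed

section \<open>Normal forms of symmetric Einstein metrics\<close>

text \<open>The spectral theorem with an oriented eigenbasis; orientation matters because the basis
  change has to preserve the cross product.\<close>

lemma diagonalize3:
  fixes N :: "real^3 \<Rightarrow> real^3 \<Rightarrow> real"
  assumes b: "bilinear N" and s: "\<And>x y. N x y = N y x"
  shows "\<exists>C. rotation_matrix C \<and> (\<forall>i j. i \<noteq> j \<longrightarrow> N (C *v axis i 1) (C *v axis j 1) = 0)"
proof -
  obtain x where x: "norm x = 1" and o: "\<And>y. x \<bullet> y = 0 \<Longrightarrow> N x y = 0"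
    using exists_extremal_direction[OF assms] by blast
  obtain A :: "real^3^3" where A: "rotation_matrix A" "A *v axis 3 1 = x"
    using rotation_matrix_exists_basis[of x 3] x by auto
  define p q where "p = A *v axis 1 1" and "q = A *v axis 2 1"
  have orth: "orthogonal_transformation ((*v) A)"
    using A by (simp add: rotation_matrix_def orthogonal_transformation_matrix)
  have pq: "norm p = 1" "norm q = 1" "p \<bullet> q = 0"
    using orth by (simp_all add: p_def q_def orthogonal_transformation_def norm_eq_1 inner_axis_axis)
  have c: "cross3 p q = x"
    using cross_rotation_matrix[OF A(1), of "axis 1 1" "axis 2 1"] A(2)
    by (simp add: p_def q_def cross_basis)
  obtain c d where cd: "c^2 + d^2 = 1" "N (c *\<^sub>R p + d *\<^sub>R q) (c *\<^sub>R q - d *\<^sub>R p) = 0"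
    using plane_diagonalize[OF b s pq] by blast
  define a1 a2 where "a1 = c *\<^sub>R p + d *\<^sub>R q" and "a2 = c *\<^sub>R q - d *\<^sub>R p"
  note r = rotated_pair[OF pq cd(1), folded a1_def a2_def]
  have x3: "x = cross3 a1 a2" using r(4) c by simp
  have z: "N x a1 = 0" "N x a2 = 0" "N a1 x = 0" "N a2 x = 0" "N a1 a2 = 0" "N a2 a1 = 0"
    using o[of a1] o[of a2] s cd(2) by (simp_all add: x3 dot_cross_self inner_commute a1_def[symmetric] a2_def[symmetric])
  show ?thesis
    by (rule exI[of _ "frame3 a1 a2 (cross3 a1 a2)"], intro conjI frame3_rotation r)
      (use z in \<open>simp add: forall_3 frame3_axis x3\<close>)
qed

text \<open>Up to scale, \<open>q1\<close> is \<open>g_can\<close>, \<open>q3\<close> is \<open>g_NK\<close>, and \<open>q2\<close> is the pullback of \<open>g_can\<close> under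
  \<open>(p, q) \<mapsto> (p q\<^sup>-\<^sup>1, q)\<close>.\<close>

definition q1 :: "vv \<Rightarrow> vv \<Rightarrow> real" where "q1 x y = fst x \<bullet> fst y + snd x \<bullet> snd y"

definition q2 :: "vv \<Rightarrow> vv \<Rightarrow> real" where "q2 x y = (fst x - snd x) \<bullet> (fst y - snd y) + snd x \<bullet> snd y"

definition q3 :: "vv \<Rightarrow> vv \<Rightarrow> real" where
  "q3 x y = fst x \<bullet> fst y - (fst x \<bullet> snd y + snd x \<bullet> fst y) / 2 + snd x \<bullet> snd y"

text \<open>The known automorphism group of the Lie algebra: rotations of the two factors and their
  exchange.\<close>

definition auts :: "(vv \<Rightarrow> vv) set" where
  "auts = {F. \<exists>A C. rotation_matrix A \<and> rotation_matrix C \<and> (F = rotp A C \<or> F = (\<lambda>x. rotp A C (vswap x)))}"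

definition canon :: "(vv \<Rightarrow> vv \<Rightarrow> real) \<Rightarrow> bool" where
  "canon B \<longleftrightarrow> (\<exists>F\<in>auts. \<exists>k>0. \<exists>q\<in>{q1,q2,q3}. \<forall>x y. B (F x) (F y) = k * q x y)"

lemma rotation_matrix_mult: "rotation_matrix (A::real^3^3) \<Longrightarrow> rotation_matrix C \<Longrightarrow> rotation_matrix (A ** C)"
  by (simp add: rotation_matrix_def orthogonal_matrix_mul det_mul)

lemma rotp_rotp: "rotp A C (rotp A' C' x) = rotp (A ** A') (C ** C') x"
  by (simp add: rotp_def matrix_vector_mul_assoc)

lemma rotp_vswap: "vswap (rotp A C x) = rotp C A (vswap x)"
  by (simp add: rotp_def vswap_def)

lemma vswap_vswap: "vswap (vswap x) = x" by (simp add: vswap_def)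

lemma canon_transfer:
  assumes c: "canon (\<lambda>x y. B (G x) (G y))" and G: "\<And>F. F \<in> auts \<Longrightarrow> (\<lambda>x. G (F x)) \<in> auts"
  shows "canon B"
proof -
  obtain F k q where F: "F \<in> auts" and k: "k > 0" and q: "q \<in> {q1,q2,q3}" and B: "\<And>x y. B (G (F x)) (G (F y)) = k * q x y"
    using c unfolding canon_def by blast
  show ?thesis unfolding canon_def
    by (rule bexI[OF _ G[OF F]], rule exI[of _ k], intro conjI k, rule bexI[OF _ q]) (use B in blast)
qed

lemma canon_rotp:
  assumes "canon (\<lambda>x y. B (rotp A C x) (rotp A C y))" "rotation_matrix A" "rotation_matrix C"
  shows "canon B"
proof (rule canon_transfer[where G="rotp A C", OF assms(1)])
  fix F assume "F \<in> auts"
  then obtain A' C' where "rotation_matrix A'" "rotation_matrix C'" "F = rotp A' C' \<or> F = (\<lambda>x. rotp A' C' (vswap x))"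
    unfolding auts_def by blast
  then show "(\<lambda>x. rotp A C (F x)) \<in> auts"
    unfolding auts_def mem_Collect_eq using rotation_matrix_mult assms(2,3)
    by (intro exI[of _ "A ** A'"] exI[of _ "C ** C'"]) (auto simp: rotp_rotp fun_eq_iff simp del: split_paired_All)
qed

lemma canon_vswap:
  assumes "canon (\<lambda>x y. B (vswap x) (vswap y))"
  shows "canon B"
proof (rule canon_transfer[where G=vswap, OF assms(1)])
  fix F assume "F \<in> auts"
  then obtain A C where "rotation_matrix A" "rotation_matrix C" "F = rotp A C \<or> F = (\<lambda>x. rotp A C (vswap x))"
    unfolding auts_def by blast
  then show "(\<lambda>x. vswap (F x)) \<in> auts"
    unfolding auts_def mem_Collect_eq
    by (intro exI[of _ C] exI[of _ A]) (auto simp: rotp_vswap vswap_vswap fun_eq_iff simp del: split_paired_All)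
qed

lemma rotation_matrix_1: "rotation_matrix (mat 1 :: real^3^3)"
  by (simp add: rotation_matrix_def orthogonal_matrix_id)

text \<open>The diagonal matrix of the signs has determinant \<open>w1*w2*w3 = 1\<close>. Rotating
  the second factor by it makes all three couplings equal and positive.\<close>

lemma sign_rotation:
  fixes w1 w2 w3 :: real
  assumes w: "w1^2 = 1" "w2^2 = 1" "w3^2 = 1" "0 < w1*w2*w3"
  shows "\<exists>D::real^3^3. rotation_matrix D \<and> (\<forall>v. (D *v v)$1 = w1 * v$1 \<and> (D *v v)$2 = w2 * v$2 \<and> (D *v v)$3 = w3 * v$3)"
proof -
  have p: "w1*w2*w3 = 1"
  proof -
    have "(w1*w2*w3)^2 = 1" using w by (simp add: power_mult_distrib)
    then show ?thesis using w(4) by (simp add: power2_eq_1_iff)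
  qed
  have n: "norm (w1 *\<^sub>R axis 1 1 :: real^3) = 1" "norm (w2 *\<^sub>R axis 2 1 :: real^3) = 1"
    using w by (auto simp: power2_eq_1_iff)
  have c: "cross3 (w1 *\<^sub>R axis 1 1) (w2 *\<^sub>R axis 2 1) = w3 *\<^sub>R (axis 3 1 :: real^3)"
  proof -
    have "w1*w2 = w3" using p w(3) by (metis mult.assoc mult.right_neutral power2_eq_square mult.commute)
    then have "w2*w1 = w3" by (simp add: mult.commute)
    then show ?thesis by (simp add: cross_mult_left cross_mult_right cross_basis)
  qed
  have "rotation_matrix (frame3 (w1 *\<^sub>R axis 1 1) (w2 *\<^sub>R axis 2 1) (w3 *\<^sub>R axis 3 1))"
    using frame3_rotation[OF n] unfolding c by (simp add: inner_axis_axis)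
  moreover have "(frame3 (w1 *\<^sub>R axis 1 1) (w2 *\<^sub>R axis 2 1) (w3 *\<^sub>R axis 3 1) *v v)$1 = w1 * v$1"
    "(frame3 (w1 *\<^sub>R axis 1 1) (w2 *\<^sub>R axis 2 1) (w3 *\<^sub>R axis 3 1) *v v)$2 = w2 * v$2"
    "(frame3 (w1 *\<^sub>R axis 1 1) (w2 *\<^sub>R axis 2 1) (w3 *\<^sub>R axis 3 1) *v v)$3 = w3 * v$3" for v
    by (simp_all add: frame3_def matrix_vector_mult_def transpose_def axis_def sum_3)
  ultimately show ?thesis by blast
qed

lemma canonI: "F \<in> auts \<Longrightarrow> 0 < k \<Longrightarrow> q \<in> {q1,q2,q3} \<Longrightarrow> (\<And>x y. B (F x) (F y) = k * q x y) \<Longrightarrow> canon B"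
  unfolding canon_def by blast

lemma einst_blk_canon:
  assumes pos: "0 < s1" "0 < s2" "0 < s3" "0 < y1" "0 < y2" "0 < y3"
    and e: "einst (blk s1 s2 s3 w1 w2 w3 y1 y2 y3)"
  shows "canon (blk s1 s2 s3 w1 w2 w3 y1 y2 y3)"
proof -
  have eq: "s2 = s1" "s3 = s1" "y2 = y1" "y3 = y1" and
    cs: "w1 = 0 \<and> w2 = 0 \<and> w3 = 0 \<and> y1 = s1 \<or>
     0 < w1*w2*w3 \<and> w1^2 = 1 \<and> w2^2 = 1 \<and> w3^2 = 1 \<and> y1 = s1 \<or>
     0 < w1*w2*w3 \<and> w1^2 = 1/4 \<and> w2^2 = 1/4 \<and> w3^2 = 1/4 \<and> (3*y1 = 4 * s1 \<or> y1 = 4 * s1)"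
    using einst_blk[OF assms] by auto
  have idm: "rotp (mat 1) (mat 1) \<in> auts" using rotation_matrix_1 by (auto simp: auts_def)
  show ?thesis unfolding eq using cs
  proof (elim disjE conjE)
    assume h: "w1 = 0" "w2 = 0" "w3 = 0" "y1 = s1"
    show "canon (blk s1 s1 s1 w1 w2 w3 y1 y1 y1)"
      by (rule canonI[OF idm, of "1/s1" q1])
        (use pos in \<open>simp_all add: h blk_def q1_def rotp_def inner_vec_def sum_3 add_divide_distrib\<close>)
  next
    assume h: "0 < w1*w2*w3" "w1^2 = 1" "w2^2 = 1" "w3^2 = 1" "y1 = s1"
    obtain D :: "real^3^3" where D: "rotation_matrix D" and Dv: "\<And>v. (D *v v)$1 = w1 * v$1 \<and> (D *v v)$2 = w2 * v$2 \<and> (D *v v)$3 = w3 * v$3"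
      using sign_rotation[OF h(2-4,1)] by blast
    have ww: "w*(w*a) = a" "w*a*(w*b) = a*b" if "w^2 = 1" for a b w :: real
    proof -
      have "w*w = 1" using that by (simp add: power2_eq_square)
      then show "w*(w*a) = a" "w*a*(w*b) = a*b" by (simp_all flip: mult.assoc)
    qed
    have D1: "(D *v v)$1 = w1 * v$1" "(D *v v)$2 = w2 * v$2" "(D *v v)$3 = w3 * v$3" for v using Dv by blast+
    have B: "blk s1 s1 s1 w1 w2 w3 s1 s1 s1 (rotp (mat 1) D x) (rotp (mat 1) D z) = 1/s1 * q2 x z" for x z
      unfolding blk_def rotp_def fst_conv snd_conv D1 ww[OF h(2)] ww[OF h(3)] ww[OF h(4)] matrix_vector_mul_lid
      by (simp add: q2_def inner_vec_def sum_3 add_divide_distrib)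
    have au: "rotp (mat 1) D \<in> auts" using rotation_matrix_1 D by (auto simp: auts_def)
    show "canon (blk s1 s1 s1 w1 w2 w3 y1 y1 y1)"
      unfolding h(5) by (rule canonI[where F="rotp (mat 1) D" and k="1/s1" and q=q2]; (rule au | rule B | (use pos in simp)))
  next
    assume h: "0 < w1*w2*w3" "w1^2 = 1/4" "w2^2 = 1/4" "w3^2 = 1/4" "3*y1 = 4 * s1"
    have g: "(2*w1)^2 = 1" "(2*w2)^2 = 1" "(2*w3)^2 = 1" "0 < (2*w1)*(2*w2)*(2*w3)" using h by (simp_all add: power_mult_distrib)
    obtain D :: "real^3^3" where D: "rotation_matrix D" and Dv: "\<And>v. (D *v v)$1 = 2*w1 * v$1 \<and> (D *v v)$2 = 2*w2 * v$2 \<and> (D *v v)$3 = 2*w3 * v$3"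
      using sign_rotation[OF g] by blast
    have ww: "w*(2*w*a) = a/2" "2*w*a*(2*w*b) = a*b" if "w^2 = 1/4" for a b w :: real
    proof -
      have q: "w*w = 1/4" using that by (simp add: power2_eq_square)
      have "w*(2*w*a) = 2*(w*w)*a" "2*w*a*(2*w*b) = 4*(w*w)*(a*b)" by simp_all
      then show "w*(2*w*a) = a/2" "2*w*a*(2*w*b) = a*b" unfolding q by simp_all
    qed
    have y: "y1 = 4/3 * s1" using h by simp
    have D1: "(D *v v)$1 = 2*w1 * v$1" "(D *v v)$2 = 2*w2 * v$2" "(D *v v)$3 = 2*w3 * v$3" for v using Dv by blast+
    have B: "blk s1 s1 s1 w1 w2 w3 (4/3 * s1) (4/3 * s1) (4/3 * s1) (rotp (mat 1) D x) (rotp (mat 1) D z) = 1/s1 * q3 x z" for x z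
      unfolding blk_def rotp_def vswap_def fst_conv snd_conv D1 ww[OF h(2)] ww[OF h(3)] ww[OF h(4)] matrix_vector_mul_lid
      using pos(1) by (simp add: q3_def inner_vec_def sum_3 field_simps)
    have au: "(rotp (mat 1) D) \<in> auts" using rotation_matrix_1 D by (auto simp: auts_def)
    show "canon (blk s1 s1 s1 w1 w2 w3 y1 y1 y1)"
      unfolding y by (rule canonI[where F="rotp (mat 1) D" and k="1/s1" and q=q3]; (rule au | rule B | (use pos in simp)))
  next
    assume h: "0 < w1*w2*w3" "w1^2 = 1/4" "w2^2 = 1/4" "w3^2 = 1/4" "y1 = 4 * s1"
    have g: "(2*w1)^2 = 1" "(2*w2)^2 = 1" "(2*w3)^2 = 1" "0 < (2*w1)*(2*w2)*(2*w3)" using h by (simp_all add: power_mult_distrib)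
    obtain D :: "real^3^3" where D: "rotation_matrix D" and Dv: "\<And>v. (D *v v)$1 = 2*w1 * v$1 \<and> (D *v v)$2 = 2*w2 * v$2 \<and> (D *v v)$3 = 2*w3 * v$3"
      using sign_rotation[OF g] by blast
    have ww: "w*(2*w*a) = a/2" "2*w*a*(2*w*b) = a*b" if "w^2 = 1/4" for a b w :: real
    proof -
      have q: "w*w = 1/4" using that by (simp add: power2_eq_square)
      have "w*(2*w*a) = 2*(w*w)*a" "2*w*a*(2*w*b) = 4*(w*w)*(a*b)" by simp_all
      then show "w*(2*w*a) = a/2" "2*w*a*(2*w*b) = a*b" unfolding q by simp_all
    qed
    have D1: "(D *v v)$1 = 2*w1 * v$1" "(D *v v)$2 = 2*w2 * v$2" "(D *v v)$3 = 2*w3 * v$3" for v using Dv by blast+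
    \<comment> \<open>After the sign rotation the form is a multiple of
      \<open>|e|^2 + |e - f|^2\<close>, with \<open>e\<close> and \<open>f\<close> the components in
      the two factors. This is \<open>q2\<close> with the factors exchanged, hence
      \<open>vswap\<close>.\<close>
    have B: "blk s1 s1 s1 w1 w2 w3 (4 * s1) (4 * s1) (4 * s1) (rotp (mat 1) D (vswap x)) (rotp (mat 1) D (vswap z)) = 1/(2 * s1) * q2 x z" for x z
      unfolding blk_def rotp_def vswap_def fst_conv snd_conv D1 ww[OF h(2)] ww[OF h(3)] ww[OF h(4)] matrix_vector_mul_lid
      using pos(1) by (simp add: q2_def inner_vec_def sum_3 field_simps)
    have au: "(\<lambda>x. rotp (mat 1) D (vswap x)) \<in> auts" using rotation_matrix_1 D by (auto simp: auts_def)
    show "canon (blk s1 s1 s1 w1 w2 w3 y1 y1 y1)"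
      unfolding h(5) by (rule canonI[where F="\<lambda>x. rotp (mat 1) D (vswap x)" and k="1/(2 * s1)" and q=q2]; (rule au | rule B | (use pos in simp)))
  qed
qed

text \<open>Rodrigues' formula for the conjugation \<open>u \<mapsto> a u a\<^sup>-\<^sup>1\<close> by the unit quaternion \<open>a = (c, w)\<close>.\<close>

definition rodr :: "real \<Rightarrow> real^3 \<Rightarrow> real^3 \<Rightarrow> real^3" where
  "rodr c w u = (c^2 - w \<bullet> w) *\<^sub>R u + (2*c) *\<^sub>R cross3 w u + (2 * (w \<bullet> u)) *\<^sub>R w"

section \<open>Normal forms forced by symmetries\<close>

lemma einst_offdiag_canon:
  assumes e: "einst (\<lambda>x y. B (rotp A C x) (rotp A C y))" and A: "rotation_matrix A" and C: "rotation_matrix C"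
    and EE: "\<And>i j. i \<noteq> j \<Longrightarrow> B (A *v axis i 1, 0) (A *v axis j 1, 0) = 0"
    and FF: "\<And>i j. i \<noteq> j \<Longrightarrow> B (0, C *v axis i 1) (0, C *v axis j 1) = 0"
    and EF: "\<And>i j. i \<noteq> j \<Longrightarrow> B (A *v axis i 1, 0) (0, C *v axis j 1) = 0"
  shows "canon B"
proof -
  let ?B = "\<lambda>x y. B (rotp A C x) (rotp A C y)"
  have s: "sprod ?B" using e by (simp add: einst_def)
  have v: "rotp A C (vE i) = (A *v axis i 1, 0)" "rotp A C (vF i) = (0, C *v axis i 1)" for i
    by (simp_all add: rotp_def vE_def vF_def)
  obtain s1 s2 s3 w1 w2 w3 y1 y2 y3 where pos: "0 < s1" "0 < s2" "0 < s3" "0 < y1" "0 < y2" "0 < y3"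
    and B: "?B = blk s1 s2 s3 w1 w2 w3 y1 y2 y3"
    using sprod_blk[OF s] EE FF EF unfolding v by blast
  have "canon ?B" unfolding B by (rule einst_blk_canon[OF pos]) (use e B in simp)
  then show ?thesis by (rule canon_rotp[OF _ A C])
qed

text \<open>The map \<open>rodr 0 n\<close> is the half-turn about \<open>n\<close>. Under the two
  symmetries the frame vectors of index 1, 2, 3 have the signs \<open>(+,-)\<close>,
  \<open>(-,+)\<close>, \<open>(-,-)\<close> in both factors, so vectors of different index are
  orthogonal.\<close>

lemma involutions_canon:
  fixes n1 n2 m1 m2 :: "real^3"
  assumes e: "einst B" and n: "norm n1 = 1" "norm n2 = 1" "n1 \<bullet> n2 = 0" and m: "norm m1 = 1" "norm m2 = 1" "m1 \<bullet> m2 = 0"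
    and i1: "\<And>x y. B (rodr 0 n1 (fst x), rodr 0 m1 (snd x)) (rodr 0 n1 (fst y), rodr 0 m1 (snd y)) = B x y"
    and i2: "\<And>x y. B (rodr 0 n2 (fst x), rodr 0 m2 (snd x)) (rodr 0 n2 (fst y), rodr 0 m2 (snd y)) = B x y"
  shows "canon B"
proof -
  have b: "bilinear B" using e by (simp add: einst_def sprod_def)
  let ?n3 = "cross3 n1 n2" and ?m3 = "cross3 m1 m2"
  let ?A = "frame3 n1 n2 ?n3" and ?C = "frame3 m1 m2 ?m3"
  have A: "rotation_matrix ?A" and C: "rotation_matrix ?C" using frame3_rotation n m by auto
  have r: "rodr 0 a a = a" "a \<bullet> u = 0 \<Longrightarrow> rodr 0 a u = - u" "rodr 0 a 0 = 0" if "norm a = 1" for a u :: "real^3"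
    using that by (simp_all add: rodr_def norm_eq_1 scaleR_2 flip: scaleR_add_left)
  have d: "n1 \<bullet> n2 = 0" "n2 \<bullet> n1 = 0" "n1 \<bullet> ?n3 = 0" "n2 \<bullet> ?n3 = 0" "m1 \<bullet> m2 = 0" "m2 \<bullet> m1 = 0" "m1 \<bullet> ?m3 = 0" "m2 \<bullet> ?m3 = 0"
    using n m by (simp_all add: dot_cross_self inner_commute)
  have neg: "B (- x) y = - B x y" "B x (- y) = - B x y" for x y
    using bilinear_lneg[OF b] bilinear_rneg[OF b] by auto
  have p: "(- u, 0) = - ((u, 0)::vv)" "(0, - u) = - ((0, u)::vv)" for u :: "real^3" by simp_all
  have z: "B x y = 0" if "B (- x) y = B x y \<or> B x (- y) = B x y" for x y using that neg[of x y] by auto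
  note R = r(1)[OF n(1)] r(1)[OF n(2)] r(1)[OF m(1)] r(1)[OF m(2)] r(3)[OF n(1)] r(3)[OF n(2)] r(3)[OF m(1)] r(3)[OF m(2)]
    r(2)[OF n(1) d(1)] r(2)[OF n(2) d(2)] r(2)[OF n(1) d(3)] r(2)[OF n(2) d(4)]
    r(2)[OF m(1) d(5)] r(2)[OF m(2) d(6)] r(2)[OF m(1) d(7)] r(2)[OF m(2) d(8)]
  have hz1: "B x y = 0" if "rodr 0 n1 (fst x) = fst x \<and> rodr 0 m1 (snd x) = snd x \<and> rodr 0 n1 (fst y) = - fst y \<and> rodr 0 m1 (snd y) = - snd y
      \<or> rodr 0 n1 (fst x) = - fst x \<and> rodr 0 m1 (snd x) = - snd x \<and> rodr 0 n1 (fst y) = fst y \<and> rodr 0 m1 (snd y) = snd y" for x y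
    using z[of x y] i1[of x y] that by (auto simp: uminus_prod_def)
  have hz2: "B x y = 0" if "rodr 0 n2 (fst x) = fst x \<and> rodr 0 m2 (snd x) = snd x \<and> rodr 0 n2 (fst y) = - fst y \<and> rodr 0 m2 (snd y) = - snd y
      \<or> rodr 0 n2 (fst x) = - fst x \<and> rodr 0 m2 (snd x) = - snd x \<and> rodr 0 n2 (fst y) = fst y \<and> rodr 0 m2 (snd y) = snd y" for x y
    using z[of x y] i2[of x y] that by (auto simp: uminus_prod_def)
  have k: "B (n1,0) (n2,0) = 0" "B (n1,0) (?n3,0) = 0" "B (n2,0) (n1,0) = 0" "B (n2,0) (?n3,0) = 0" "B (?n3,0) (n1,0) = 0" "B (?n3,0) (n2,0) = 0"
    "B (0,m1) (0,m2) = 0" "B (0,m1) (0,?m3) = 0" "B (0,m2) (0,m1) = 0" "B (0,m2) (0,?m3) = 0" "B (0,?m3) (0,m1) = 0" "B (0,?m3) (0,m2) = 0"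
    "B (n1,0) (0,m2) = 0" "B (n1,0) (0,?m3) = 0" "B (n2,0) (0,m1) = 0" "B (n2,0) (0,?m3) = 0" "B (?n3,0) (0,m1) = 0" "B (?n3,0) (0,m2) = 0"
    by ((rule hz1, simp add: R; fail) | (rule hz2, simp add: R; fail))+
  have e': "einst (\<lambda>x y. B (rotp ?A ?C x) (rotp ?A ?C y))" by (rule einst_aut[OF e lie_aut_rotp[OF A C]])
  show ?thesis
  proof (rule einst_offdiag_canon[OF e' A C])
    fix i j :: 3 assume ij: "i \<noteq> j"
    show "B (?A *v axis i 1, 0) (?A *v axis j 1, 0) = 0" "B (0, ?C *v axis i 1) (0, ?C *v axis j 1) = 0" "B (?A *v axis i 1, 0) (0, ?C *v axis j 1) = 0"
      using ij exhaust_3[of i] exhaust_3[of j] k by (auto simp: frame3_axis)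
  qed
qed

text \<open>A nontrivial rotation fixes no nonzero vector orthogonal to its axis. Here
  \<open>2 * s^2\<close> and \<open>2*c * s\<close> are \<open>1 - cos\<close> and
  \<open>sin\<close> of the full angle, and the sum of their squares is the determinant of the
  linear system for \<open>f u\<close> and \<open>f ?J\<close>.\<close>

lemma rotation_fixed_functional:
  fixes f :: "real^3 \<Rightarrow> real"
  assumes f: "linear f" and n: "norm n = 1" and cs: "c^2 + s^2 = 1" and s: "s \<noteq> 0"
    and inv: "\<And>u. f (rodr c (s *\<^sub>R n) u) = f u" and u: "n \<bullet> u = 0"
  shows "f u = 0"
proof -
  have nn: "n \<bullet> n = 1" using n by (simp add: norm_eq_1)
  let ?J = "cross3 n u"
  have JJ: "cross3 n ?J = - u" using nn u by (simp add: Lagrange)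
  have al: "c^2 - s^2 = 1 - 2 * s^2" using cs by simp
  have r: "rodr c (s *\<^sub>R n) v = (1 - 2 * s^2) *\<^sub>R v + (2*c * s) *\<^sub>R cross3 n v" if "n \<bullet> v = 0" for v
    using that nn al by (simp add: rodr_def cross_mult_left power2_eq_square)
  have "f u = (1-2 * s^2) * f u + (2*c * s) * f ?J"
    using inv[of u] unfolding r[OF u] by (simp add: linear_add[OF f] linear_scale[OF f])
  then have 1: "2 * s^2 * f u = (2*c * s) * f ?J" by (simp add: algebra_simps)
  have "f ?J = (1-2 * s^2) * f ?J + (2*c * s) * f (- u)"
    using inv[of ?J] unfolding r[OF dot_cross_self(1)] JJ by (simp only: linear_add[OF f] linear_scale[OF f]) simp
  then have 2: "2 * s^2 * f ?J = - ((2*c * s) * f u)" by (simp add: algebra_simps linear_neg[OF f])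
  have "(2 * s^2) * (2 * s^2 * f u) = (2*c * s) * (2 * s^2 * f ?J)" unfolding 1 by simp
  also have "\<dots> = - ((2*c * s)^2 * f u)" unfolding 2 by (simp add: power2_eq_square)
  finally have "((2 * s^2)^2 + (2*c * s)^2) * f u = 0" by (simp add: algebra_simps power2_eq_square)
  moreover have "0 < (2 * s^2)^2 + (2*c * s)^2" using s by (simp add: add_pos_nonneg)
  ultimately show ?thesis by simp
qed

lemma rodr_axis: "norm n = 1 \<Longrightarrow> c^2 + s^2 = 1 \<Longrightarrow> rodr c (s *\<^sub>R n) n = n"
  by (simp add: rodr_def norm_eq_1 cross_mult_left power2_eq_square add.commute flip: scaleR_add_left)

lemma rodr_0: "rodr c w 0 = 0" by (simp add: rodr_def)

lemma rodr_zero: "c^2 = 1 \<Longrightarrow> rodr c 0 u = u" by (simp add: rodr_def)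

lemma orthonormal_completion:
  fixes n :: "real^3" assumes "norm n = 1"
  obtains p q where "norm p = 1" "norm q = 1" "p \<bullet> q = 0" "cross3 p q = n" "n \<bullet> p = 0" "n \<bullet> q = 0"
proof -
  obtain A :: "real^3^3" where A: "rotation_matrix A" "A *v axis 3 1 = n"
    using rotation_matrix_exists_basis[of n 3] assms by auto
  define p q where "p = A *v axis 1 1" and "q = A *v axis 2 1"
  have orth: "orthogonal_transformation ((*v) A)"
    using A by (simp add: rotation_matrix_def orthogonal_transformation_matrix)
  have pq: "norm p = 1" "norm q = 1" "p \<bullet> q = 0"
    using orth by (simp_all add: p_def q_def orthogonal_transformation_def norm_eq_1 inner_axis_axis)
  have c: "cross3 p q = n"
    using cross_rotation_matrix[OF A(1), of "axis 1 1" "axis 2 1"] A(2) by (simp add: p_def q_def cross_basis)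
  show thesis by (rule that[OF pq c]) (simp_all add: dot_cross_self flip: c)
qed

lemma bilinear_sections:
  assumes b: "bilinear (B::vv \<Rightarrow> vv \<Rightarrow> real)"
  shows "bilinear (\<lambda>u u'. B (u,0) (u',0))" "bilinear (\<lambda>v v'. B (0,v) (0,v'))" "linear (\<lambda>u. B (u,0) x)" "linear (\<lambda>v. B (0,v) x)" "linear (\<lambda>v. B x (0,v))"
proof -
  have p: "(u + v, 0) = (u,0) + ((v,0)::vv)" "(0, u + v) = (0,u) + ((0,v)::vv)" "(k *\<^sub>R u, 0) = k *\<^sub>R ((u,0)::vv)" "(0, k *\<^sub>R u) = k *\<^sub>R ((0,u)::vv)"
    for u v :: "real^3" and k by simp_all
  note B = bilinear_ladd[OF b] bilinear_radd[OF b] bilinear_lmul[OF b] bilinear_rmul[OF b]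
  show "linear (\<lambda>u. B (u,0) x)" "linear (\<lambda>v. B (0,v) x)" "linear (\<lambda>v. B x (0,v))"
    by (rule linearI; simp only: p B real_scaleR_def)+
  show "bilinear (\<lambda>u u'. B (u,0) (u',0))" "bilinear (\<lambda>v v'. B (0,v) (0,v'))"
    unfolding bilinear_def by (intro conjI allI linearI; simp only: p B real_scaleR_def)+
qed

text \<open>The symmetry fixes the second factor pointwise, so the plane orthogonal to
  \<open>n\<close> decouples from everything else. Only \<open>n\<close> can be coupled to the
  second factor, and this is the rank-one form.\<close>

lemma one_sided_canon:
  fixes n :: "real^3"
  assumes e: "einst B" and n: "norm n = 1" and cs: "c^2 + s^2 = 1" and s: "s \<noteq> 0"
    and inv: "\<And>x y. B (rodr c (s *\<^sub>R n) (fst x), snd x) (rodr c (s *\<^sub>R n) (fst y), snd y) = B x y"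
  shows "canon B"
proof -
  have sp: "sprod B" using e by (simp add: einst_def)
  note b = sprodD(1)[OF sp] and sym = sprodD(2)[OF sp]
  note sec = bilinear_sections[OF b]
  have zn: "B (u,0) (n,0) = 0" if "n \<bullet> u = 0" for u
    by (rule rotation_fixed_functional[OF sec(3) n cs s _ that]) (use inv[of "(_,0)" "(n,0)"] in \<open>simp add: rodr_axis[OF n cs]\<close>)
  have zv: "B (u,0) (0,v) = 0" if "n \<bullet> u = 0" for u v
    by (rule rotation_fixed_functional[OF sec(3) n cs s _ that]) (use inv[of "(_,0)" "(0,v)"] in \<open>simp add: rodr_0\<close>)
  obtain p q where pq: "norm p = 1" "norm q = 1" "p \<bullet> q = 0" and cr: "cross3 p q = n" and np: "n \<bullet> p = 0" "n \<bullet> q = 0"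
    using orthonormal_completion[OF n] by blast
  obtain k d where kd: "k^2+d^2 = 1" "B (k *\<^sub>R p + d *\<^sub>R q, 0) (k *\<^sub>R q - d *\<^sub>R p, 0) = 0"
    using plane_diagonalize[OF sec(1) sym pq] by blast
  define a1 a2 where "a1 = k *\<^sub>R p + d *\<^sub>R q" and "a2 = k *\<^sub>R q - d *\<^sub>R p"
  note r = rotated_pair[OF pq kd(1), folded a1_def a2_def]
  have na: "n \<bullet> a1 = 0" "n \<bullet> a2 = 0" using np by (simp_all add: a1_def a2_def inner_add_right inner_diff_right)
  define A where "A = frame3 a1 a2 (cross3 a1 a2)"
  have A: "rotation_matrix A" unfolding A_def by (rule frame3_rotation[OF r(1-3)])
  have Aa: "A *v axis 1 1 = a1" "A *v axis 2 1 = a2" "A *v axis 3 1 = n" by (simp_all add: A_def frame3_axis r(4) cr)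
  \<comment> \<open>The Schur complement with respect to \<open>n\<close>. Diagonalizing it, rather
    than \<open>B\<close> on the second factor, is what \<open>sprod_rkone\<close> asks for.\<close>
  define N where "N v v' = B (0,v) (0,v') - B (n,0) (0,v) * B (n,0) (0,v') / B (n,0) (n,0)" for v v'
  have "bilinear N"
  proof -
    note l = linear_add[OF sec(5)] linear_scale[OF sec(5)] bilinear_ladd[OF sec(2)] bilinear_radd[OF sec(2)] bilinear_lmul[OF sec(2)] bilinear_rmul[OF sec(2)]
    show ?thesis unfolding bilinear_def N_def
      by (intro conjI allI linearI) (simp_all only: l real_scaleR_def, simp_all add: algebra_simps add_divide_distrib)
  qed
  then obtain C where C: "rotation_matrix C" and NC: "\<And>i j. i \<noteq> j \<Longrightarrow> N (C *v axis i 1) (C *v axis j 1) = 0"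
    using diagonalize3[of N] sym by (auto simp: N_def mult.commute)
  let ?B = "\<lambda>x y. B (rotp A C x) (rotp A C y)"
  have e': "einst ?B" by (rule einst_aut[OF e lie_aut_rotp[OF A C]])
  have sp': "sprod ?B" using e' by (simp add: einst_def)
  have v: "rotp A C (vE i) = (A *v axis i 1, 0)" "rotp A C (vF i) = (0, C *v axis i 1)" for i
    by (simp_all add: rotp_def vE_def vF_def)
  have EE: "?B (vE i) (vE j) = 0" if "i \<noteq> j" for i j
    using that exhaust_3[of i] exhaust_3[of j] zn[OF na(1)] zn[OF na(2)] sym[of "(n,0)"] kd(2)[folded a1_def a2_def] sym[of "(a2,0)" "(a1,0)"]
    unfolding v by (auto simp: Aa)
  have EF: "?B (vE i) (vF j) = 0" if "i \<noteq> 3" for i j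
    using that exhaust_3[of i] zv[OF na(1)] zv[OF na(2)] unfolding v by (auto simp: Aa)
  have FF: "?B (vF i) (vF j) = ?B (vE 3) (vF i) * ?B (vE 3) (vF j) / ?B (vE 3) (vE 3)" if "i \<noteq> j" for i j
    using NC[OF that] unfolding v N_def Aa by simp
  obtain s1 s2 s3 w1 w2 w3 y1 y2 y3 where pos: "0 < s1" "0 < s2" "0 < s3" "0 < y1" "0 < y2" "0 < y3"
    and B: "?B = rkone s1 s2 s3 w1 w2 w3 y1 y2 y3"
    using sprod_rkone[OF sp' EE EF FF] by blast
  have B': "?B = blk s1 s1 s1 0 0 0 s1 s1 s1"
    using einst_rkone_round[OF pos] e' unfolding B by simp
  have "canon ?B" unfolding B' by (rule einst_blk_canon) (use pos e' B' in auto)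
  then show ?thesis by (rule canon_rotp[OF _ A C])
qed

text \<open>The conditions \<open>c \<noteq> 0\<close> and \<open>s \<noteq> 0\<close> say that the
  full angle is not a multiple of \<open>\<pi>\<close>. Invariance gives two equations for
  \<open>Z-X\<close> and \<open>2*Y\<close> whose coefficient matrix is orthogonal, so both
  vanish.\<close>

lemma isotropic_plane:
  fixes P :: "real^3 \<Rightarrow> real^3 \<Rightarrow> real"
  assumes b: "bilinear P" and sym: "\<And>x y. P x y = P y x" and n: "norm n = 1" and cs: "c^2 + s^2 = 1" "c \<noteq> 0" "s \<noteq> 0"
    and inv: "\<And>u v. P (rodr c (s *\<^sub>R n) u) (rodr c (s *\<^sub>R n) v) = P u v"
    and pq: "norm p = 1" "norm q = 1" "p \<bullet> q = 0" "cross3 p q = n" "n \<bullet> p = 0" "n \<bullet> q = 0"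
  shows "P p q = 0" "P p p = P q q"
proof -
  have nn: "n \<bullet> n = 1" using n by (simp add: norm_eq_1)
  have i: "p \<bullet> p = 1" "q \<bullet> q = 1" "q \<bullet> p = 0" using pq by (simp_all add: norm_eq_1 inner_commute)
  have J: "cross3 n p = q" "cross3 n q = - p"
    unfolding pq(4)[symmetric]
    using i pq(3) by (simp_all add: cross_skew[of "cross3 p q"] Lagrange)
  define al be where "al = c^2 - s^2" and "be = 2*c * s"
  have r: "rodr c (s *\<^sub>R n) p = al *\<^sub>R p + be *\<^sub>R q" "rodr c (s *\<^sub>R n) q = al *\<^sub>R q - be *\<^sub>R p"
    using nn pq by (simp_all add: rodr_def cross_mult_left J al_def be_def power2_eq_square)
  have ab: "al*al + be*be = 1"
  proof -
    have "al*al + be*be = (c^2+s^2)^2" by (simp add: al_def be_def power2_eq_square algebra_simps)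
    then show ?thesis using cs by simp
  qed
  have be: "be \<noteq> 0" using cs by (simp add: be_def)
  note B = bilinear_ladd[OF b] bilinear_radd[OF b] bilinear_lsub[OF b] bilinear_rsub[OF b] bilinear_lmul[OF b] bilinear_rmul[OF b]
  define X Y Z where "X = P p p" and "Y = P p q" and "Z = P q q"
  have "al*al*X + 2*al*be*Y + be*be*Z = X"
    using inv[of p p] sym[of q p] unfolding r by (simp add: B X_def Y_def Z_def algebra_simps)
  moreover have "X = (al*al+be*be)*X" by (simp add: ab)
  ultimately have "be*(be*(Z-X) + 2*al*Y) = 0" by (simp add: algebra_simps)
  then have 1: "be*(Z-X) + 2*al*Y = 0" using be by simp
  have "al*al*Y - al*be*X + al*be*Z - be*be*Y = Y"
    using inv[of p q] sym[of q p] unfolding r by (simp add: B X_def Y_def Z_def algebra_simps)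
  moreover have "Y = (al*al+be*be)*Y" by (simp add: ab)
  ultimately have "be*(al*(Z-X) - 2*be*Y) = 0" by (simp add: algebra_simps)
  then have 2: "al*(Z-X) - 2*be*Y = 0" using be by simp
  have "(al*al+be*be)*(Z-X) = be*(be*(Z-X) + 2*al*Y) + al*(al*(Z-X) - 2*be*Y)" by (simp add: algebra_simps)
  then have ZX: "Z = X" by (simp add: 1 2 ab)
  then have "2*al*Y = 0" "2*be*Y = 0" using 1 2 by simp_all
  then show "P p q = 0" "P p p = P q q" using ZX be by (simp_all add: X_def Y_def Z_def)
qed

text \<open>Since \<open>B\<close> is isotropic on each plane orthogonal to an axis, orthonormal
  bases of both planes may be rotated freely. A singular value decomposition of the coupling
  \<open>M\<close> between the planes then leaves only pairs of equal index; the axes form the third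
  pair.\<close>

lemma two_sided_canon:
  fixes n m :: "real^3"
  assumes e: "einst B" and n: "norm n = 1" and m: "norm m = 1" and cs: "c^2 + s^2 = 1" "c \<noteq> 0" "s \<noteq> 0"
    and cs': "c'^2 + s'^2 = 1" "c' \<noteq> 0" "s' \<noteq> 0"
    and inv: "\<And>x y. B (rodr c (s *\<^sub>R n) (fst x), rodr c' (s' *\<^sub>R m) (snd x)) (rodr c (s *\<^sub>R n) (fst y), rodr c' (s' *\<^sub>R m) (snd y)) = B x y"
  shows "canon B"
proof -
  have sp: "sprod B" using e by (simp add: einst_def)
  note b = sprodD(1)[OF sp] and sym = sprodD(2)[OF sp]
  note sec = bilinear_sections[OF b]
  note ax = rodr_axis[OF n cs(1)] rodr_axis[OF m cs'(1)] rodr_0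
  have z: "B (u,0) (n,0) = 0" "B (u,0) (0,m) = 0" if "n \<bullet> u = 0" for u
    by (rule rotation_fixed_functional[OF sec(3) n cs(1,3) _ that], use inv[of "(_,0)" "(n,0)"] inv[of "(_,0)" "(0,m)"] in \<open>simp add: ax\<close>)+
  have z': "B (0,v) (0,m) = 0" "B (0,v) (n,0) = 0" if "m \<bullet> v = 0" for v
    by (rule rotation_fixed_functional[OF sec(4) m cs'(1,3) _ that], use inv[of "(0,_)" "(n,0)"] inv[of "(0,_)" "(0,m)"] in \<open>simp add: ax\<close>)+
  obtain p q where pq: "norm p = 1" "norm q = 1" "p \<bullet> q = 0" "cross3 p q = n" "n \<bullet> p = 0" "n \<bullet> q = 0"
    using orthonormal_completion[OF n] by blast
  obtain p' q' where pq': "norm p' = 1" "norm q' = 1" "p' \<bullet> q' = 0" "cross3 p' q' = m" "m \<bullet> p' = 0" "m \<bullet> q' = 0"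
    using orthonormal_completion[OF m] by blast
  have P: "B (p,0) (q,0) = 0" "B (p,0) (p,0) = B (q,0) (q,0)"
    by (rule isotropic_plane[OF sec(1) sym n cs _ pq], use inv[of "(_,0)" "(_,0)"] in \<open>simp add: ax\<close>)+
  have R: "B (0,p') (0,q') = 0" "B (0,p') (0,p') = B (0,q') (0,q')"
    by (rule isotropic_plane[OF sec(2) sym m cs' _ pq'], use inv[of "(0,_)" "(0,_)"] in \<open>simp add: ax\<close>)+
  define M where "M u v = B (u,0) (0,v)" for u v
  \<comment> \<open>The Gram form of the rows of \<open>M\<close>: diagonalizing it makes the rows
    of \<open>a1\<close> and \<open>a2\<close> orthogonal.\<close>
  define N where "N u u' = M u p' * M u' p' + M u q' * M u' q'" for u u'
  have Ml: "M (u + u') v = M u v + M u' v" "M (k *\<^sub>R u) v = k * M u v" for u u' v k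
    using linear_add[OF sec(3)] linear_scale[OF sec(3)] by (simp_all add: M_def)
  have Mr: "M u (v + v') = M u v + M u v'" "M u (v - v') = M u v - M u v'" "M u (k *\<^sub>R v) = k * M u v" for u v v' k
    using linear_add[OF sec(5)] linear_diff[OF sec(5)] linear_scale[OF sec(5)] by (simp_all add: M_def)
  have "bilinear N" unfolding bilinear_def N_def
    by (intro conjI allI linearI) (simp_all add: Ml algebra_simps)
  then obtain k d where kd: "k^2+d^2 = 1" "N (k *\<^sub>R p + d *\<^sub>R q) (k *\<^sub>R q - d *\<^sub>R p) = 0"
    using plane_diagonalize[of N p q] pq by (auto simp: N_def mult.commute)
  define a1 a2 where "a1 = k *\<^sub>R p + d *\<^sub>R q" and "a2 = k *\<^sub>R q - d *\<^sub>R p"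
  note r = rotated_pair[OF pq(1-3) kd(1), folded a1_def a2_def]
  have Nz: "M a1 p' * M a2 p' + M a1 q' * M a2 q' = 0" using kd(2) by (simp add: N_def a1_def a2_def)
  have unit: "\<exists>g h. g^2+h^2 = 1 \<and> g * t = h * u" for t u :: real
  proof (cases "t = 0 \<and> u = 0")
    case True then show ?thesis by (intro exI[of _ 1] exI[of _ 0]) simp
  next
    case False
    define r where "r = sqrt (u^2 + t^2)"
    have "0 < u^2 + t^2" using False by (auto simp: sum_power2_gt_zero_iff)
    moreover have "r^2 = u^2 + t^2" using calculation by (simp add: r_def)
    ultimately have "r^2 = u^2 + t^2" "r^2 \<noteq> 0" by linarith+
    then have "(u/r)^2 + (t/r)^2 = 1" by (simp add: power_divide flip: add_divide_distrib)
    moreover have "(u/r)*t = (t/r)*u" by simp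
    ultimately show ?thesis by blast
  qed
  \<comment> \<open>The direction \<open>(g, h)\<close> follows the row of \<open>a1\<close>, to
    which the row of \<open>a2\<close> is orthogonal. If the row of \<open>a1\<close> is zero, it is
    chosen orthogonal to the row of \<open>a2\<close>.\<close>
  have "\<exists>g h. g^2+h^2 = 1 \<and> g * M a1 q' = h * M a1 p' \<and> g * M a2 p' + h * M a2 q' = 0"
  proof (cases "M a1 p' = 0 \<and> M a1 q' = 0")
    case True
    obtain g h where "g^2+h^2 = 1" "g * M a2 p' = h * - M a2 q'" using unit by blast
    then show ?thesis using True by (intro exI[of _ g] exI[of _ h]) simp
  next
    case False
    obtain g h where gh: "g^2+h^2 = 1" "g * M a1 q' = h * M a1 p'" using unit by blast
    have "M a1 p' * (g * M a2 p' + h * M a2 q') = g * (M a1 p' * M a2 p' + M a1 q' * M a2 q')"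
      using gh(2) by (simp add: algebra_simps)
    moreover have "M a1 q' * (g * M a2 p' + h * M a2 q') = h * (M a1 p' * M a2 p' + M a1 q' * M a2 q')"
      using gh(2) by (simp add: algebra_simps)
    ultimately have "g * M a2 p' + h * M a2 q' = 0" using False Nz by auto
    then show ?thesis using gh by blast
  qed
  then obtain g h where gh: "g^2+h^2 = 1" "g * M a1 q' = h * M a1 p'" "g * M a2 p' + h * M a2 q' = 0" by blast
  define b1 b2 where "b1 = g *\<^sub>R p' + h *\<^sub>R q'" and "b2 = g *\<^sub>R q' - h *\<^sub>R p'"
  note r' = rotated_pair[OF pq'(1-3) gh(1), folded b1_def b2_def]
  have M0: "M a1 b2 = 0" "M a2 b1 = 0" using gh by (simp_all add: b1_def b2_def Mr)
  have na: "n \<bullet> a1 = 0" "n \<bullet> a2 = 0" "m \<bullet> b1 = 0" "m \<bullet> b2 = 0"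
    using pq pq' by (simp_all add: a1_def a2_def b1_def b2_def inner_add_right inner_diff_right)
  note B1 = bilinear_ladd[OF sec(1)] bilinear_rsub[OF sec(1)] bilinear_lmul[OF sec(1)] bilinear_rmul[OF sec(1)]
  note B2 = bilinear_ladd[OF sec(2)] bilinear_rsub[OF sec(2)] bilinear_lmul[OF sec(2)] bilinear_rmul[OF sec(2)]
  have PA: "B (a1,0) (a2,0) = 0" unfolding a1_def a2_def
    using P sym[of "(q,0)" "(p,0)"] by (simp only: B1) simp
  have RA: "B (0,b1) (0,b2) = 0" unfolding b1_def b2_def
    using R sym[of "(0,q')" "(0,p')"] by (simp only: B2) simp
  define A C where "A = frame3 a1 a2 (cross3 a1 a2)" and "C = frame3 b1 b2 (cross3 b1 b2)"
  have A: "rotation_matrix A" and C: "rotation_matrix C" unfolding A_def C_def by (rule frame3_rotation[OF r(1-3)] frame3_rotation[OF r'(1-3)])+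
  have Aa: "A *v axis 1 1 = a1" "A *v axis 2 1 = a2" "A *v axis 3 1 = n" "C *v axis 1 1 = b1" "C *v axis 2 1 = b2" "C *v axis 3 1 = m"
    by (simp_all add: A_def C_def frame3_axis r(4) r'(4) pq(4) pq'(4))
  note zz = z[OF na(1)] z[OF na(2)] z'[OF na(3)] z'[OF na(4)] PA RA M0[unfolded M_def]
  note zs = zz zz[THEN trans[OF sym]]
  have e': "einst (\<lambda>x y. B (rotp A C x) (rotp A C y))" by (rule einst_aut[OF e lie_aut_rotp[OF A C]])
  show ?thesis
  proof (rule einst_offdiag_canon[OF e' A C])
    fix i j :: 3 assume ij: "i \<noteq> j"
    show "B (A *v axis i 1, 0) (A *v axis j 1, 0) = 0" "B (0, C *v axis i 1) (0, C *v axis j 1) = 0" "B (A *v axis i 1, 0) (0, C *v axis j 1) = 0"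
      using ij exhaust_3[of i] exhaust_3[of j] zs by (auto simp: Aa)
  qed
qed

section \<open>The Koszul formula\<close>

definition orthonormal6 :: "(vv \<Rightarrow> vv \<Rightarrow> real) \<Rightarrow> (nat \<Rightarrow> vv) \<Rightarrow> bool" where
  "orthonormal6 B e \<longleftrightarrow> (\<forall>i<6. \<forall>j<6. B (e i) (e j) = (if i = j then 1 else 0))"

lemma lin_sum: "linear f \<Longrightarrow> f (\<Sum>i\<in>S. c i *\<^sub>R x i) = (\<Sum>i\<in>S. c i * (f (x i)::real))"
  by (simp add: linear_sum linear_scale)

lemma bil_lin: "bilinear B \<Longrightarrow> linear (\<lambda>x. B x y)" "bilinear B \<Longrightarrow> linear (B x)"
  by (auto simp: bilinear_def)

lemma sum_delta6: "j < 6 \<Longrightarrow> (\<Sum>i<6. c i * (if i = j then 1 else 0)) = (c (j::nat)::real)"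
  by (simp add: if_distrib[of "\<lambda>x. _ * x"] cong: if_cong)

lemma orthonormal6_span:
  assumes b: "bilinear B" and o: "orthonormal6 B e"
  shows "span (e ` {..<6}) = UNIV"
proof -
  have inj: "inj_on e {..<6}"
  proof (rule inj_onI)
    fix i j :: nat assume ij: "i \<in> {..<6}" "j \<in> {..<6}" "e i = e j"
    then have "B (e i) (e j) = 1" using o by (metis lessThan_iff orthonormal6_def)
    then show "i = j" using o ij by (metis lessThan_iff orthonormal6_def zero_neq_one)
  qed
  have "independent (e ` {..<6})"
  proof (rule independent_if_scalars_zero)
    fix f x assume z: "(\<Sum>x\<in>e ` {..<6}. f x *\<^sub>R x) = 0" and x: "x \<in> e ` {..<6}"
    then obtain j where j: "j < 6" "x = e j" by auto
    have "(\<Sum>i<6. f (e i) *\<^sub>R e i) = 0" using z by (simp add: sum.reindex[OF inj])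
    then have "0 = (\<Sum>i<6. f (e i) * B (e i) (e j))"
      using lin_sum[OF bil_lin(1)[OF b, of "e j"], where S="{..<6}" and c="\<lambda>i. f (e i)" and x=e] by (simp add: bilinear_lzero[OF b])
    also have "\<dots> = (\<Sum>i<6. f (e i) * (if i = j then 1 else 0))"
      using o j by (intro sum.cong) (auto simp: orthonormal6_def)
    finally show "f x = 0" using j by (simp only: sum_delta6)
  qed simp
  moreover have "card (e ` {..<6}) = 6" using inj by (simp add: card_image)
  moreover have "DIM(vv) = 6" by simp
  ultimately show ?thesis
    by (metis (no_types, lifting) card_ge_dim_independent dim_UNIV order_refl subset_UNIV top.extremum_uniqueI)
qed

lemma orthonormal6_expand:
  assumes b: "bilinear B" and o: "orthonormal6 B e"
  shows "x = (\<Sum>i<6. B x (e i) *\<^sub>R e i)"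
proof -
  have "x \<in> span (e ` {..<6})" using orthonormal6_span[OF b o] by simp
  then show ?thesis
  proof (induction rule: span_induct_alt)
    case base
    show ?case by (simp add: bilinear_lzero[OF b])
  next
    case (step c x y)
    then obtain j where j: "j < 6" "x = e j" by auto
    have "(\<Sum>i<6. B (c *\<^sub>R x + y) (e i) *\<^sub>R e i) = (\<Sum>i<6. (c * B x (e i)) *\<^sub>R e i) + (\<Sum>i<6. B y (e i) *\<^sub>R e i)"
      by (simp add: bilinear_ladd[OF b] bilinear_lmul[OF b] scaleR_add_left sum.distrib)
    also have "(\<Sum>i<6. (c * B x (e i)) *\<^sub>R e i) = (\<Sum>i<6. if i = j then c *\<^sub>R x else 0)"
      using o j by (intro sum.cong) (auto simp: orthonormal6_def)
    also have "\<dots> = c *\<^sub>R x" using j by simp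
    finally show ?case using step(2) by simp
  qed
qed

lemma orthonormal6_parseval:
  assumes b: "bilinear B" and o: "orthonormal6 B e" and f: "linear f"
  shows "f x = (\<Sum>i<6. B x (e i) * (f (e i)::real))"
  by (subst orthonormal6_expand[OF b o, of x]) (rule lin_sum[OF f])

text \<open>Koszul's formula for the product of \<open>D X Y\<close> with \<open>Z\<close> on
  left-invariant fields; the derivative terms are absent because products of such fields are
  constant.\<close>

definition kos :: "(vv \<Rightarrow> vv \<Rightarrow> real) \<Rightarrow> vv \<Rightarrow> vv \<Rightarrow> vv \<Rightarrow> real" where
  "kos B x y z = (B (lbr x y) z - B (lbr x z) y - B (lbr y z) x) / 2"

lemma lbr_linear: "linear (\<lambda>x. lbr x y)" "linear (lbr x)"
  by (auto intro!: linearI simp: lbr_def cross_add_left cross_add_right cross_mult_left cross_mult_right)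

lemma lbr_skew: "lbr x y = - lbr y x"
  using cross_skew[of "fst x" "fst y"] cross_skew[of "snd x" "snd y"] by (simp add: lbr_def)

lemma kos_linear1:
  assumes b: "bilinear B"
  shows "linear (\<lambda>x. kos B x y z)"
proof -
  note [simp] = linear_add[OF lbr_linear(1)] linear_scale[OF lbr_linear(1)] bilinear_ladd[OF b] bilinear_lmul[OF b] bilinear_radd[OF b] bilinear_rmul[OF b]
  show ?thesis unfolding kos_def by (rule linearI) (simp_all add: add_divide_distrib diff_divide_distrib algebra_simps)
qed

text \<open>Unimodularity. The trace does not depend on the basis, and in the Euclidean standard
  basis every summand vanishes because a cross product is orthogonal to its factors.\<close>

lemma trace_lbr:
  assumes s: "sprod B" and o: "orthonormal6 B e"
  shows "(\<Sum>i<6. B (lbr (e i) x) (e i)) = 0"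
proof -
  have b: "bilinear B" and sym: "\<And>x y. B x y = B y x" using s by (auto simp: sprod_def simp del: split_paired_All)
  have "B (lbr (e i) x) (e i) = (\<Sum>u\<in>Basis. (e i \<bullet> u) * B (lbr u x) (e i))" for i
  proof -
    have l: "linear (\<lambda>y. B (lbr y x) (e i))"
      using linear_compose[OF lbr_linear(1)[of x] bil_lin(1)[OF b, of "e i"]] by (simp add: o_def)
    show ?thesis using lin_sum[OF l, where S=Basis and c="\<lambda>u. e i \<bullet> u" and x="\<lambda>u. u"] by (simp add: euclidean_representation)
  qed
  then have "(\<Sum>i<6. B (lbr (e i) x) (e i)) = (\<Sum>u\<in>Basis. \<Sum>i<6. (e i \<bullet> u) * B (lbr u x) (e i))"
    by (simp add: sum.swap[of _ Basis])
  also have "\<dots> = (\<Sum>u\<in>Basis. lbr u x \<bullet> u)"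
  proof (rule sum.cong[OF refl])
    fix u :: vv
    have "linear (\<lambda>y. y \<bullet> u)" by (rule linearI) (simp_all add: inner_add_left)
    from orthonormal6_parseval[OF b o this, of "lbr u x"]
    show "(\<Sum>i<6. (e i \<bullet> u) * B (lbr u x) (e i)) = lbr u x \<bullet> u" by (simp add: mult.commute)
  qed
  also have "\<dots> = 0" by (rule sum.neutral) (auto simp: lbr_def inner_prod_def dot_cross_self)
  finally show ?thesis .
qed

text \<open>The left side is the trace defining the Ricci tensor, with the second covariant
  derivatives already resolved by metric compatibility and Parseval's identity.\<close>

lemma koszul_ricci:
  assumes s: "sprod B" and o: "orthonormal6 B e"
  shows "(\<Sum>i<6. - (\<Sum>k<6. kos B y z (e k) * kos B (e i) (e i) (e k)) + (\<Sum>k<6. kos B (e i) z (e k) * kos B y (e i) (e k))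
      - kos B (lbr (e i) y) z (e i)) = ric B (\<lambda>_. 1) e y z"
proof -
  have b: "bilinear B" and sym: "\<And>x y. B x y = B y x" using s by (auto simp: sprod_def simp del: split_paired_All)
  define c where "c a b k = B (lbr a b) k" for a b k
  have skew: "c a b k = - c b a k" for a b k
    unfolding c_def by (subst lbr_skew) (simp add: bilinear_lneg[OF b])
  have t1: "(\<Sum>i<6. \<Sum>k<6. kos B y z (e k) * kos B (e i) (e i) (e k)) = 0"
  proof -
    have "kos B (e i) (e i) (e k) = - B (lbr (e i) (e k)) (e i)" for i k
      using skew[of "e i" "e i" "e k"] by (simp add: kos_def c_def)
    then have "(\<Sum>i<6. kos B (e i) (e i) (e k)) = 0" for k using trace_lbr[OF s o, of "e k"] by (simp add: sum_negf)
    then have "(\<Sum>k<6. kos B y z (e k) * (\<Sum>i<6. kos B (e i) (e i) (e k))) = 0" by simp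
    then show ?thesis by (subst sum.swap) (simp add: sum_distrib_left)
  qed
  have t3: "kos B (lbr (e i) y) z (e i) = (\<Sum>k<6. c (e i) y (e k) * kos B (e k) z (e i))" for i
    using orthonormal6_parseval[OF b o kos_linear1[OF b], of "lbr (e i) y"] by (simp add: c_def)
  \<comment> \<open>The symmetric and antisymmetric parts in \<open>i\<close> and \<open>k\<close>.
    Mixed products cancel on summation; the products of the \<open>A\<close> give the first sum in
    \<open>ric\<close>, those of the \<open>S\<close> the second, including the Killing
    form.\<close>
  define S A where "S x i k = c x (e i) (e k) + c x (e k) (e i)" and "A x i k = c (e i) (e k) x" for x i k
  have Ssym: "S x k i = S x i k" and Aanti: "A x k i = - A x i k" for x i k
    using skew[of "e k" "e i" x] by (simp_all add: S_def A_def)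
  have K1: "kos B (e i) z (e k) = - (S z i k + A z i k) / 2" for i k
    using skew[of "e i" z "e k"] by (simp add: kos_def S_def A_def flip: c_def)
  have K2: "kos B y (e i) (e k) + c y (e k) (e i) = (S y i k - A y i k) / 2" for i k
    by (simp add: kos_def S_def A_def field_simps flip: c_def)
  have "(\<Sum>i<6. \<Sum>k<6. kos B (e i) z (e k) * kos B y (e i) (e k)) - (\<Sum>i<6. \<Sum>k<6. c (e i) y (e k) * kos B (e k) z (e i))
    = (\<Sum>i<6. \<Sum>k<6. kos B (e i) z (e k) * kos B y (e i) (e k)) - (\<Sum>i<6. \<Sum>k<6. c (e k) y (e i) * kos B (e i) z (e k))"
    by (subst sum.swap[of "\<lambda>i k. c (e i) y (e k) * kos B (e k) z (e i)"]) simp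
  also have "\<dots> = (\<Sum>i<6. \<Sum>k<6. kos B (e i) z (e k) * (kos B y (e i) (e k) + c y (e k) (e i)))"
    using skew[of _ y] by (simp add: algebra_simps sum.distrib sum_negf)
  also have "\<dots> = (\<Sum>i<6. \<Sum>k<6. (A z i k * A y i k - S z i k * S y i k) / 4 + (S z i k * A y i k - A z i k * S y i k) / 4)"
    unfolding K1 K2 by (intro sum.cong refl) (simp add: field_simps)
  also have "\<dots> = (\<Sum>i<6. \<Sum>k<6. (A z i k * A y i k - S z i k * S y i k) / 4) + (\<Sum>i<6. \<Sum>k<6. (S z i k * A y i k - A z i k * S y i k) / 4)"
    by (simp add: sum.distrib)
  also have "(\<Sum>i<6. \<Sum>k<6. (S z i k * A y i k - A z i k * S y i k) / 4) = 0"
  proof -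
    define T where "T = (\<Sum>i<6. \<Sum>k<6. (S z i k * A y i k - A z i k * S y i k) / 4)"
    have "T = (\<Sum>i<6. \<Sum>k<6. (S z k i * A y k i - A z k i * S y k i) / 4)" unfolding T_def by (rule sum.swap)
    also have "\<dots> = (\<Sum>i<6. \<Sum>k<6. - ((S z i k * A y i k - A z i k * S y i k) / 4))"
    proof (intro sum.cong refl)
      fix i k
      show "(S z k i * A y k i - A z k i * S y k i) / 4 = - ((S z i k * A y i k - A z i k * S y i k) / 4)"
        unfolding Ssym[of z k i] Ssym[of y k i] Aanti[of z k i] Aanti[of y k i] by (simp add: field_simps)
    qed
    also have "\<dots> = - T" unfolding T_def by (simp only: sum_negf)
    finally show ?thesis unfolding T_def by simp
  qed
  also have "(\<Sum>i<6. \<Sum>k<6. (A z i k * A y i k - S z i k * S y i k) / 4)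
    = (\<Sum>i<6. \<Sum>k<6. A y i k * A z i k) / 4 - (\<Sum>i<6. \<Sum>k<6. S y i k * S z i k) / 4"
    by (simp add: sum_subtractf diff_divide_distrib sum_divide_distrib mult.commute)
  also have "(\<Sum>i<6. \<Sum>k<6. S y i k * S z i k)
     = 2 * (\<Sum>i<6. B (lbr y (e i)) (lbr z (e i)) + B (lbr y (lbr z (e i))) (e i))"
  proof -
    have p1: "(\<Sum>k<6. c y (e i) (e k) * c z (e i) (e k)) = B (lbr y (e i)) (lbr z (e i))" for i
      using orthonormal6_parseval[OF b o bil_lin(2)[OF b], of "lbr z (e i)" "lbr y (e i)"]
      by (simp add: c_def mult.commute sym[of "lbr y (e i)" "lbr z (e i)"])
    have l: "linear (\<lambda>w. B (lbr y w) (e i))" for i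
      using linear_compose[OF lbr_linear(2)[of y] bil_lin(1)[OF b, of "e i"]] by (simp add: o_def)
    have p2: "(\<Sum>k<6. c z (e i) (e k) * c y (e k) (e i)) = B (lbr y (lbr z (e i))) (e i)" for i
      using orthonormal6_parseval[OF b o l[of i], of "lbr z (e i)"] by (simp add: c_def)
    have "(\<Sum>i<6. \<Sum>k<6. S y i k * S z i k) = (\<Sum>i<6. \<Sum>k<6. c y (e i) (e k) * c z (e i) (e k)) + (\<Sum>i<6. \<Sum>k<6. c y (e k) (e i) * c z (e k) (e i))
       + ((\<Sum>i<6. \<Sum>k<6. c z (e i) (e k) * c y (e k) (e i)) + (\<Sum>i<6. \<Sum>k<6. c z (e k) (e i) * c y (e i) (e k)))"
      unfolding S_def by (simp only: sum.distrib[symmetric]) (intro sum.cong refl, simp add: algebra_simps)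
    also have "(\<Sum>i<6. \<Sum>k<6. c y (e k) (e i) * c z (e k) (e i)) = (\<Sum>i<6. \<Sum>k<6. c y (e i) (e k) * c z (e i) (e k))" by (rule sum.swap)
    also have "(\<Sum>i<6. \<Sum>k<6. c z (e k) (e i) * c y (e i) (e k)) = (\<Sum>i<6. \<Sum>k<6. c z (e i) (e k) * c y (e k) (e i))" by (rule sum.swap)
    finally show ?thesis unfolding p1 p2 by (simp add: sum.distrib)
  qed
  finally have main: "(\<Sum>i<6. \<Sum>k<6. kos B (e i) z (e k) * kos B y (e i) (e k)) - (\<Sum>i<6. \<Sum>k<6. c (e i) y (e k) * kos B (e k) z (e i))
    = ric B (\<lambda>_. 1) e y z"
    by (simp add: ric_def A_def c_def)
  show ?thesis
    using main t1 unfolding t3 by (simp add: sum.distrib sum_subtractf sum_negf)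
qed

lemma adapted_orthonormal6:
  assumes s: "sprod B" and a: "adapted B m v"
  shows "orthonormal6 B (\<lambda>i. sqrt (m i) *\<^sub>R v i)" "ric B (\<lambda>_. 1) (\<lambda>i. sqrt (m i) *\<^sub>R v i) x y = ric B m v x y"
proof -
  have b: "bilinear B" using s by (auto simp: sprod_def)
  have m: "0 < m i" if "i < 6" for i using a that by (simp add: adapted_def)
  then show "orthonormal6 B (\<lambda>i. sqrt (m i) *\<^sub>R v i)"
    using a by (fastforce simp: orthonormal6_def adapted_def bilinear_lmul[OF b] bilinear_rmul[OF b])
  note l = linear_scale[OF lbr_linear(1)] linear_scale[OF lbr_linear(2)] bilinear_lmul[OF b] bilinear_rmul[OF b]
  have m2: "sqrt (m i) * sqrt (m i) = m i" if "i < 6" for i using m[OF that] by simp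
  have A: "B (lbr (sqrt (m i) *\<^sub>R v i) (sqrt (m j) *\<^sub>R v j)) x * B (lbr (sqrt (m i) *\<^sub>R v i) (sqrt (m j) *\<^sub>R v j)) y
    = m i * m j * B (lbr (v i) (v j)) x * B (lbr (v i) (v j)) y" if "i < 6" "j < 6" for i j
  proof -
    have "B (lbr (sqrt (m i) *\<^sub>R v i) (sqrt (m j) *\<^sub>R v j)) x * B (lbr (sqrt (m i) *\<^sub>R v i) (sqrt (m j) *\<^sub>R v j)) y
      = (sqrt (m i) * sqrt (m i)) * (sqrt (m j) * sqrt (m j)) * B (lbr (v i) (v j)) x * B (lbr (v i) (v j)) y"
      by (simp only: l real_scaleR_def mult_ac)
    then show ?thesis by (simp only: m2[OF that(1)] m2[OF that(2)])
  qed
  have C: "B (lbr x (sqrt (m i) *\<^sub>R v i)) (lbr y (sqrt (m i) *\<^sub>R v i)) + B (lbr x (lbr y (sqrt (m i) *\<^sub>R v i))) (sqrt (m i) *\<^sub>R v i)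
    = m i * (B (lbr x (v i)) (lbr y (v i)) + B (lbr x (lbr y (v i))) (v i))" if "i < 6" for i
  proof -
    have "B (lbr x (sqrt (m i) *\<^sub>R v i)) (lbr y (sqrt (m i) *\<^sub>R v i)) + B (lbr x (lbr y (sqrt (m i) *\<^sub>R v i))) (sqrt (m i) *\<^sub>R v i)
      = (sqrt (m i) * sqrt (m i)) * (B (lbr x (v i)) (lbr y (v i)) + B (lbr x (lbr y (v i))) (v i))"
      by (simp only: l real_scaleR_def mult_ac distrib_left)
    then show ?thesis by (simp only: m2[OF that])
  qed
  show "ric B (\<lambda>_. 1) (\<lambda>i. sqrt (m i) *\<^sub>R v i) x y = ric B m v x y"
    unfolding ric_def mult_1 using A C by (simp cong: sum.cong_simp)
qed

section \<open>Left-invariant geometry of the group\<close>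

lemma qmult_bilinear: "bilinear qmult"
  unfolding bilinear_def
  by (auto intro!: linearI simp: qmult_def prod_eq_iff inner_add_left inner_add_right cross_add_left cross_add_right
      cross_mult_left cross_mult_right algebra_simps scaleR_add_left scaleR_add_right)

lemma gmult_bilinear: "bilinear gmult"
  unfolding bilinear_def gmult_def
  using bilinear_ladd[OF qmult_bilinear] bilinear_radd[OF qmult_bilinear] bilinear_lmul[OF qmult_bilinear] bilinear_rmul[OF qmult_bilinear]
  by (auto intro!: linearI)

lemma qmult_assoc: "qmult (qmult a b) c = qmult a (qmult b c)"
  by (simp add: qmult_def prod_eq_iff vec_eq_iff forall_3 cross3_def inner_vec_def sum_3 algebra_simps)

lemma gmult_assoc: "gmult (gmult a b) c = gmult a (gmult b c)"
  by (simp add: gmult_def qmult_assoc)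

lemma qmult_inner: "qmult a x \<bullet> qmult a y = (a \<bullet> a) * (x \<bullet> y)" "qmult x a \<bullet> qmult y a = (a \<bullet> a) * (x \<bullet> y)"
  by (simp_all add: qmult_def inner_prod_def inner_vec_def sum_3 cross3_def algebra_simps)

lemma qmult_cnj: "qmult a (qcnj a) = (a \<bullet> a, 0)" "qmult (qcnj a) a = (a \<bullet> a, 0)"
  by (simp_all add: qmult_def qcnj_def inner_prod_def power2_eq_square)

lemma qmult_one: "qmult (1,0) a = a" "qmult a (1,0) = a"
  by (simp_all add: qmult_def prod_eq_iff)

lemma S3xS3_iff: "p \<in> S3xS3 \<longleftrightarrow> fst p \<bullet> fst p = 1 \<and> snd p \<bullet> snd p = 1"
  by (cases p) (simp add: S3xS3_def norm_eq_1)

lemma gmult_one: "gmult gone a = a" "gmult a gone = a"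
  by (simp_all add: gmult_def gone_def qmult_one)

lemma gmult_ginv: "p \<in> S3xS3 \<Longrightarrow> gmult p (ginv p) = gone" "p \<in> S3xS3 \<Longrightarrow> gmult (ginv p) p = gone"
  by (simp_all add: gmult_def ginv_def qmult_cnj S3xS3_iff gone_def)

lemma gone_S3: "gone \<in> S3xS3" by (simp add: S3xS3_iff gone_def)

lemma ginv_S3: "p \<in> S3xS3 \<Longrightarrow> ginv p \<in> S3xS3" by (simp add: S3xS3_iff ginv_def qcnj_def inner_prod_def)

lemma gmult_S3: "a \<in> S3xS3 \<Longrightarrow> b \<in> S3xS3 \<Longrightarrow> gmult a b \<in> S3xS3" by (simp add: S3xS3_iff gmult_def qmult_inner)

text \<open>The factor \<open>1/2\<close> turns the commutator of quaternions into the cross product.\<close>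

definition io :: "vv \<Rightarrow> quat \<times> quat" where "io x = ((0, (1/2) *\<^sub>R fst x), (0, (1/2) *\<^sub>R snd x))"

lemma io_linear: "linear io"
  by (auto intro!: linearI simp: io_def scaleR_add_right)

lemma io_bracket: "gmult (io x) (io y) - gmult (io y) (io x) = io (lbr x y)"
proof -
  have c: "cross3 b a = - cross3 a b" for a b by (rule cross_skew)
  show ?thesis
    by (simp add: gmult_def qmult_def io_def lbr_def prod_eq_iff inner_commute cross_mult_left cross_mult_right c[of "fst x"] c[of "snd x"]
        flip: scaleR_add_left scaleR_diff_left)
qed

section \<open>Calculus on embedded submanifolds\<close>

lemma has_derivative_tangent:
  fixes f :: "'a::euclidean_space \<Rightarrow> 'b::euclidean_space"
  assumes f: "(f has_derivative D) (at p within M)" and \<gamma>: "\<forall>t. \<gamma> t \<in> M" "\<gamma> 0 = p" "(\<gamma> has_vector_derivative v) (at (0::real))"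
  shows "((\<lambda>t. f (\<gamma> t)) has_vector_derivative D v) (at 0)"
proof -
  have "(f has_derivative D) (at (\<gamma> 0) within (\<gamma> ` UNIV))"
    by (rule has_derivative_subset[of _ _ _ M]) (use f \<gamma> in auto)
  from has_derivative_in_compose[OF \<gamma>(3)[unfolded has_vector_derivative_def] this]
  show ?thesis
    using has_derivative_bounded_linear[OF f] unfolding has_vector_derivative_def
    by (simp add: linear_simps(5) bounded_linear.linear linear_scale)
qed

text \<open>A curve in \<open>M\<close> sees only values on \<open>M\<close>, so any differentiable
  ambient extension computes the differential on tangent vectors, whichever derivative
  \<open>frechet_derivative\<close> chooses.\<close>

lemma differential_eqI:
  fixes F :: "'a::euclidean_space \<Rightarrow> 'b::euclidean_space"
  assumes F: "(F has_derivative F') (at p)" and eq: "\<And>x. x \<in> M \<Longrightarrow> f x = F x" and v: "v \<in> tangent_space M p"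
  shows "differential M f p v = F' v"
proof -
  obtain \<gamma> :: "real \<Rightarrow> 'a" where \<gamma>: "\<forall>t. \<gamma> t \<in> M" "\<gamma> 0 = p" "(\<gamma> has_vector_derivative v) (at 0)"
    using v unfolding tangent_space_def by blast
  have p: "p \<in> M" using \<gamma> by auto
  have f: "(f has_derivative F') (at p within M)"
    by (rule has_derivative_transform[OF p _ has_derivative_at_withinI[OF F]]) (use eq in simp)
  then have "(f has_derivative frechet_derivative f (at p within M)) (at p within M)"
    using frechet_derivative_works differentiable_def by blast
  from has_derivative_tangent[OF this \<gamma>] has_derivative_tangent[OF f \<gamma>]
  show ?thesis unfolding differential_def by (rule vector_derivative_unique_at)
qed

lemma differential_linear:
  fixes F :: "'a::euclidean_space \<Rightarrow> 'b::euclidean_space"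
  assumes "linear F" "\<And>x. x \<in> M \<Longrightarrow> f x = F x" "v \<in> tangent_space M p"
  shows "differential M f p v = F v"
  by (rule differential_eqI[OF linear_imp_has_derivative[OF assms(1)] assms(2,3)])

lemma Ck_on_const: "Ck_on k UNIV (\<lambda>x. c)"
  by (induction k arbitrary: c) (auto simp: frechet_derivative_const)

lemma Ck_on_affine:
  fixes f :: "'a::euclidean_space \<Rightarrow> 'b::euclidean_space"
  assumes "linear f" shows "Ck_on k UNIV (\<lambda>x. f x + c)"
proof (cases k)
  case 0 then show ?thesis using assms by (simp add: linear_continuous_on linear_linear continuous_on_add)
next
  case (Suc n)
  have d: "((\<lambda>x. f x + c) has_derivative f) (at x)" for x
    using has_derivative_add[OF linear_imp_has_derivative[OF assms] has_derivative_const] by simp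
  have "frechet_derivative (\<lambda>x. f x + c) (at x) = f" for x using frechet_derivative_at[OF d] by simp
  then show ?thesis using d Suc Ck_on_const by (auto simp: differentiable_def)
qed

lemma quadratic_has_derivative:
  fixes f :: "'a::euclidean_space \<Rightarrow> 'b::euclidean_space"
  assumes f: "linear f" and b: "bilinear b"
  shows "((\<lambda>x. f x + b x x) has_derivative (\<lambda>h. f h + (b x h + b h x))) (at x)"
proof -
  have "bounded_bilinear b" using b bilinear_conv_bounded_bilinear by blast
  from bounded_bilinear.FDERIV[OF this has_derivative_ident has_derivative_ident]
  show ?thesis by (intro has_derivative_add linear_imp_has_derivative[OF f])
qed

lemma Ck_on_quadratic:
  fixes f :: "'a::euclidean_space \<Rightarrow> 'b::euclidean_space"
  assumes f: "linear f" and b: "bilinear b" shows "Ck_on k UNIV (\<lambda>x. f x + b x x)"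
proof (cases k)
  case 0
  then show ?thesis using bilinear_continuous_on_compose[OF continuous_on_id continuous_on_id b] f
    by (simp add: linear_continuous_on linear_linear continuous_on_add)
next
  case (Suc n)
  note d = quadratic_has_derivative[OF f b]
  have "frechet_derivative (\<lambda>x. f x + b x x) (at x) = (\<lambda>h. f h + (b x h + b h x))" for x using frechet_derivative_at[OF d] by simp
  moreover have "Ck_on n UNIV (\<lambda>x. f h + (b x h + b h x))" for h
  proof -
    have "linear (\<lambda>x. b x h + b h x)" by (rule linear_compose_add) (use b in \<open>simp_all add: bilinear_def\<close>)
    from Ck_on_affine[OF this, of n "f h"] show ?thesis by (simp add: add.commute)
  qed
  ultimately show ?thesis using d Suc by (auto simp: differentiable_def)
qed

lemma smooth_linear: "linear F \<Longrightarrow> (\<And>x. x \<in> M \<Longrightarrow> f x = F x) \<Longrightarrow> smooth M f"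
  unfolding smooth_def using Ck_on_affine[of F _ 0] by (intro exI[of _ UNIV] exI[of _ F]) simp

lemma smooth_quadratic: "linear l \<Longrightarrow> bilinear b \<Longrightarrow> (\<And>x. x \<in> M \<Longrightarrow> f x = l x + b x x) \<Longrightarrow> smooth M f"
  unfolding smooth_def by (rule exI[of _ UNIV], rule exI[of _ "\<lambda>x. l x + b x x"]) (simp add: Ck_on_quadratic)

section \<open>Tangent spaces and left-invariant vector fields\<close>

lemma tangent_gone: "io x \<in> tangent_space S3xS3 gone"
proof -
  define h where "h u t = (1 / sqrt (1 + t^2 * (u \<bullet> u))) *\<^sub>R (1::real, t *\<^sub>R u)" for u :: "real^3" and t :: real
  have pos: "0 < 1 + t^2 * (u \<bullet> u)" for u :: "real^3" and t by (simp add: add_pos_nonneg)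
  have hn: "h u t \<bullet> h u t = 1" for u t
  proof -
    have "h u t \<bullet> h u t = (1 / sqrt (1 + t^2 * (u \<bullet> u)))^2 * (1 + t^2 * (u \<bullet> u))"
      by (simp add: h_def inner_prod_def power2_eq_square algebra_simps add_divide_distrib)
    then show ?thesis using pos[of t u] by (simp add: power_divide)
  qed
  have hd: "(h u has_vector_derivative (0, u)) (at 0)" for u
  proof -
    have "((\<lambda>t. 1 / sqrt (1 + t^2 * (u \<bullet> u))) has_real_derivative 0) (at 0)"
      by (auto intro!: derivative_eq_intros)
    moreover have "((\<lambda>t. (1::real, t *\<^sub>R u)) has_vector_derivative (0, u)) (at 0)"
      by (auto intro!: derivative_eq_intros has_vector_derivative_Pair)
    ultimately show ?thesis
      unfolding h_def using has_vector_derivative_scaleR[of "\<lambda>t. 1 / sqrt (1 + t^2 * (u \<bullet> u))" 0 0 UNIV "\<lambda>t. (1::real, t *\<^sub>R u)" "(0,u)"] by simp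
  qed
  show ?thesis
    unfolding tangent_space_def mem_Collect_eq
    by (rule exI[of _ "\<lambda>t. (h ((1/2) *\<^sub>R fst x) t, h ((1/2) *\<^sub>R snd x) t)"])
      (auto simp: S3xS3_iff hn io_def gone_def intro!: has_vector_derivative_Pair hd, simp_all add: h_def)
qed

lemma tangent_gmult:
  assumes a: "a \<in> S3xS3" and v: "v \<in> tangent_space S3xS3 p"
  shows "gmult a v \<in> tangent_space S3xS3 (gmult a p)"
proof -
  obtain \<gamma> :: "real \<Rightarrow> _" where \<gamma>: "\<forall>t. \<gamma> t \<in> S3xS3" "\<gamma> 0 = p" "(\<gamma> has_vector_derivative v) (at 0)"
    using v unfolding tangent_space_def by blast
  have l: "linear (gmult a)" using gmult_bilinear unfolding bilinear_def by blast
  have "((\<lambda>t. gmult a (\<gamma> t)) has_vector_derivative gmult a v) (at 0)"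
    by (rule has_derivative_tangent[OF linear_imp_has_derivative[OF l]]) (use \<gamma> in auto)
  then show ?thesis unfolding tangent_space_def mem_Collect_eq
    by (intro exI[of _ "\<lambda>t. gmult a (\<gamma> t)"]) (use \<gamma> a gmult_S3 in auto)
qed

lemma tangent_io: "p \<in> S3xS3 \<Longrightarrow> gmult p (io x) \<in> tangent_space S3xS3 p"
  using tangent_gmult[OF _ tangent_gone, of p x] by (simp add: gmult_one)

lemma lie_alg_eq: "lie_alg = range io"
proof -
  have "v \<in> range io" if v: "v \<in> tangent_space S3xS3 gone" for v
  proof -
    obtain \<gamma> :: "real \<Rightarrow> _" where \<gamma>: "\<forall>t. \<gamma> t \<in> S3xS3" "\<gamma> 0 = gone" "(\<gamma> has_vector_derivative v) (at 0)"
      using v unfolding tangent_space_def by blast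
    have f: "fst v \<bullet> fst gone = 0" "snd v \<bullet> snd gone = 0"
    proof -
      have q: "bilinear (\<lambda>x y. fst x \<bullet> fst (y::quat \<times> quat))" "bilinear (\<lambda>x y. snd x \<bullet> snd (y::quat \<times> quat))"
        by (auto simp: bilinear_def inner_add_left inner_add_right algebra_simps intro!: linearI)
      have d: "((\<lambda>x. b x x) has_derivative (\<lambda>h. b gone h + b h gone)) (at gone within S3xS3)"
        if "bilinear b" for b :: "quat \<times> quat \<Rightarrow> quat \<times> quat \<Rightarrow> real"
        using bounded_bilinear.FDERIV[OF bilinear_conv_bounded_bilinear[THEN iffD1, OF that] has_derivative_ident has_derivative_ident] by simp
      have c: "((\<lambda>t. 1::real) has_vector_derivative 0) (at 0)" by simp
      have 1: "fst (\<gamma> t) \<bullet> fst (\<gamma> t) = 1" "snd (\<gamma> t) \<bullet> snd (\<gamma> t) = 1" for t using \<gamma>(1) S3xS3_iff by blast+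
      have "fst gone \<bullet> fst v + fst v \<bullet> fst gone = 0"
        using vector_derivative_unique_at[OF has_derivative_tangent[OF d[OF q(1)] \<gamma>, unfolded 1] c] .
      moreover have "snd gone \<bullet> snd v + snd v \<bullet> snd gone = 0"
        using vector_derivative_unique_at[OF has_derivative_tangent[OF d[OF q(2)] \<gamma>, unfolded 1] c] .
      ultimately show "fst v \<bullet> fst gone = 0" "snd v \<bullet> snd gone = 0" by (simp_all add: inner_commute)
    qed
    have "v = io (2 *\<^sub>R snd (fst v), 2 *\<^sub>R snd (snd v))"
      using f by (simp add: io_def gone_def prod_eq_iff inner_prod_def)
    then show ?thesis by blast
  qed
  then show ?thesis using tangent_gone by (auto simp: lie_alg_def)
qed

lemma tangent_space_eq:
  assumes p: "p \<in> S3xS3"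
  shows "tangent_space S3xS3 p = range (\<lambda>x. gmult p (io x))"
proof -
  have "v \<in> range (\<lambda>x. gmult p (io x))" if v: "v \<in> tangent_space S3xS3 p" for v
  proof -
    have "gmult (ginv p) v \<in> lie_alg"
      using tangent_gmult[OF ginv_S3[OF p] v] gmult_ginv[OF p] by (simp add: lie_alg_def)
    then obtain x where "gmult (ginv p) v = io x" by (auto simp: lie_alg_eq)
    then have "gmult p (io x) = gmult (gmult p (ginv p)) v" by (simp add: gmult_assoc)
    then show ?thesis using gmult_ginv[OF p] by (auto simp: gmult_one)
  qed
  then show ?thesis using tangent_io[OF p] by auto
qed

definition linv :: "vv \<Rightarrow> quat \<times> quat \<Rightarrow> quat \<times> quat" where "linv x p = gmult p (io x)"

text \<open>A predicate rather than equality with \<open>linv x\<close>, because the bracket of two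
  such fields is controlled only at points of the group.\<close>

definition is_linv :: "(quat \<times> quat \<Rightarrow> quat \<times> quat) \<Rightarrow> vv \<Rightarrow> bool" where
  "is_linv X x \<longleftrightarrow> X \<in> vector_fields S3xS3 \<and> (\<forall>p\<in>S3xS3. X p = gmult p (io x))"

lemma gmult_linear: "linear (gmult a)" "linear (\<lambda>q. gmult q a)"
  using gmult_bilinear unfolding bilinear_def by blast+

lemma is_linvI:
  assumes "\<And>p. p \<in> S3xS3 \<Longrightarrow> X p = gmult p (io x)"
  shows "is_linv X x"
  unfolding is_linv_def vector_fields_def mem_Collect_eq
  using smooth_linear[OF gmult_linear(2) assms] tangent_io assms by simp

lemma is_linv_linv: "is_linv (linv x) x"
  by (rule is_linvI) (simp add: linv_def)

lemma is_linv_bracket: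
  assumes "is_linv X x" "is_linv Y y"
  shows "is_linv (vf_bracket S3xS3 X Y) (lbr x y)"
proof (rule is_linvI)
  fix p assume p: "p \<in> S3xS3"
  have d: "differential S3xS3 Y p (X p) = gmult (gmult p (io x)) (io y)" if "is_linv X x" "is_linv Y y" for X Y x y
    using differential_linear[OF gmult_linear(2)[of "io y"], of S3xS3 Y "X p" p] that p tangent_io[OF p, of x]
    by (simp add: is_linv_def)
  show "vf_bracket S3xS3 X Y p = gmult p (io (lbr x y))"
    unfolding vf_bracket_def d[OF assms] d[OF assms(2,1)] gmult_assoc io_bracket[symmetric]
    by (simp add: linear_diff[OF gmult_linear(1)])
qed

lemma left_invariant_value:
  assumes "left_invariant g" "p \<in> S3xS3"
  shows "g p (gmult p (io x)) (gmult p (io y)) = g gone (io x) (io y)"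
proof -
  have "differential S3xS3 (gmult p) gone (io z) = gmult p (io z)" for z
    by (rule differential_linear[OF gmult_linear(1) _ tangent_gone]) simp
  moreover have "g (gmult p gone) (differential S3xS3 (gmult p) gone (io x)) (differential S3xS3 (gmult p) gone (io y)) = g gone (io x) (io y)"
    using assms tangent_gone gone_S3 unfolding left_invariant_def by blast
  ultimately show ?thesis by (simp add: gmult_one)
qed

section \<open>The Einstein condition on the Lie algebra\<close>

lemma sprod_of_metric:
  assumes "scalar_product_on (tangent_space S3xS3 gone) (g gone)"
  shows "sprod (\<lambda>x y. g gone (io x) (io y))"
proof -
  note s = assms[unfolded scalar_product_on_def]
  have t: "io x \<in> tangent_space S3xS3 gone" for x by (rule tangent_gone)
  have add: "g gone (io (x + y)) (io z) = g gone (io x) (io z) + g gone (io y) (io z)" for x y z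
    using s t by (simp add: linear_add[OF io_linear])
  have scale: "g gone (io (c *\<^sub>R x)) (io z) = c * g gone (io x) (io z)" for c x z
    using s t by (simp add: linear_scale[OF io_linear])
  have sym: "g gone (io x) (io y) = g gone (io y) (io x)" for x y using s t by blast
  have pos: "0 < g gone (io x) (io x)" if "x \<noteq> 0" for x
  proof -
    have "io x \<noteq> 0" using that by (auto simp: io_def prod_eq_iff)
    then show ?thesis using s t by blast
  qed
  show ?thesis
    unfolding sprod_def bilinear_def
    using add scale sym pos add[of _ _ , unfolded sym[of "_ + _"]]
    by (intro conjI allI impI linearI) (simp_all del: split_paired_All add: sym[of "_ + _"] sym[of "_ *\<^sub>R _"], (metis sym)?)
qed

text \<open>The Ricci equation is evaluated at \<open>gone\<close> on left-invariant fields. That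
  \<open>D X Y\<close> is itself left-invariant is never shown: its products with left-invariant
  fields are given by \<open>koszul\<close>, and Parseval's identity does the rest.\<close>

lemma einst_of_metric:
  assumes em: "einstein_metric S3xS3 g" and li: "left_invariant g"
  shows "einst (\<lambda>x y. g gone (io x) (io y))"
proof -
  define M where "M = S3xS3"
  define B where "B x y = g gone (io x) (io y)" for x y
  obtain lam D where lc: "levi_civita_connection M g D"
    and ric0: "\<forall>p\<in>M. \<forall>Y\<in>vector_fields M. \<forall>Z\<in>vector_fields M. \<forall>n. \<forall>E :: nat \<Rightarrow> quat \<times> quat \<Rightarrow> quat \<times> quat.
        (\<forall>i<n. E i \<in> vector_fields M) \<longrightarrow>
        (\<forall>i<n. \<forall>j<n. g p (E i p) (E j p) = (if i = j then 1 else 0)) \<longrightarrow>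
        span ((\<lambda>i. E i p) ` {..<n}) = tangent_space M p \<longrightarrow>
        lam * g p (Y p) (Z p) = (\<Sum>i<n. g p (curvature M D (E i) Y Z p) (E i p))"
    using em unfolding einstein_metric_def has_ricci_tensor_def M_def by (elim conjE exE)
  note ric = ric0[rule_format]
  have sp: "scalar_product_on (tangent_space M p) (g p)" if "p \<in> M" for p
    using em that unfolding einstein_metric_def riemannian_metric_def M_def by blast
  have goneM: "gone \<in> M" by (simp add: M_def gone_S3)
  have s: "sprod B" unfolding B_def using sprod_of_metric sp[OF goneM] by (simp add: M_def)
  note b = sprod_def[THEN iffD1, OF s, THEN conjunct1]
  have sym: "B x y = B y x" for x y using s unfolding sprod_def by blast
  have gB: "g p (X p) (Y p) = B x y" if "p \<in> M" "is_linv X x" "is_linv Y y" for p X Y x y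
    using that left_invariant_value[OF li] by (simp add: is_linv_def B_def M_def)
  have LFv: "X \<in> vector_fields M" if "is_linv X x" for X x using that by (simp add: is_linv_def M_def)
  have Dv: "D X Y \<in> vector_fields M" if "X \<in> vector_fields M" "Y \<in> vector_fields M" for X Y
    using lc that unfolding levi_civita_connection_def affine_connection_def by blast
  have tan: "X p \<in> tangent_space M p" if "X \<in> vector_fields M" "p \<in> M" for X p
    using that by (simp add: vector_fields_def)
  have sub: "subspace (tangent_space M p)" if "p \<in> M" for p
  proof -
    have "linear (\<lambda>x. gmult p (io x))" using linear_compose[OF io_linear gmult_linear(1)[of p]] by (simp add: o_def)
    then show ?thesis using tangent_space_eq[of p] that linear_subspace_image[of _ UNIV] by (simp add: M_def)
  qed
  have gsym: "g p u v = g p v u" if "p \<in> M" "u \<in> tangent_space M p" "v \<in> tangent_space M p" for p u v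
    using sp[OF that(1)] that unfolding scalar_product_on_def by blast
  have gdiff: "g p (u - v) w = g p u w - g p v w"
    if p: "p \<in> M" and t: "u \<in> tangent_space M p" "v \<in> tangent_space M p" "w \<in> tangent_space M p" for p u v w
  proof -
    have "u - v \<in> tangent_space M p" using subspace_diff[OF sub[OF p]] t by blast
    then have "g p ((u - v) + v) w = g p (u - v) w + g p v w"
      using sp[OF p] t unfolding scalar_product_on_def by blast
    then show ?thesis by simp
  qed
  have metric: "differential M (\<lambda>q. g q (Y q) (Z q)) p (X p) = g p (D X Y p) (Z p) + g p (Y p) (D X Z p)"
    if "X \<in> vector_fields M" "Y \<in> vector_fields M" "Z \<in> vector_fields M" "p \<in> M" for X Y Z p
    using lc that unfolding levi_civita_connection_def by blast
  have const: "differential M f p v = 0" if "\<And>q. q \<in> M \<Longrightarrow> f q = c" "v \<in> tangent_space M p" for f :: "_ \<Rightarrow> real" and p v c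
    by (rule differential_eqI[OF has_derivative_const that])
  have skew: "g p (D X Y p) (Z p) = - g p (D X Z p) (Y p)" if "is_linv X x" "is_linv Y y" "is_linv Z z" "p \<in> M" for X Y Z x y z p
  proof -
    have "0 = g p (D X Y p) (Z p) + g p (Y p) (D X Z p)"
      using metric[OF LFv LFv LFv, OF that] const[of "\<lambda>q. g q (Y q) (Z q)" "B y z" "X p" p] gB[OF _ that(2,3)] tan[OF LFv[OF that(1)] that(4)] by simp
    then show ?thesis using gsym[OF that(4) tan[OF LFv[OF that(2)] that(4)] tan[OF Dv[OF LFv[OF that(1)] LFv[OF that(3)]] that(4)]] by simp
  qed
  have tors: "g p (D X Y p) (Z p) - g p (D Y X p) (Z p) = B (lbr x y) z" if "is_linv X x" "is_linv Y y" "is_linv Z z" "p \<in> M" for X Y Z x y z p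
  proof -
    have "D X Y p - D Y X p = vf_bracket M X Y p"
      using lc LFv that unfolding levi_civita_connection_def by blast
    then have "g p (D X Y p - D Y X p) (Z p) = B (lbr x y) z"
      using gB[OF that(4) is_linv_bracket[OF that(1,2)] that(3)] by (simp add: M_def)
    then show ?thesis
      using gdiff[OF that(4) tan[OF Dv[OF LFv[OF that(1)] LFv[OF that(2)]] that(4)] tan[OF Dv[OF LFv[OF that(2)] LFv[OF that(1)]] that(4)] tan[OF LFv[OF that(3)] that(4)]]
      by simp
  qed
  have koszul: "g p (D X Y p) (Z p) = kos B x y z" if "is_linv X x" "is_linv Y y" "is_linv Z z" "p \<in> M" for X Y Z x y z p
  proof -
    note L = that(1-3)
    show ?thesis
      using skew[OF L(1,2,3) that(4)] skew[OF L(2,1,3) that(4)] skew[OF L(3,1,2) that(4)]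
        tors[OF L(1,2,3) that(4)] tors[OF L(1,3,2) that(4)] tors[OF L(2,3,1) that(4)]
      unfolding kos_def by argo
  qed
  have "ric B m v y z = lam * B y z" if ad: "adapted B m v" for m v y z
  proof -
    define e where "e i = sqrt (m i) *\<^sub>R v i" for i
    have o: "orthonormal6 B e" and re: "ric B (\<lambda>_. 1) e y z = ric B m v y z"
      using adapted_orthonormal6[OF s ad] by (auto simp: e_def[abs_def])
    define E where "E i = linv (e i)" for i
    have LE: "is_linv (E i) (e i)" for i by (simp add: E_def is_linv_linv)
    define Y Z where "Y = linv y" and "Z = linv z"
    have LY: "is_linv Y y" and LZ: "is_linv Z z" by (simp_all add: Y_def Z_def is_linv_linv)
    have Xg: "linv x gone = io x" for x by (simp add: linv_def gmult_one)
    have spn: "span ((\<lambda>i. E i gone) ` {..<6}) = tangent_space M gone"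
    proof -
      have "(\<lambda>i. E i gone) ` {..<6} = io ` (e ` {..<6})" by (auto simp: E_def Xg)
      then have "span ((\<lambda>i. E i gone) ` {..<6}) = io ` span (e ` {..<6})" by (simp add: linear_span_image[OF io_linear])
      then show ?thesis using orthonormal6_span[OF b o] lie_alg_eq by (simp add: lie_alg_def M_def)
    qed
    have "lam * g gone (Y gone) (Z gone) = (\<Sum>i<6. g gone (curvature M D (E i) Y Z gone) (E i gone))"
      by (rule ric[where n=6 and E=E, OF goneM LFv[OF LY] LFv[OF LZ] _ _ spn])
        (use LFv[OF LE] gB[OF goneM LE LE] o in \<open>auto simp: orthonormal6_def\<close>)
    also have "\<dots> = (\<Sum>i<6. - (\<Sum>k<6. kos B y z (e k) * kos B (e i) (e i) (e k)) + (\<Sum>k<6. kos B (e i) z (e k) * kos B y (e i) (e k))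
      - kos B (lbr (e i) y) z (e i))"
    proof (rule sum.cong[OF refl])
      fix i
      have pars: "g gone (D X W gone) (D X' W' gone) = (\<Sum>k<6. kos B x w (e k) * kos B x' w' (e k))"
        if L: "is_linv X x" "is_linv W w" "is_linv X' x'" "is_linv W' w'" for X W X' W' x w x' w'
      proof -
        have "D X W gone \<in> lie_alg" "D X' W' gone \<in> lie_alg"
          using tan[OF Dv[OF LFv[OF L(1)] LFv[OF L(2)]] goneM] tan[OF Dv[OF LFv[OF L(3)] LFv[OF L(4)]] goneM] by (simp_all add: lie_alg_def M_def)
        then obtain d d' where d: "D X W gone = io d" "D X' W' gone = io d'" by (auto simp: lie_alg_eq simp del: split_paired_Ex split_paired_All)
        have k: "B d (e k) = kos B x w (e k)" "B d' (e k) = kos B x' w' (e k)" for k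
          using koszul[OF L(1,2) LE goneM, of k] koszul[OF L(3,4) LE goneM, of k] by (simp_all add: d E_def Xg B_def)
        have "B d d' = (\<Sum>k<6. B d (e k) * B (e k) d')"
          by (rule orthonormal6_parseval[OF b o bil_lin(1)[OF b]])
        then show ?thesis unfolding d k[symmetric] B_def[symmetric] using sym[of d'] by simp
      qed
      \<comment> \<open>The product of \<open>D W V\<close> with \<open>U\<close> is constant on the
        group, so metric compatibility moves the outer derivative onto \<open>U\<close> with a minus
        sign.\<close>
      have second: "g gone (D X (D W V) gone) (U gone) = - (\<Sum>k<6. kos B w v (e k) * kos B x u (e k))"
        if L: "is_linv X x" "is_linv W w" "is_linv V v" "is_linv U u" for X W V U x w v u
      proof -
        have "differential M (\<lambda>q. g q (D W V q) (U q)) gone (X gone) = 0"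
          by (rule const[of _ "kos B w v u"]) (use koszul[OF L(2-4)] tan[OF LFv[OF L(1)] goneM] in auto)
        then have "0 = g gone (D X (D W V) gone) (U gone) + g gone (D W V gone) (D X U gone)"
          using metric[OF LFv[OF L(1)] Dv[OF LFv[OF L(2)] LFv[OF L(3)]] LFv[OF L(4)] goneM] by simp
        then show ?thesis using pars[OF L(2,3,1,4)] by simp
      qed
      have LB: "is_linv (vf_bracket M (E i) Y) (lbr (e i) y)" using is_linv_bracket[OF LE LY] by (simp add: M_def)
      note v = LFv[OF LE[of i]] LFv[OF LY] LFv[OF LZ] LFv[OF LB]
      have t: "D (E i) (D Y Z) gone \<in> tangent_space M gone" "D Y (D (E i) Z) gone \<in> tangent_space M gone"
        "D (vf_bracket M (E i) Y) Z gone \<in> tangent_space M gone" "E i gone \<in> tangent_space M gone"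
        using tan[OF _ goneM] Dv v by blast+
      have "g gone (curvature M D (E i) Y Z gone) (E i gone)
        = g gone (D (E i) (D Y Z) gone) (E i gone) - g gone (D Y (D (E i) Z) gone) (E i gone) - g gone (D (vf_bracket M (E i) Y) Z gone) (E i gone)"
        unfolding curvature_def
        using gdiff[OF goneM subspace_diff[OF sub[OF goneM] t(1,2)] t(3,4)] gdiff[OF goneM t(1,2,4)] by simp
      then show "g gone (curvature M D (E i) Y Z gone) (E i gone) = - (\<Sum>k<6. kos B y z (e k) * kos B (e i) (e i) (e k))
         + (\<Sum>k<6. kos B (e i) z (e k) * kos B y (e i) (e k)) - kos B (lbr (e i) y) z (e i)"
        unfolding second[OF LE LY LZ LE] second[OF LY LE LZ LE] koszul[OF LB LZ LE goneM] by simp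
    qed
    also have "\<dots> = ric B (\<lambda>_. 1) e y z" by (rule koszul_ricci[OF s o])
    finally show ?thesis using re by (simp add: Y_def Z_def Xg B_def)
  qed
  then show ?thesis using s unfolding einst_def B_def[symmetric] by blast
qed

section \<open>Homotheties\<close>

lemma homotheticI:
  assumes c: "0 < c" and phi: "\<And>p. p \<in> S3xS3 \<Longrightarrow> \<phi> p \<in> S3xS3" and psi: "\<And>p. p \<in> S3xS3 \<Longrightarrow> \<psi> p \<in> S3xS3"
    and inv: "\<And>p. p \<in> S3xS3 \<Longrightarrow> \<psi> (\<phi> p) = p" "\<And>p. p \<in> S3xS3 \<Longrightarrow> \<phi> (\<psi> p) = p"
    and sm: "smooth S3xS3 \<phi>" "smooth S3xS3 \<psi>"
    and iso: "\<And>p x y. p \<in> S3xS3 \<Longrightarrow> h (\<phi> p) (differential S3xS3 \<phi> p (gmult p (io x))) (differential S3xS3 \<phi> p (gmult p (io y)))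
        = c * g p (gmult p (io x)) (gmult p (io y))"
  shows "homothetic S3xS3 g S3xS3 h"
proof -
  have inj: "inj_on \<phi> S3xS3" using inv(1) by (rule inj_on_inverseI)
  have im: "\<phi> ` S3xS3 = S3xS3" using phi psi inv(2) by (auto simp: image_iff) metis
  have "inv_into S3xS3 \<phi> q = \<psi> q" if "q \<in> S3xS3" for q
    using inv_into_f_f[OF inj psi[OF that]] inv(2)[OF that] by simp
  then have "smooth S3xS3 (inv_into S3xS3 \<phi>)" using sm(2) unfolding smooth_def by simp
  then have "diffeomorphism S3xS3 S3xS3 \<phi>" using inj im sm(1) by (simp add: diffeomorphism_def bij_betw_def)
  moreover have "h (\<phi> p) (differential S3xS3 \<phi> p u) (differential S3xS3 \<phi> p v) = c * g p u v"
    if "p \<in> S3xS3" "u \<in> tangent_space S3xS3 p" "v \<in> tangent_space S3xS3 p" for p u v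
    using that iso[OF that(1)] unfolding tangent_space_eq[OF that(1)] by blast
  ultimately have "isometry S3xS3 (\<lambda>p u v. c * g p u v) S3xS3 h \<phi>" unfolding isometry_def by blast
  then show ?thesis using c unfolding homothetic_def by blast
qed

definition qrot :: "real^3^3 \<Rightarrow> quat \<Rightarrow> quat" where "qrot A p = (fst p, A *v snd p)"

definition pair_rot :: "real^3^3 \<Rightarrow> real^3^3 \<Rightarrow> quat \<times> quat \<Rightarrow> quat \<times> quat" where "pair_rot A C p = (qrot A (fst p), qrot C (snd p))"

definition pswap :: "quat \<times> quat \<Rightarrow> quat \<times> quat" where "pswap p = (snd p, fst p)"

lemma rotation_inner: "rotation_matrix (A::real^3^3) \<Longrightarrow> (A *v x) \<bullet> (A *v y) = x \<bullet> y"
  using orthogonal_transformation_matrix[of "(*v) A"] by (simp add: rotation_matrix_def orthogonal_transformation_def)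

lemma rotation_transpose:
  assumes "rotation_matrix (A::real^3^3)"
  shows "rotation_matrix (transpose A)" "transpose A *v (A *v x) = x" "A *v (transpose A *v x) = x"
  using assms by (simp_all add: rotation_matrix_def orthogonal_matrix_transpose det_transpose matrix_vector_mul_assoc orthogonal_matrix_def
      del: transpose_matrix_vector)

lemma qrot_mult: "rotation_matrix A \<Longrightarrow> qrot A (qmult p q) = qmult (qrot A p) (qrot A q)"
  by (simp add: qrot_def qmult_def rotation_inner cross_rotation_matrix matrix_vector_right_distrib matrix_vector_mult_scaleR)

lemma pair_rot_linear: "linear (pair_rot A C)"
  by (rule linearI) (simp_all add: pair_rot_def qrot_def matrix_vector_right_distrib matrix_vector_mult_scaleR)

lemma pswap_linear: "linear pswap"
  by (rule linearI) (simp_all add: pswap_def)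

text \<open>The group automorphism \<open>\<Phi>\<close> integrates the inverse of \<open>F\<close>,
  since the isometry has to lead from the given metric to its normal form. It is linear on the
  ambient space, which makes smoothness trivial.\<close>

lemma aut_lift:
  assumes "F \<in> auts"
  obtains \<Phi> \<Psi> where "linear \<Phi>" "linear \<Psi>" "\<And>p. \<Psi> (\<Phi> p) = p" "\<And>p. \<Phi> (\<Psi> p) = p"
    "\<And>p. p \<in> S3xS3 \<Longrightarrow> \<Phi> p \<in> S3xS3" "\<And>p. p \<in> S3xS3 \<Longrightarrow> \<Psi> p \<in> S3xS3"
    "\<And>a b. \<Phi> (gmult a b) = gmult (\<Phi> a) (\<Phi> b)" "\<And>x. \<Phi> (io (F x)) = io x" "\<And>x. \<exists>x'. x = F x'"
proof -
  obtain A C where A: "rotation_matrix A" and C: "rotation_matrix C" and F: "F = rotp A C \<or> F = (\<lambda>x. rotp A C (vswap x))"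
    using assms unfolding auts_def by blast
  let ?A = "transpose A" and ?C = "transpose C"
  note t = rotation_transpose[OF A] rotation_transpose[OF C]
  have i: "pair_rot ?A ?C (pair_rot A C p) = p" "pair_rot A C (pair_rot ?A ?C p) = p" for p using t by (simp_all add: pair_rot_def qrot_def)
  have S: "pair_rot A C p \<in> S3xS3" "pair_rot ?A ?C p \<in> S3xS3" if "p \<in> S3xS3" for p
    using that rotation_inner[OF A] rotation_inner[OF C] rotation_inner[OF t(1)] rotation_inner[OF t(4)]
    by (simp_all add: S3xS3_iff pair_rot_def qrot_def inner_prod_def)
  have m: "pair_rot ?A ?C (gmult a b) = gmult (pair_rot ?A ?C a) (pair_rot ?A ?C b)" for a b
    using qrot_mult[OF t(1)] qrot_mult[OF t(4)] by (simp add: pair_rot_def gmult_def)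
  have io1: "pair_rot ?A ?C (io (rotp A C x)) = io x" for x
    using t by (simp add: pair_rot_def qrot_def io_def rotp_def matrix_vector_mult_scaleR)
  have sj: "x = rotp A C (rotp ?A ?C x)" for x using t by (simp add: rotp_def)
  from F show ?thesis
  proof
    assume F: "F = rotp A C"
    show ?thesis
    proof (rule that)
      show "\<exists>x'. x = F x'" for x unfolding F using sj by blast
      show "pair_rot ?A ?C (io (F x)) = io x" for x unfolding F by (rule io1)
    qed (fact pair_rot_linear i S m)+
  next
    assume F: "F = (\<lambda>x. rotp A C (vswap x))"
    have l: "linear (\<lambda>p. pswap (pair_rot ?A ?C p))" "linear (\<lambda>p. pair_rot A C (pswap p))"
      using linear_compose[OF pair_rot_linear pswap_linear] linear_compose[OF pswap_linear pair_rot_linear] by (simp_all add: o_def)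
    have ps: "pswap (pswap p) = p" "pswap p \<in> S3xS3 \<longleftrightarrow> p \<in> S3xS3" "pswap (gmult a b) = gmult (pswap a) (pswap b)" "pswap (io (vswap x)) = io x" for p a b x
      by (auto simp: pswap_def S3xS3_iff gmult_def io_def vswap_def)
    have sj': "x = rotp A C (vswap (vswap (rotp ?A ?C x)))" for x using sj by (simp add: vswap_vswap)
    show ?thesis
    proof (rule that[OF l])
      show "\<exists>x'. x = F x'" for x unfolding F using sj' by blast
    qed (simp_all add: i S m io1 ps F)
  qed
qed

lemma io_inner: "io x \<bullet> io y = q1 x y / 4"
  by (simp add: io_def q1_def inner_prod_def)

lemma gmult_inner: "p \<in> S3xS3 \<Longrightarrow> gmult p u \<bullet> gmult p v = u \<bullet> v"
  by (simp add: S3xS3_iff gmult_def inner_prod_def[of "(_,_)"] qmult_inner) (simp add: inner_prod_def)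

lemma homothetic_left_invariant:
  assumes F: "F \<in> auts" and k: "0 < k" and r: "0 < r"
    and g: "\<And>p x y. p \<in> S3xS3 \<Longrightarrow> g p (gmult p (io x)) (gmult p (io y)) = B x y"
    and h: "\<And>p x y. p \<in> S3xS3 \<Longrightarrow> h p (gmult p (io x)) (gmult p (io y)) = r * q x y"
    and B: "\<And>x y. B (F x) (F y) = k * q x y"
  shows "homothetic S3xS3 g S3xS3 h"
proof (rule aut_lift[OF F])
  fix \<Phi> \<Psi> assume lin: "linear \<Phi>" "linear \<Psi>" and inv: "\<And>p. \<Psi> (\<Phi> p) = p" "\<And>p. \<Phi> (\<Psi> p) = p"
    and S: "\<And>p. p \<in> S3xS3 \<Longrightarrow> \<Phi> p \<in> S3xS3" "\<And>p. p \<in> S3xS3 \<Longrightarrow> \<Psi> p \<in> S3xS3"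
    and m: "\<And>a b. \<Phi> (gmult a b) = gmult (\<Phi> a) (\<Phi> b)" and i: "\<And>x. \<Phi> (io (F x)) = io x" and sj: "\<And>x. \<exists>x'. x = F x'"
  show ?thesis
  proof (rule homotheticI[where \<phi>=\<Phi> and \<psi>=\<Psi> and c="r/k"])
    fix p :: "quat \<times> quat" and x y assume p: "p \<in> S3xS3"
    obtain x' y' where xy: "x = F x'" "y = F y'" using sj by blast
    have d: "differential S3xS3 \<Phi> p (gmult p (io (F z))) = gmult (\<Phi> p) (io z)" for z
      using differential_linear[OF lin(1) refl tangent_io[OF p, of "F z"]] by (simp add: m i)
    show "h (\<Phi> p) (differential S3xS3 \<Phi> p (gmult p (io x))) (differential S3xS3 \<Phi> p (gmult p (io y))) = r / k * g p (gmult p (io x)) (gmult p (io y))"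
      unfolding xy d h[OF S(1)[OF p]] g[OF p] B using k by simp
  next
    show "smooth S3xS3 \<Phi>" "smooth S3xS3 \<Psi>" using smooth_linear[OF lin(1)] smooth_linear[OF lin(2)] by simp_all
    show "0 < r / k" using k r by simp
  qed (fact S | rule inv)+
qed

lemma homothetic_can:
  assumes "F \<in> auts" "0 < k" "\<And>p x y. p \<in> S3xS3 \<Longrightarrow> g p (gmult p (io x)) (gmult p (io y)) = B x y"
    and "\<And>x y. B (F x) (F y) = k * q1 x y"
  shows "homothetic S3xS3 g S3xS3 g_can"
  \<comment> \<open>The factor \<open>1/4\<close> comes from the halving in
    \<open>io\<close>.\<close>
  by (rule homothetic_left_invariant[where r="1/4" and F=F and k=k and B=B and q=q1 and g=g, OF assms(1,2) _ assms(3) _ assms(4)])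
    (simp_all add: g_can_def gmult_inner io_inner)

lemma qcnj_mult: "qcnj (qmult a b) = qmult (qcnj b) (qcnj a)"
  by (simp add: qmult_def qcnj_def prod_eq_iff vec_eq_iff forall_3 cross3_def inner_vec_def sum_3 algebra_simps)

lemma qcnj_linear: "linear qcnj" by (rule linearI) (simp_all add: qcnj_def)

lemma qcnj_inner: "qcnj a \<bullet> qcnj a = a \<bullet> a" by (simp add: qcnj_def inner_prod_def)

text \<open>The map \<open>(p, q) \<mapsto> (p q\<^sup>-\<^sup>1, q)\<close> is not a homomorphism, but it pulls \<open>g_can\<close> back to a
  left-invariant metric.\<close>

lemma homothetic_twist:
  assumes F: "F \<in> auts" and k: "0 < k"
    and g: "\<And>p x y. p \<in> S3xS3 \<Longrightarrow> g p (gmult p (io x)) (gmult p (io y)) = B x y"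
    and B: "\<And>x y. B (F x) (F y) = k * q2 x y"
  shows "homothetic S3xS3 g S3xS3 g_can"
proof (rule aut_lift[OF F])
  fix \<Phi> \<Psi> assume lin: "linear \<Phi>" "linear \<Psi>" and inv: "\<And>p. \<Psi> (\<Phi> p) = p" "\<And>p. \<Phi> (\<Psi> p) = p"
    and S: "\<And>p. p \<in> S3xS3 \<Longrightarrow> \<Phi> p \<in> S3xS3" "\<And>p. p \<in> S3xS3 \<Longrightarrow> \<Psi> p \<in> S3xS3"
    and m: "\<And>a b. \<Phi> (gmult a b) = gmult (\<Phi> a) (\<Phi> b)" and i: "\<And>x. \<Phi> (io (F x)) = io x" and sj: "\<And>x. \<exists>x'. x = F x'"
  note qb = bilinear_ladd[OF qmult_bilinear] bilinear_radd[OF qmult_bilinear] bilinear_lmul[OF qmult_bilinear] bilinear_rmul[OF qmult_bilinear]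
    bilinear_lsub[OF qmult_bilinear] bilinear_rsub[OF qmult_bilinear] bilinear_rneg[OF qmult_bilinear] bilinear_lneg[OF qmult_bilinear]
  \<comment> \<open>With conjugation in place of inversion the twist and its inverse are linear plus
    quadratic on the whole ambient space, which gives their smoothness and differentials.\<close>
  define l where "l p = ((0::quat), snd (\<Phi> p))" for p
  define b where "b p r = (qmult (fst (\<Phi> p)) (qcnj (snd (\<Phi> r))), (0::quat))" for p r
  define \<phi> where "\<phi> p = l p + b p p" for p
  define l' where "l' p = \<Psi> ((0::quat), snd p)" for p :: "quat \<times> quat"
  define b' where "b' p r = \<Psi> (qmult (fst p) (snd r), (0::quat))" for p r :: "quat \<times> quat"
  define \<psi> where "\<psi> p = l' p + b' p p" for p
  have ll: "linear l" "linear l'"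
  proof -
    show "linear l" unfolding l_def by (rule linearI) (simp_all add: linear_add[OF lin(1)] linear_scale[OF lin(1)])
    have "linear (\<lambda>p::quat \<times> quat. ((0::quat), snd p))" by (rule linearI) simp_all
    from linear_compose[OF this lin(2)] show "linear l'" by (simp add: l'_def[abs_def] o_def)
  qed
  have bb: "bilinear b" "bilinear b'"
  proof -
    show "bilinear b" unfolding bilinear_def b_def
      by (intro conjI allI linearI) (simp_all add: qb linear_add[OF lin(1)] linear_scale[OF lin(1)] linear_add[OF qcnj_linear] linear_scale[OF qcnj_linear])
    have p: "\<Psi> (u + v, 0) = \<Psi> (u,0) + \<Psi> (v,0)" "\<Psi> (c *\<^sub>R u, 0) = c *\<^sub>R \<Psi> (u,0)" for u v :: quat and c
      using linear_add[OF lin(2), of "(u,0)" "(v,0)"] linear_scale[OF lin(2), of c "(u,0)"] by simp_all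
    show "bilinear b'" unfolding bilinear_def b'_def by (intro conjI allI linearI) (simp_all add: qb p)
  qed
  have phi: "\<phi> p = (qmult (fst (\<Phi> p)) (qcnj (snd (\<Phi> p))), snd (\<Phi> p))" for p by (simp add: \<phi>_def l_def b_def)
  have psi: "\<psi> p = \<Psi> (qmult (fst p) (snd p), snd p)" for p
    using linear_add[OF lin(2), of "(0, snd p)" "(qmult (fst p) (snd p), 0)"] by (simp add: \<psi>_def l'_def b'_def)
  have un: "fst p \<bullet> fst p = 1" "snd p \<bullet> snd p = 1" if "p \<in> S3xS3" for p using that S3xS3_iff by blast+
  show ?thesis
  proof (rule homotheticI[where \<phi>=\<phi> and \<psi>=\<psi> and c="1/(4*k)"])
    show "smooth S3xS3 \<phi>" by (rule smooth_quadratic[OF ll(1) bb(1)]) (simp add: \<phi>_def)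
    show "smooth S3xS3 \<psi>" by (rule smooth_quadratic[OF ll(2) bb(2)]) (simp add: \<psi>_def)
    show "0 < 1/(4*k)" using k by simp
  next
    fix p :: "quat \<times> quat" assume p: "p \<in> S3xS3"
    note u = un[OF p] un[OF S(1)[OF p]]
    show "\<phi> p \<in> S3xS3" using u by (simp add: phi S3xS3_iff qmult_inner qcnj_inner)
    show "\<psi> p \<in> S3xS3" unfolding psi by (rule S(2)) (use u in \<open>simp add: S3xS3_iff qmult_inner\<close>)
    show "\<psi> (\<phi> p) = p" unfolding psi phi
      using u by (simp add: qmult_assoc qmult_cnj qmult_one inv)
    show "\<phi> (\<psi> p) = p" unfolding psi phi inv
      using u by (simp add: qmult_assoc qmult_cnj qmult_one)
    fix x y
    obtain x' y' where xy: "x = F x'" "y = F y'" using sj by blast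
    let ?P = "\<Phi> p"
    \<comment> \<open>The product rule: conjugation changes the sign of imaginary quaternions,
      whence the difference in the first component. The outer multiplications by unit quaternions
      preserve norms, so the pullback is \<open>q2\<close> up to the factor
      \<open>1/4\<close>.\<close>
    have d: "differential S3xS3 \<phi> p (gmult p (io (F z)))
      = (qmult (qmult (fst ?P) (fst (io z) - snd (io z))) (qcnj (snd ?P)), qmult (snd ?P) (snd (io z)))" for z
    proof -
      let ?v = "gmult p (io (F z))"
      have V: "\<Phi> ?v = gmult ?P (io z)" by (simp add: m i)
      have c: "qcnj (snd (io z)) = - snd (io z)" by (simp add: io_def qcnj_def)
      have "differential S3xS3 \<phi> p ?v = l ?v + (b p ?v + b ?v p)"
        by (rule differential_eqI[OF quadratic_has_derivative[OF ll(1) bb(1)] _ tangent_io[OF p]]) (simp add: \<phi>_def)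
      also have "\<dots> = (qmult (fst ?P) (qmult (- snd (io z)) (qcnj (snd ?P))) + qmult (qmult (fst ?P) (fst (io z))) (qcnj (snd ?P)), qmult (snd ?P) (snd (io z)))"
        unfolding l_def b_def V by (simp add: gmult_def qcnj_mult c)
      finally show ?thesis by (simp add: qb flip: qmult_assoc)
    qed
    have "g_can (\<phi> p) (differential S3xS3 \<phi> p (gmult p (io x))) (differential S3xS3 \<phi> p (gmult p (io y))) = q2 x' y' / 4"
      unfolding g_can_def xy d using u
      by (simp add: inner_Pair qmult_inner qcnj_inner) (simp add: io_def q2_def inner_prod_def inner_diff_left inner_diff_right field_simps)
    then show "g_can (\<phi> p) (differential S3xS3 \<phi> p (gmult p (io x))) (differential S3xS3 \<phi> p (gmult p (io y))) = 1/(4*k) * g p (gmult p (io x)) (gmult p (io y))"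
      unfolding g[OF p] xy B using k by simp
  qed
qed

section \<open>The nearly Kaehler metric in coordinates\<close>

lemma nk_scalar_product: "scalar_product_of_basis nk_basis (io x) (io y) = 2 / sqrt 3 * q3 x y"
proof -
  let ?S = "scalar_product_of_basis nk_basis"
  define a b c where "a = root 4 3 / sqrt 2" and "b = 1 / (sqrt 2 * root 4 3)" and "c = sqrt 2 / root 4 (3::real)"
  have r4: "root 4 3 ^ 2 = sqrt 3"
    using real_root_mult_exp[of 2 2 "3::real"] by (simp flip: sqrt_def)
  have pos: "0 < a" "0 < b" "0 < c" by (simp_all add: a_def b_def c_def)
  have E: "io (vE i) = (1/a) *\<^sub>R nk_X i" for i
    using pos by (simp add: nk_X_def a_def[symmetric] io_def vE_def lie_E_def axis_def vec_eq_iff zero_prod_def)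
  have Y: "nk_Y i = b *\<^sub>R lie_E i + c *\<^sub>R lie_F i" for i by (simp add: nk_Y_def b_def c_def)
  have EL: "io (vE i) = lie_E i" and FL: "io (vF i) = lie_F i" for i
    by (simp_all add: io_def vE_def vF_def lie_E_def lie_F_def axis_def vec_eq_iff zero_prod_def)
  have F: "io (vF i) = (1/c) *\<^sub>R nk_Y i - (b/c) *\<^sub>R io (vE i)" for i
    using pos by (simp add: Y FL EL scaleR_add_right)
  note ind = independent_nk_basis
  have XS: "nk_X i \<in> nk_basis" "nk_Y i \<in> nk_basis" for i by (simp_all add: nk_basis_def)
  have sp: "nk_X i \<in> span nk_basis" "nk_Y i \<in> span nk_basis" for i using XS span_base by blast+
  have spE: "io (vE i) \<in> span nk_basis" for i unfolding E using sp span_scale by blast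
  have spF: "io (vF i) \<in> span nk_basis" for i unfolding F using sp spE span_scale span_diff by blast
  have spio: "io x \<in> span nk_basis" for x
  proof -
    have "io x = (\<Sum>i\<in>UNIV. fst x$i *\<^sub>R io (vE i)) + (\<Sum>i\<in>UNIV. snd x$i *\<^sub>R io (vF i))"
      by (subst vv_expand[of x]) (simp add: linear_add[OF io_linear] linear_sum[OF io_linear] linear_scale[OF io_linear])
    then show ?thesis using spE spF by (simp add: span_add span_sum span_scale)
  qed
  have add: "?S (u + v) w = ?S u w + ?S v w" "?S w (u + v) = ?S w u + ?S w v" if "u \<in> span nk_basis" "v \<in> span nk_basis" for u v w
    using that by (simp_all add: scalar_product_of_basis_def representation_add[OF ind] sum.distrib algebra_simps)
  have scale: "?S (t *\<^sub>R u) w = t * ?S u w" "?S w (t *\<^sub>R u) = t * ?S w u" if "u \<in> span nk_basis" for t u w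
    using that by (simp_all add: scalar_product_of_basis_def representation_scale[OF ind] sum_distrib_left algebra_simps)
  have diff: "?S (u - v) w = ?S u w - ?S v w" "?S w (u - v) = ?S w u - ?S w v" if "u \<in> span nk_basis" "v \<in> span nk_basis" for u v w
    using that by (simp_all add: scalar_product_of_basis_def representation_diff[OF ind] sum_subtractf algebra_simps)
  have bil: "bilinear (\<lambda>x y. ?S (io x) (io y))"
    unfolding bilinear_def
    by (intro conjI allI linearI) (simp_all add: linear_add[OF io_linear] linear_scale[OF io_linear] add scale spio)
  have ne: "nk_X i \<noteq> nk_Y j" for i j
  proof
    assume e: "nk_X i = nk_Y j"
    have "snd (snd (nk_Y j)) $ j = c / 2" by (simp add: Y lie_E_def lie_F_def)
    moreover have "snd (snd (nk_X i)) = 0" by (simp add: nk_X_def lie_E_def zero_prod_def)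
    ultimately show False using e pos by simp
  qed
  have eX: "nk_X i = nk_X j \<longleftrightarrow> i = j" for i j
    using pos by (auto simp: nk_X_def a_def[symmetric] lie_E_def axis_eq_axis)
  have eY: "nk_Y i = nk_Y j \<longleftrightarrow> i = j" for i j
    using pos by (auto simp: Y lie_E_def lie_F_def axis_eq_axis)
  have v: "?S (nk_X i) (nk_X j) = (if i = j then 1 else 0)" "?S (nk_Y i) (nk_Y j) = (if i = j then 1 else 0)"
    "?S (nk_X i) (nk_Y j) = 0" "?S (nk_Y j) (nk_X i) = 0" for i j
    using scalar_product_nk_basis XS ne ne[symmetric] eX eY by auto
  \<comment> \<open>By \<open>bc\<close>, the vector for \<open>vF i\<close> is
    \<open>(1/c) *\<^sub>R nk_Y i\<close> minus half the one for \<open>vE i\<close>. Thus its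
    product with the latter is \<open>-1/2\<close> of \<open>2/sqrt 3\<close>, and its squared
    length is \<open>3/4 + 1/4\<close> of \<open>2/sqrt 3\<close>: the coefficients of
    \<open>q3\<close>.\<close>
  have aa: "1/(a*a) = 2/sqrt 3" and cc: "1/(c*c) = sqrt 3/2" and bc: "b/c = 1/2"
    using r4 by (simp_all add: a_def b_def c_def field_simps power2_eq_square)
  have s3: "sqrt 3 / 2 = 3/4 * (2/sqrt 3)" by (simp add: field_simps)
  have EE: "?S (io (vE i)) (io (vE j)) = (if i = j then 2/sqrt 3 else 0)" for i j
    unfolding E using sp by (simp add: scale v aa[symmetric])
  have EY: "?S (io (vE i)) (nk_Y j) = 0" "?S (nk_Y j) (io (vE i)) = 0" for i j
    unfolding E using sp by (simp_all add: scale v)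
  have EF: "?S (io (vE i)) (io (vF j)) = (if i = j then - (1/2) * (2/sqrt 3) else 0)" "?S (io (vF j)) (io (vE i)) = (if i = j then - (1/2) * (2/sqrt 3) else 0)" for i j
    unfolding F[of j] bc using sp spE EE[of i j] EE[of j i] EY by (simp_all add: scale diff span_scale)
  have FF: "?S (io (vF i)) (io (vF j)) = (if i = j then 2/sqrt 3 else 0)" for i j
  proof -
    have "?S (io (vF i)) (io (vF j)) = (1/c)*((1/c) * ?S (nk_Y i) (nk_Y j)) + 1/2*(1/2*?S (io (vE i)) (io (vE j)))"
      unfolding F bc using sp spE EY by (simp add: scale diff span_scale)
    also have "\<dots> = (if i = j then 1/(c*c) + 1/4*(2/sqrt 3) else 0)" by (simp add: v EE)
    finally show ?thesis unfolding cc s3 by simp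
  qed
  define w where "w = 2 / sqrt 3"
  show ?thesis
    unfolding bilinear_expand[OF bil, of x y] EE EF FF w_def[symmetric] q3_def inner_vec_def
    by (simp add: sum_3 field_simps)
qed

lemma g_NK_value:
  assumes p: "p \<in> S3xS3"
  shows "g_NK p (gmult p (io x)) (gmult p (io y)) = 2 / sqrt 3 * q3 x y"
proof -
  have "linear (gmult (ginv p))" using gmult_bilinear unfolding bilinear_def by blast
  from differential_linear[OF this refl tangent_io[OF p]]
  have "differential S3xS3 (gmult (ginv p)) p (gmult p (io z)) = io z" for z
    using gmult_ginv[OF p] by (simp add: gmult_one flip: gmult_assoc)
  then show ?thesis by (simp add: g_NK_def left_extension_def nk_scalar_product)
qed

lemma canon_homothetic:
  assumes c: "canon B" and g: "\<And>p x y. p \<in> S3xS3 \<Longrightarrow> g p (gmult p (io x)) (gmult p (io y)) = B x y"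
  shows "homothetic S3xS3 g S3xS3 g_can \<or> homothetic S3xS3 g S3xS3 g_NK"
proof -
  obtain F k q where F: "F \<in> auts" and k: "0 < k" and q: "q = q1 \<or> q = q2 \<or> q = q3" and B: "\<And>x y. B (F x) (F y) = k * q x y"
    using c unfolding canon_def by blast
  from q show ?thesis
  proof (elim disjE)
    assume "q = q1" then show ?thesis using homothetic_can[where F=F and k=k and B=B and g=g] F k g B by blast
  next
    assume "q = q2" then show ?thesis using homothetic_twist[where F=F and k=k and B=B and g=g] F k g B by blast
  next
    assume q: "q = q3"
    have "homothetic S3xS3 g S3xS3 g_NK"
      by (rule homothetic_left_invariant[where r="2/sqrt 3" and q=q3 and B=B and g=g and F=F and k=k, OF F k _ g g_NK_value]) (use B q in auto)
    then show ?thesis by simp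
  qed
qed

section \<open>The adjoint group\<close>

definition adj :: "quat \<times> quat \<Rightarrow> vv \<Rightarrow> vv" where
  "adj a x = (rodr (fst (fst a)) (snd (fst a)) (fst x), rodr (fst (snd a)) (snd (snd a)) (snd x))"

lemma qmult_conjugate: "qmult (qmult a (0, u)) (qcnj a) = (0, rodr (fst a) (snd a) u)"
  by (simp add: qmult_def qcnj_def rodr_def prod_eq_iff vec_eq_iff forall_3 cross3_def inner_vec_def sum_3 power2_eq_square algebra_simps)

lemma gmult_conjugate: "gmult (gmult a (io x)) (ginv a) = io (adj a x)"
  by (simp add: gmult_def ginv_def io_def adj_def qmult_conjugate)
    (simp add: rodr_def cross_mult_right scaleR_add_right)

lemma io_inj: "io x = io y \<longleftrightarrow> x = y"
  by (simp add: io_def prod_eq_iff)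

lemma ginv_gmult: "ginv (gmult a b) = gmult (ginv b) (ginv a)"
  by (simp add: gmult_def ginv_def qcnj_mult)

lemma adj_gmult: "adj (gmult a b) x = adj a (adj b x)"
  unfolding io_inj[symmetric, of _ "adj a (adj b x)"] gmult_conjugate[symmetric] ginv_gmult by (simp only: gmult_assoc)

lemma adj_gone: "adj gone x = x"
  by (simp add: adj_def gone_def rodr_def)

lemma io_in_lie_alg: "io x \<in> lie_alg"
  using lie_alg_eq by blast

lemma lie_algE:
  assumes "v \<in> lie_alg" obtains x where "v = io x"
  using assms lie_alg_eq by blast

lemma Ad_io: "Ad a (io x) = io (adj a x)"
proof -
  have l: "linear (\<lambda>y. gmult (gmult a y) (ginv a))"
    by (rule linearI)
      (simp_all add: bilinear_ladd[OF gmult_bilinear] bilinear_radd[OF gmult_bilinear] bilinear_lmul[OF gmult_bilinear] bilinear_rmul[OF gmult_bilinear])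
  show ?thesis
    using differential_linear[OF l refl tangent_gone[of x]] by (simp add: Ad_def gmult_conjugate io_in_lie_alg)
qed

lemma Ad_extensional: "Ad a \<in> extensional lie_alg"
  by (simp add: Ad_def)

lemma Ad_eqI:
  assumes "\<And>x. adj a x = adj b x"
  shows "Ad a = Ad b"
proof (rule extensionalityI[OF Ad_extensional Ad_extensional])
  fix v assume "v \<in> lie_alg"
  then obtain x where "v = io x" by (rule lie_algE)
  then show "Ad a v = Ad b v" using assms by (simp add: Ad_io)
qed

lemma Ad_Bij:
  assumes "a \<in> S3xS3"
  shows "Ad a \<in> Bij lie_alg"
proof -
  have i: "adj (ginv a) (adj a x) = x" "adj a (adj (ginv a) x) = x" for x
    using gmult_ginv[OF assms] adj_gone by (simp_all flip: adj_gmult)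
  have "inj_on (Ad a) lie_alg"
    unfolding inj_on_def lie_alg_eq using i by (metis (no_types, lifting) Ad_io io_inj imageE)
  moreover have "Ad a ` lie_alg = lie_alg"
  proof
    show "Ad a ` lie_alg \<subseteq> lie_alg" using Ad_io io_in_lie_alg by (metis image_subsetI lie_algE)
    show "lie_alg \<subseteq> Ad a ` lie_alg"
    proof
      fix v assume "v \<in> lie_alg"
      then obtain x where "v = io x" by (rule lie_algE)
      then have "v = Ad a (io (adj (ginv a) x))" by (simp add: Ad_io i)
      then show "v \<in> Ad a ` lie_alg" using io_in_lie_alg by blast
    qed
  qed
  ultimately show ?thesis by (simp add: Bij_def bij_betw_def Ad_extensional)
qed

lemma Ad_group_mult:
  assumes "a \<in> S3xS3" "b \<in> S3xS3"
  shows "Ad a \<otimes>\<^bsub>Ad_group\<^esub> Ad b = Ad (gmult a b)"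
proof -
  have "compose lie_alg (Ad a) (Ad b) = Ad (gmult a b)"
  proof (rule extensionalityI[OF compose_extensional Ad_extensional])
    fix v assume v: "v \<in> lie_alg"
    then obtain x where "v = io x" by (rule lie_algE)
    then show "compose lie_alg (Ad a) (Ad b) v = Ad (gmult a b) v"
      using v by (simp add: compose_eq Ad_io adj_gmult)
  qed
  then show ?thesis using assms by (simp add: Ad_group_def BijGroup_def Ad_Bij)
qed

lemma Ad_group_one: "\<one>\<^bsub>Ad_group\<^esub> = Ad gone"
proof -
  have "(\<lambda>x\<in>lie_alg. x) = Ad gone"
  proof (rule extensionalityI[OF restrict_extensional Ad_extensional])
    fix v assume v: "v \<in> lie_alg"
    then obtain x where "v = io x" by (rule lie_algE)
    then show "(\<lambda>x\<in>lie_alg. x) v = Ad gone v" using v by (simp add: Ad_io adj_gone)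
  qed
  then show ?thesis by (simp add: Ad_group_def BijGroup_def)
qed

lemma iso_integer_mod_group_2:
  assumes car: "carrier H = {e, f}" and ne: "e \<noteq> f"
    and "e \<otimes>\<^bsub>H\<^esub> e = e" "e \<otimes>\<^bsub>H\<^esub> f = f" "f \<otimes>\<^bsub>H\<^esub> e = f" "f \<otimes>\<^bsub>H\<^esub> f = e"
  shows "H \<cong> integer_mod_group 2"
proof -
  define h :: "_ \<Rightarrow> int" where "h x = (if x = e then 0 else 1)" for x
  have "h \<in> hom H (integer_mod_group 2)"
    using assms by (auto simp: hom_def h_def carrier_integer_mod_group mult_integer_mod_group)
  moreover have "bij_betw h (carrier H) (carrier (integer_mod_group 2))"
    using ne by (auto simp: bij_betw_def car h_def carrier_integer_mod_group inj_on_def image_iff)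
  ultimately show ?thesis by (auto simp: is_iso_def iso_def)
qed

section \<open>Symmetries supplied by the group\<close>

lemma unit_axis_angle:
  fixes w :: "real^3" assumes "w \<noteq> 0"
  obtains n s where "w = s *\<^sub>R n" "norm n = 1" "s \<noteq> 0" "s^2 = w \<bullet> w"
proof
  show "w = norm w *\<^sub>R (w /\<^sub>R norm w)" "norm (w /\<^sub>R norm w) = 1" "norm w \<noteq> 0" "(norm w)^2 = w \<bullet> w"
    using assms by (simp_all add: power2_norm_eq_inner)
qed

text \<open>The set \<open>T\<close> plays the preimage of the group in \<open>S3xS3\<close>, so it
  may contain elements acting trivially. If no normal form existed, every nontrivial element would
  be a half-turn in both factors. For \<open>a\<close>, \<open>b\<close> and their product this
  makes the axes of \<open>a\<close> and \<open>b\<close> orthogonal, and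
  \<open>involutions_canon\<close> applies.\<close>

lemma canon_of_symmetries:
  assumes e: "einst B"
    and T: "T \<subseteq> S3xS3" "\<And>a b. a \<in> T \<Longrightarrow> b \<in> T \<Longrightarrow> gmult a b \<in> T"
    and inv: "\<And>a x y. a \<in> T \<Longrightarrow> B (adj a x) (adj a y) = B x y"
    and ab: "a \<in> T" "b \<in> T" "Ad a \<noteq> Ad gone" "Ad b \<noteq> Ad gone" "Ad (gmult a b) \<noteq> Ad gone"
  shows "canon B"
proof (rule ccontr)
  assume no: "\<not> canon B"
  have unit: "(fst (fst a))^2 + snd (fst a) \<bullet> snd (fst a) = 1" "(fst (snd a))^2 + snd (snd a) \<bullet> snd (snd a) = 1" if "a \<in> T" for a
    using that T(1) S3xS3_iff[of a] by (auto simp: inner_prod_def power2_eq_square)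
  have one: "snd (fst a) = 0 \<longleftrightarrow> snd (snd a) = 0" if a: "a \<in> T" for a
  proof (rule ccontr)
    assume "\<not> ?thesis"
    then consider "snd (fst a) \<noteq> 0" "snd (snd a) = 0" | "snd (fst a) = 0" "snd (snd a) \<noteq> 0" by blast
    then show False
    proof cases
      case 1
      obtain n s where n: "snd (fst a) = s *\<^sub>R n" "norm n = 1" "s \<noteq> 0" "s^2 = snd (fst a) \<bullet> snd (fst a)" using unit_axis_angle[OF 1(1)] by blast
      have "adj a x = (rodr (fst (fst a)) (s *\<^sub>R n) (fst x), snd x)" for x
        using 1 n(1) unit(2)[OF a] by (simp add: adj_def rodr_zero)
      then have "canon B" using one_sided_canon[OF e n(2) _ n(3), of "fst (fst a)"] inv[OF a] unit(1)[OF a] n(4) by simp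
      then show False using no by blast
    next
      case 2
      obtain n s where n: "snd (snd a) = s *\<^sub>R n" "norm n = 1" "s \<noteq> 0" "s^2 = snd (snd a) \<bullet> snd (snd a)" using unit_axis_angle[OF 2(2)] by blast
      have "adj a (vswap x) = vswap (rodr (fst (snd a)) (s *\<^sub>R n) (fst x), snd x)" for x
        using 2 n(1) unit(1)[OF a] by (simp add: adj_def rodr_zero vswap_def)
      then have "B (vswap (rodr (fst (snd a)) (s *\<^sub>R n) (fst x), snd x)) (vswap (rodr (fst (snd a)) (s *\<^sub>R n) (fst y), snd y)) = B (vswap x) (vswap y)" for x y
        using inv[OF a, of "vswap x" "vswap y"] by simp
      then have "canon (\<lambda>x y. B (vswap x) (vswap y))"
        using one_sided_canon[OF einst_aut[OF e lie_aut_vswap] n(2) _ n(3), of "fst (snd a)"] unit(2)[OF a] n(4) by simp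
      then show False using no canon_vswap by blast
    qed
  qed
  have pure: "fst (fst a) = 0 \<and> fst (snd a) = 0 \<and> norm (snd (fst a)) = 1 \<and> norm (snd (snd a)) = 1"
    if a: "a \<in> T" and nt: "Ad a \<noteq> Ad gone" for a
  proof -
    have nz: "snd (fst a) \<noteq> 0" "snd (snd a) \<noteq> 0"
    proof -
      have False if "snd (fst a) = 0" "snd (snd a) = 0"
        using nt Ad_eqI[of a gone] that unit[OF a] by (simp add: adj_gone) (simp add: adj_def rodr_zero)
      then show "snd (fst a) \<noteq> 0" "snd (snd a) \<noteq> 0" using one[OF a] by blast+
    qed
    obtain n s where n: "snd (fst a) = s *\<^sub>R n" "norm n = 1" "s \<noteq> 0" "s^2 = snd (fst a) \<bullet> snd (fst a)" using unit_axis_angle[OF nz(1)] by blast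
    obtain m r where m: "snd (snd a) = r *\<^sub>R m" "norm m = 1" "r \<noteq> 0" "r^2 = snd (snd a) \<bullet> snd (snd a)" using unit_axis_angle[OF nz(2)] by blast
    have "\<not> (fst (fst a) \<noteq> 0 \<and> fst (snd a) \<noteq> 0)"
    proof
      assume c: "fst (fst a) \<noteq> 0 \<and> fst (snd a) \<noteq> 0"
      have "canon B"
        by (rule two_sided_canon[OF e n(2) m(2), of "fst (fst a)" s "fst (snd a)" r])
          (use c n m unit[OF a] inv[OF a] in \<open>simp_all add: adj_def\<close>)
      then show False using no by blast
    qed
    \<comment> \<open>If only one of the two rotations were a half-turn, the square would rotate
      just one factor, against \<open>one\<close>.\<close>
    moreover have "fst (fst a) = 0 \<longleftrightarrow> fst (snd a) = 0"
      using one[OF T(2)[OF a a]] nz by (simp add: gmult_def qmult_def flip: scaleR_add_left)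
    ultimately show ?thesis using unit[OF a] by (auto simp: norm_eq_1)
  qed
  \<comment> \<open>The real part of a product of imaginary quaternions is minus their inner
    product, so the last instance says that the axes are orthogonal in both factors.\<close>
  note p = pure[OF ab(1,3)] pure[OF ab(2,4)] pure[OF T(2)[OF ab(1,2)] ab(5)]
  have "canon B"
    by (rule involutions_canon[OF e, of "snd (fst a)" "snd (fst b)" "snd (snd a)" "snd (snd b)"])
      (use p inv[OF ab(1)] inv[OF ab(2)] in \<open>simp_all add: adj_def gmult_def qmult_def\<close>)
  then show False using no by blast
qed

theorem theorem2:
  fixes g :: "(quat \<times> quat) metric_tensor"
    and \<Gamma> :: "(quat \<times> quat \<Rightarrow> quat \<times> quat) set"
  assumes "einstein_metric S3xS3 g"
    and "left_invariant g"
    and "subgroup \<Gamma> Ad_group"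
    and "finite \<Gamma>"
    and "\<Gamma> \<noteq> {\<one>\<^bsub>Ad_group\<^esub>}"
    and "\<not> Ad_group\<lparr>carrier := \<Gamma>\<rparr> \<cong> integer_mod_group 2"
    and "invariant_under \<Gamma> g"
  shows "homothetic S3xS3 g S3xS3 g_can \<or> homothetic S3xS3 g S3xS3 g_NK"
proof -
  let ?B = "\<lambda>x y. g gone (io x) (io y)"
  define T where "T = {a \<in> S3xS3. Ad a \<in> \<Gamma>}"
  have im: "\<exists>a\<in>T. \<phi> = Ad a" if "\<phi> \<in> \<Gamma>" for \<phi>
    using subgroup.subset[OF assms(3)] that unfolding T_def by (auto simp: Ad_group_def simp del: split_paired_Ex)
  have T: "T \<subseteq> S3xS3" by (auto simp: T_def)
  have mult: "gmult a b \<in> T" if "a \<in> T" "b \<in> T" for a b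
    using that subgroup.m_closed[OF assms(3), of "Ad a" "Ad b"] by (simp add: T_def gmult_S3 Ad_group_mult)
  have inv: "?B (adj a x) (adj a y) = ?B x y" if "a \<in> T" for a x y
    using assms(7) that io_in_lie_alg unfolding invariant_under_def T_def by (simp flip: Ad_io)
  have one: "Ad gone \<in> \<Gamma>" using subgroup.one_closed[OF assms(3)] by (simp add: Ad_group_one)
  obtain \<phi> where "\<phi> \<in> \<Gamma>" "\<phi> \<noteq> Ad gone" using assms(5) one unfolding Ad_group_one by blast
  then obtain a where a: "a \<in> T" "Ad a \<noteq> Ad gone" using im by blast
  \<comment> \<open>Otherwise any two nontrivial elements have trivial product, and then
    \<open>b = (a a) b = a (a b) = a\<close> leaves a group of order two. The choice
    \<open>a = b\<close> is allowed, which covers elements of order greater than two.\<close>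
  have "\<exists>a\<in>T. \<exists>b\<in>T. Ad a \<noteq> Ad gone \<and> Ad b \<noteq> Ad gone \<and> Ad (gmult a b) \<noteq> Ad gone"
  proof (rule ccontr)
    assume "\<not> ?thesis"
    then have tr: "Ad (gmult b c) = Ad gone" if "b \<in> T" "c \<in> T" "Ad b \<noteq> Ad gone" "Ad c \<noteq> Ad gone" for b c
      using that by blast
    note S = subsetD[OF T]
    have cong: "Ad (gmult b c) = Ad (gmult b' c')" if "b \<in> T" "c \<in> T" "b' \<in> T" "c' \<in> T" "Ad b = Ad b'" "Ad c = Ad c'" for b c b' c'
      using that S Ad_group_mult by metis
    have gT: "gone \<in> T" using one gone_S3 by (simp add: T_def)
    have eq: "Ad b = Ad a" if b: "b \<in> T" "Ad b \<noteq> Ad gone" for b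
    proof -
      have "Ad b = Ad (gmult (gmult a a) b)"
        using cong[of gone b "gmult a a" b] tr[of a a] a b gT mult by (simp add: gmult_one)
      also have "\<dots> = Ad (gmult a gone)"
        using cong[of a "gmult a b" a gone] tr[of a b] a b gT mult by (simp add: gmult_assoc)
      finally show ?thesis by (simp add: gmult_one)
    qed
    have "\<Gamma> = {Ad gone, Ad a}"
    proof
      show "\<Gamma> \<subseteq> {Ad gone, Ad a}"
      proof
        fix \<phi> assume "\<phi> \<in> \<Gamma>"
        then obtain b where "b \<in> T" "\<phi> = Ad b" using im by metis
        then show "\<phi> \<in> {Ad gone, Ad a}" using eq[of b] by (cases "\<phi> = Ad gone") simp_all
      qed
      show "{Ad gone, Ad a} \<subseteq> \<Gamma>" using one a(1) by (simp add: T_def)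
    qed
    then have "Ad_group\<lparr>carrier := \<Gamma>\<rparr> \<cong> integer_mod_group 2"
      using a tr[OF a(1) a(1) a(2) a(2)] S[OF a(1)] gone_S3
      by (intro iso_integer_mod_group_2[of _ "Ad gone" "Ad a"]) (auto simp: Ad_group_mult gmult_one)
    then show False using assms(6) by blast
  qed
  then obtain a b where "a \<in> T" "b \<in> T" "Ad a \<noteq> Ad gone" "Ad b \<noteq> Ad gone" "Ad (gmult a b) \<noteq> Ad gone"
    by (elim bexE conjE)
  from canon_of_symmetries[OF einst_of_metric[OF assms(1,2)] T mult inv this]
  have "canon ?B" .
  then show ?thesis by (rule canon_homothetic) (rule left_invariant_value[OF assms(2)])
qed

end
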